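(* Let $d\in\mathbb{N}$ and let $\{\mathbf{x}_t\}_{t\ge1}$ be a non-stochastic sequence of vectors $\mathbf{x}_t^\top=(x_{1t},\dots,x_{dt})\in\mathbb{R}^{1\times d}$. For $T\in\mathbb{N}$ let $\mathbf{X}_T\in\mathbb{R}^{T\times d}$ have rows $\mathbf{x}_1^\top,\dots,\mathbf{x}_T^\top$, let $s_{iT}^2=\sum_{t=1}^T x_{it}^2$, let $\mathbf{S}_T=\mathrm{diag}(s_{1T},\dots,s_{dT})$ and $\mathbf{Z}_T=\mathbf{X}_T\mathbf{S}_T^{-1}$. Assume the Grenander conditions: (G1) $\lim_{T\to\infty}s_{iT}^2=\infty$ for each $i\in[d]$; (G2) $\lim_{T\to\infty}x_{iT}^2/s_{iT}^2=0$ for each $i\in[d]$; (G3) for each $i,j\in[d]$ and each integer $k\ge0$, the limit $\rho_{ij}(k)=\lim_{T\to\infty}(s_{iT}s_{jT})^{-1}\sum_{t=1}^{T-k}x_{it}x_{j,t+k}$ exists; set $\rho_{ij}(-k)=\rho_{ji}(k)$ and let $\mathbf{R}(k)$ be the $d\times d$ matrix with entries $\rho_{ij}(k)$; (G4) $\mathbf{R}(0)$ is non-singular. Let $\mathbf{H}(\omega)$, $\omega\in[-\pi,\pi]$, be a Hermitian-matrix-valued function with positive semidefinite increments such that $\mathbf{R}(k)=\int_{-\pi}^{\pi}e^{\iota k\omega}\,\mathrm{d}\mathbf{H}(\omega)$ for all integers $k$ ($\iota=\sqrt{-1}$). Let $\bm\beta\in\mathbb{R}^d$ be non-stochastic and $Y_t=\mathbf{x}_t^\top\bm\beta+U_t$,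 $\mathbf{y}_T=(Y_1,\dots,Y_T)^\top$, $\mathbf{u}_T=(U_1,\dots,U_T)^\top$, where: (M1) $U_t=\sum_{i=-\infty}^{\infty}\theta_iE_{t-i}$, with $\{E_t\}_{t\in\mathbb{Z}}$ an independent sequence with $\mathbb{E}(E_t)=0$, $\mathrm{var}(E_t)=\sigma^2<\infty$, $\sum_{i}|\theta_i|<\infty$, and $\left|\sum_{i=-\infty}^\infty\theta_ie^{-\iota i\omega}\right|>0$ for all $\omega\in[-\pi,\pi]$; (M2) the distribution functions $F_{E_t}$ of $E_t$ satisfy $\lim_{\delta\to\infty}\sup_{t\in\mathbb{Z}}\int_{|e|>\delta}e^2\,\mathrm{d}F_{E_t}(e)=0$. Let $\{V_t\}_{t\in\mathbb{Z}}$ be a stationary process with autocovariances $\eta_i=\mathrm{cov}(V_t,V_{t+i})$ ($\eta_{-i}=\eta_i$) and spectral density $f_v(\omega)=(2\pi)^{-1}\sum_{i=-\infty}^\infty\eta_ie^{-\iota i\omega}$, such that (M3) $f_v$ is real, positive, continuous and even on $[-\pi,\pi]$; (M4) $\sum_{i=1}^\infty i|\eta_i|<\infty$. Let $\bm\Lambda_T$ be the $T\times T$ Toeplitz matrix with $(s,t)$ entry $\eta_{|s-t|}$, let $\bm\Sigma_T=\mathbb{E}(\mathbf{u}_T\mathbf{u}_T^\top)$, let $f_u$ be the spectral density of $\{U_t\}$, and define the estimator $\tilde{\bm\beta}_T(f_v)=(\mathbf{X}_T^\top\bm\Lambda_T^{-1}\mathbf{X}_T)^{-1}\mathbf{X}_T^\top\bm\Lambda_T^{-1}\mathbf{y}_T$.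 Then \[\mathbf{S}_T\big(\tilde{\bm\beta}_T(f_v)-\bm\beta\big)\xrightarrow{\mathcal{L}}\mathrm{N}(\mathbf{0},\mathbf{C}_v)\quad(T\to\infty),\] where \[ \mathbf{C}_v=\lim_{T\to\infty}(\mathbf{Z}_T^\top\bm\Lambda_T^{-1}\mathbf{Z}_T)^{-1}\mathbf{Z}_T^\top\bm\Lambda_T^{-1}\bm\Sigma_T\bm\Lambda_T^{-1}\mathbf{Z}_T(\mathbf{Z}_T^\top\bm\Lambda_T^{-1}\mathbf{Z}_T)^{-1} =2\pi\left[\int_{-\pi}^{\pi}\frac{\mathrm{d}\mathbf{H}(\omega)}{f_v(\omega)}\right]^{-1}\int_{-\pi}^{\pi}\frac{f_u(\omega)}{f_v^2(\omega)}\mathrm{d}\mathbf{H}(\omega)\left[\int_{-\pi}^{\pi}\frac{\mathrm{d}\mathbf{H}(\omega)}{f_v(\omega)}\right]^{-1}.\]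
   Context: $[n]=\{1,\dots,n\}$. $\iota$ is the imaginary unit. $\xrightarrow{\mathcal{L}}$ denotes convergence in law; $\mathrm{N}(\mathbf{0},\mathbf{C})$ is the multivariate normal distribution with mean $\mathbf{0}$ and covariance $\mathbf{C}$. The spectral density of a stationary process with autocovariances $\gamma_i$ is $(2\pi)^{-1}\sum_i\gamma_ie^{-\iota i\omega}$. *)

theory Defs
  imports "HOL-Probability.Probability"
begin

definition RS_tagged_partition :: "real \<Rightarrow> real \<Rightarrow> real list \<Rightarrow> real list \<Rightarrow> bool" where
  "RS_tagged_partition a b p \<tau> \<longleftrightarrow>
     length p \<ge> 2 \<and> hd p = a \<and> last p = b \<and> sorted_wrt (<) p \<and>
     length \<tau> = length p - 1 \<and>
     (\<forall>k < length \<tau>. p ! k \<le> \<tau> ! k \<and> \<tau> ! k \<le> p ! (k + 1))"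

definition RS_mesh :: "real list \<Rightarrow> real" where
  "RS_mesh p = Max ({p ! (k + 1) - p ! k | k. k < length p - 1} \<union> {0})"

definition RS_sum :: "(real \<Rightarrow> complex) \<Rightarrow> (real \<Rightarrow> complex) \<Rightarrow> real list \<Rightarrow> real list \<Rightarrow> complex" where
  "RS_sum g F p \<tau> = (\<Sum>k < length p - 1. g (\<tau> ! k) * (F (p ! (k + 1)) - F (p ! k)))"

definition has_RS_integral :: "(real \<Rightarrow> complex) \<Rightarrow> (real \<Rightarrow> complex) \<Rightarrow> real \<Rightarrow> real \<Rightarrow> complex \<Rightarrow> bool" where
  "has_RS_integral g F a b I \<longleftrightarrow>
     (\<forall>\<epsilon>>0. \<exists>\<delta>>0. \<forall>p \<tau>. RS_tagged_partition a b p \<tau> \<and> RS_mesh p < \<delta> \<longrightarrow>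
         norm (RS_sum g F p \<tau> - I) < \<epsilon>)"

definition RS_integral :: "(real \<Rightarrow> complex) \<Rightarrow> (real \<Rightarrow> complex) \<Rightarrow> real \<Rightarrow> real \<Rightarrow> complex" where
  "RS_integral g F a b = (THE I. has_RS_integral g F a b I)"

definition RS_integral_mat ::
  "(real \<Rightarrow> complex) \<Rightarrow> (real \<Rightarrow> complex^'d^'d) \<Rightarrow> real \<Rightarrow> real \<Rightarrow> complex^'d^'d" where
  "RS_integral_mat g H a b = (\<chi> i j. RS_integral g (\<lambda>w. H w $ i $ j) a b)"

definition spec_dens :: "(int \<Rightarrow> real) \<Rightarrow> real \<Rightarrow> complex" where
  "spec_dens \<gamma> w = (1 / (2 * complex_of_real pi)) *
      (\<Sum>\<^sub>\<infinity> i \<in> (UNIV :: int set). complex_of_real (\<gamma> i) * exp (- \<i> * of_int i * of_real w))"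

definition cov :: "'a measure \<Rightarrow> ('a \<Rightarrow> real) \<Rightarrow> ('a \<Rightarrow> real) \<Rightarrow> real" where
  "cov M X Y = (\<integral>\<omega>. (X \<omega> - (\<integral>\<omega>'. X \<omega>' \<partial>M)) * (Y \<omega> - (\<integral>\<omega>'. Y \<omega>' \<partial>M)) \<partial>M)"

definition lin_proc :: "(int \<Rightarrow> real) \<Rightarrow> (int \<Rightarrow> 'a \<Rightarrow> real) \<Rightarrow> int \<Rightarrow> 'a \<Rightarrow> real" where
  "lin_proc \<theta> E t \<omega> = (\<Sum>\<^sub>\<infinity> i \<in> (UNIV :: int set). \<theta> i * E (t - i) \<omega>)"

definition sq_inv :: "nat \<Rightarrow> (nat \<Rightarrow> nat \<Rightarrow> real) \<Rightarrow> (nat \<Rightarrow> nat \<Rightarrow> real)" where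
  "sq_inv n A = (SOME B. \<forall>s\<in>{1..n}. \<forall>t\<in>{1..n}.
       (\<Sum>k=1..n. A s k * B k t) = (if s = t then 1 else 0) \<and>
       (\<Sum>k=1..n. B s k * A k t) = (if s = t then 1 else 0))"

definition s_norm :: "(nat \<Rightarrow> real^'d) \<Rightarrow> nat \<Rightarrow> 'd \<Rightarrow> real" where
  "s_norm x T i = sqrt (\<Sum>t=1..T. (x t $ i)^2)"

definition rho_pos :: "(nat \<Rightarrow> real^'d) \<Rightarrow> 'd \<Rightarrow> 'd \<Rightarrow> nat \<Rightarrow> nat \<Rightarrow> real" where
  "rho_pos x i j k T = (\<Sum>t=1..T-k. x t $ i * x (t + k) $ j) / (s_norm x T i * s_norm x T j)"

definition grenander_rho :: "(nat \<Rightarrow> real^'d) \<Rightarrow> 'd \<Rightarrow> 'd \<Rightarrow> int \<Rightarrow> real" where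
  "grenander_rho x i j k =
     (if k \<ge> 0 then lim (rho_pos x i j (nat k)) else lim (rho_pos x j i (nat (- k))))"

definition R_mat :: "(nat \<Rightarrow> real^'d) \<Rightarrow> int \<Rightarrow> real^'d^'d" where
  "R_mat x k = (\<chi> i j. grenander_rho x i j k)"

definition std_normal_vec :: "(real^'d) measure" where
  "std_normal_vec = density lborel
     (\<lambda>(z::real^'d). ennreal ((2 * pi) powr (- real CARD('d) / 2) * exp (- (norm z * norm z) / 2)))"

definition mvn :: "real^'d^'d \<Rightarrow> (real^'d) measure" where
  "mvn C = distr std_normal_vec borel (\<lambda>z. (SOME L::real^'d^'d. L ** transpose L = C) *v z)"

definition conv_in_law :: "'a measure \<Rightarrow> (nat \<Rightarrow> 'a \<Rightarrow> real^'d) \<Rightarrow> (real^'d) measure \<Rightarrow> bool" where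
  "conv_in_law M X \<mu> \<longleftrightarrow>
     (\<forall>g :: real^'d \<Rightarrow> real. continuous_on UNIV g \<and> bounded (range g) \<longrightarrow>
        (\<lambda>T. \<integral>\<omega>. g (X T \<omega>) \<partial>M) \<longlonglongrightarrow> (\<integral>z. g z \<partial>\<mu>))"


definition toep_inv :: "(int \<Rightarrow> real) \<Rightarrow> nat \<Rightarrow> nat \<Rightarrow> nat \<Rightarrow> real" where
  "toep_inv \<eta> T = sq_inv T (\<lambda>p q. \<eta> \<bar>int p - int q\<bar>)"

definition gls_est :: "(nat \<Rightarrow> real^'d) \<Rightarrow> (int \<Rightarrow> real) \<Rightarrow> (nat \<Rightarrow> real) \<Rightarrow> nat \<Rightarrow> real^'d" where
  "gls_est x \<eta> y T =
     matrix_inv (\<chi> i j. \<Sum>p=1..T. \<Sum>q=1..T. x p $ i * toep_inv \<eta> T p q * x q $ j)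
     *v (\<chi> i. \<Sum>p=1..T. \<Sum>q=1..T. x p $ i * toep_inv \<eta> T p q * y q)"

definition z_row :: "(nat \<Rightarrow> real^'d) \<Rightarrow> nat \<Rightarrow> nat \<Rightarrow> real^'d" where
  "z_row x T t = (\<chi> i. x t $ i / s_norm x T i)"

definition sandwich_cov :: "(nat \<Rightarrow> real^'d) \<Rightarrow> (int \<Rightarrow> real) \<Rightarrow> (nat \<Rightarrow> nat \<Rightarrow> real) \<Rightarrow> nat \<Rightarrow> real^'d^'d" where
  "sandwich_cov x \<eta> Sig T =
     (let Li = toep_inv \<eta> T; z = z_row x T;
          A = (\<chi> i j. \<Sum>p=1..T. \<Sum>q=1..T. z p $ i * Li p q * z q $ j);
          B = (\<chi> i j. \<Sum>p=1..T. \<Sum>q=1..T. \<Sum>r=1..T. \<Sum>w=1..T.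
                  z p $ i * Li p q * Sig q r * Li r w * z w $ j)
      in matrix_inv A ** B ** matrix_inv A)"

definition spectral_cov :: "(real \<Rightarrow> complex^'d^'d) \<Rightarrow> (real \<Rightarrow> complex) \<Rightarrow> (real \<Rightarrow> complex) \<Rightarrow> complex^'d^'d" where
  "spectral_cov H fv fu =
     (let Hv = RS_integral_mat (\<lambda>w. 1 / fv w) H (- pi) pi;
          Hu = RS_integral_mat (\<lambda>w. fu w / (fv w)^2) H (- pi) pi;
          P = matrix_inv Hv ** Hu ** matrix_inv Hv
      in (\<chi> i j. complex_of_real (2 * pi) * P $ i $ j))"

end

theory Submission
  imports Defs "HOL-Library.Poly_Mapping"
begin

text \<open>
  Write \<open>f = 2\<pi>f\<^sub>v\<close> for the symbol of the Toeplitz matrices \<open>\<Lambda>\<^sub>T\<close>, and identify finitely supported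
  sequences with Laurent polynomials, so that Parseval turns bounds on symbols into bounds on convolution operators
  in \<open>\<ell>\<^sup>2\<close>. A Neumann series yields an even Laurent polynomial \<open>p\<close> with \<open>p f\<close> uniformly close to \<open>1\<close>. Since the
  columns \<open>z\<close> of \<open>Z\<^sub>T\<close> are normalised with vanishing maximal entry, edge effects are negligible, and
  \<open>\<Lambda>\<^sub>T\<close> is bounded below; hence \<open>\<Lambda>\<^sub>T\<^sup>-\<^sup>1 z\<close> is close to \<open>p z\<close> in \<open>\<ell>\<^sup>2\<close>. Quadratic forms in \<open>p z\<close> converge by
  the Grenander conditions to integrals of trigonometric polynomials against \<open>H\<close>, which gives the two limiting
  matrices. The same approximation shows that the weights of the estimator have vanishing maximal entry, so a Lindeberg
  argument on characteristic functions, applied to truncations of the linear process, gives asymptotic normality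
  of every linear combination. A variant of the Cramer-Wold device upgrades this to convergence in law.
\<close>

section \<open>Laurent polynomials as finitely supported sequences\<close>

text \<open>The inverse of a Toeplitz section is in general not close in operator norm to the
  section of the inverse symbol: the two differ near both ends of \<open>{1..T}\<close>. The
  comparison is therefore made only on vectors whose largest entry tends to 0, which carry little
  mass near the ends, and all it needs of the exact solution is the coercivity constant
  \<open>m\<close>. Sections of every size \<open>T\<close> live in one ring: the symbol truncated
  at lag \<open>T\<close>, multiplied with a sequence supported in \<open>{1..T}\<close> and read at
  those positions, is exactly the matrix product. Against \<open>H\<close>, only the integrals of
  exponentials are given. Integrals of \<open>1 / f\<close> and of its products are constructed as
  limits along uniformly convergent trigonometric polynomials; the control this requires is a
  variation bound for every entry of \<open>H\<close>, extracted from the semidefinite increments.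
  The limiting design matrix is nonsingular because its quadratic form dominates a multiple of that
  of \<open>R(0)\<close>. The Gaussian comparison keeps the exact variance of each finite sum and
  never divides by it, so that singular limits are included.\<close>

type_synonym laurent = "int \<Rightarrow>\<^sub>0 real"

abbreviation coef :: "laurent \<Rightarrow> int \<Rightarrow> real" where "coef \<equiv> Poly_Mapping.lookup"
abbreviation mono1 :: "int \<Rightarrow> real \<Rightarrow> laurent" where "mono1 \<equiv> Poly_Mapping.single"
abbreviation supp :: "laurent \<Rightarrow> int set" where "supp \<equiv> Poly_Mapping.keys"

definition restr :: "int set \<Rightarrow> (int \<Rightarrow> real) \<Rightarrow> laurent" where
  "restr S f = (\<Sum>k\<in>S. mono1 k (f k))"

lemma coef_restr: "finite S \<Longrightarrow> coef (restr S f) k = (if k \<in> S then f k else 0)"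
  unfolding restr_def lookup_sum by (simp add: lookup_single when_def)

lemma supp_restr: "finite S \<Longrightarrow> supp (restr S f) \<subseteq> S"
  by (auto simp: in_keys_iff coef_restr split: if_splits)

lemma restr_coef:
  assumes "finite S" "supp a \<subseteq> S"
  shows "restr S (coef a) = a"
  using assms by (intro poly_mapping_eqI) (auto simp: coef_restr in_keys_iff subset_iff)

text \<open>Coefficient 0 makes the zero polynomial a monomial, so two cases suffice. Identities
  that are additive in each argument, such as those for \<open>ft\<close> and \<open>adj\<close> of
  a product, thus reduce to monomials.\<close>

lemma laurent_induct [case_names mono1 add]:
  assumes "\<And>k c. P (mono1 k c)" and "\<And>a b. P a \<Longrightarrow> P b \<Longrightarrow> P (a + b)"
  shows "P (a :: laurent)"
proof -
  have "P (restr S f)" if "finite S" for S f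
    using that
  proof (induction S)
    case empty
    have "P (mono1 0 0)" by (rule assms(1))
    then show ?case by (simp add: restr_def)
  next
    case (insert x F)
    then show ?case using assms by (simp add: restr_def)
  qed
  from this[of "supp a" "coef a"] show ?thesis by (simp add: restr_coef)
qed

lemma coef_mono1_mult: "coef (mono1 k c * b) n = c * coef b (n - k)"
proof (induction b rule: laurent_induct)
  case (mono1 j d)
  then show ?case by (auto simp: mult_single lookup_single when_def)
next
  case (add a b)
  then show ?case by (simp add: distrib_left lookup_add)
qed

lemma coef_mult:
  assumes "finite S" "supp a \<subseteq> S"
  shows "coef (a * b) n = (\<Sum>k\<in>S. coef a k * coef b (n - k))"
proof -
  have "coef (restr S (coef a) * b) n = (\<Sum>k\<in>S. coef a k * coef b (n - k))"
    unfolding restr_def sum_distrib_right lookup_sum by (simp add: coef_mono1_mult)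
  then show ?thesis using assms by (simp add: restr_coef)
qed

section \<open>Fourier transforms, reflection, and Parseval's identity\<close>

definition ft :: "laurent \<Rightarrow> real \<Rightarrow> complex" where
  "ft a w = (\<Sum>k\<in>supp a. of_real (coef a k) * cis (of_int k * w))"

lemma ft_superset:
  assumes "finite S" "supp a \<subseteq> S"
  shows "ft a w = (\<Sum>k\<in>S. of_real (coef a k) * cis (of_int k * w))"
  unfolding ft_def using assms by (intro sum.mono_neutral_left) (auto simp: in_keys_iff)

lemma ft_restr: "finite S \<Longrightarrow> ft (restr S f) w = (\<Sum>k\<in>S. of_real (f k) * cis (of_int k * w))"
  by (simp add: ft_superset[OF _ supp_restr] coef_restr)

lemma ft_mono1: "ft (mono1 k c) w = of_real c * cis (of_int k * w)"
  by (subst ft_superset[of "{k}"]) auto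

lemma ft_one [simp]: "ft 1 w = 1"
  by (subst single_one[symmetric], subst ft_mono1) simp

lemma ft_zero [simp]: "ft 0 w = 0"
  by (simp add: ft_def)

lemma ft_add: "ft (a + b) w = ft a w + ft b w"
proof -
  have "supp (a + b) \<subseteq> supp a \<union> supp b" by (rule keys_add)
  then show ?thesis
    by (subst (1 2 3) ft_superset[of "supp a \<union> supp b"])
      (auto simp: lookup_add distrib_right sum.distrib)
qed

lemma ft_uminus: "ft (- a) w = - ft a w"
proof -
  have "ft (- a) w + ft a w = 0" by (simp flip: ft_add)
  then show ?thesis by (simp add: add_eq_0_iff2)
qed

lemma ft_diff: "ft (a - b) w = ft a w - ft b w"
  using ft_add[of a "- b" w] by (simp add: ft_uminus)

lemma ft_sum: "ft (\<Sum>x\<in>A. f x) w = (\<Sum>x\<in>A. ft (f x) w)"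
  by (induction A rule: infinite_finite_induct) (auto simp: ft_add)

lemma ft_mult: "ft (a * b) w = ft a w * ft b w"
proof (induction a rule: laurent_induct)
  case (mono1 k c)
  show ?case
  proof (induction b rule: laurent_induct)
    case (mono1 j d)
    then show ?case
      by (simp add: mult_single ft_mono1 cis_mult[symmetric] distrib_right)
  next
    case (add a b)
    then show ?case by (simp add: distrib_left ft_add)
  qed
next
  case (add a b)
  then show ?case by (simp add: distrib_right ft_add)
qed

lemma ft_power: "ft (a ^ n) w = ft a w ^ n"
  by (induction n) (auto simp: ft_mult)

text \<open>Reflection of the coefficients. As they are real, it conjugates the transform on the
  unit circle (\<open>ft_adj\<close>), and so gives the adjoint of a multiplication operator with
  respect to \<open>ip\<close> (\<open>ip_mult_left\<close>).\<close>

definition adj :: "laurent \<Rightarrow> laurent" where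
  "adj a = restr (uminus ` supp a) (\<lambda>k. coef a (- k))"

lemma coef_adj [simp]: "coef (adj a) k = coef a (- k)"
  proof -
  have "coef (adj a) k = (if k \<in> uminus ` supp a then coef a (- k) else 0)"
    unfolding adj_def by (subst coef_restr) auto
  moreover have "k \<in> uminus ` supp a \<longleftrightarrow> - k \<in> supp a"
    by (metis image_eqI minus_minus image_iff)
  ultimately show ?thesis by (simp add: in_keys_iff)
qed

lemma adj_add: "adj (a + b) = adj a + adj b"
  by (rule poly_mapping_eqI) (simp add: lookup_add)

lemma adj_mono1: "adj (mono1 k c) = mono1 (- k) c"
  by (rule poly_mapping_eqI) (auto simp: lookup_single when_def)

lemma adj_mult: "adj (a * b) = adj a * adj b"
proof (induction a rule: laurent_induct)
  case (mono1 k c)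
  show ?case
  proof (induction b rule: laurent_induct)
    case (mono1 j d)
    then show ?case by (simp add: mult_single adj_mono1)
  next
    case (add a b)
    then show ?case by (simp add: distrib_left adj_add)
  qed
next
  case (add a b)
  then show ?case by (simp add: distrib_right adj_add)
qed

lemma ft_adj: "ft (adj a) w = cnj (ft a w)"
proof (induction a rule: laurent_induct)
  case (mono1 k c)
  then show ?case by (simp add: adj_mono1 ft_mono1 cis_cnj)
next
  case (add a b)
  then show ?case by (simp add: adj_add ft_add)
qed

lemma cmod_ft_le: 
  assumes "finite S" "supp a \<subseteq> S"
  shows "cmod (ft a w) \<le> (\<Sum>k\<in>S. \<bar>coef a k\<bar>)"
  unfolding ft_superset[OF assms] by (rule sum_norm_le) (simp add: norm_mult)

text \<open>For \<open>k\<close> different from 0 the antiderivative is periodic, so its boundary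
  values cancel. By linearity this identifies the constant coefficient of any polynomial with a mean
  over the circle.\<close>

lemma has_integral_cis:
  "((\<lambda>w. cis (of_int k * w)) has_integral (if k = 0 then 2 * of_real pi else 0)) {-pi..pi}"
proof (cases "k = 0")
  case True
  have "((\<lambda>w. 1 :: complex) has_integral (2 * of_real pi)) {-pi..pi}"
    using has_integral_const_real[of "1 :: complex" "-pi" pi] by (simp add: scaleR_conv_of_real)
  with True show ?thesis by simp
next
  case False
  let ?F = "\<lambda>w. - \<i> * cis (of_int k * w) / of_int k"
  have "((\<lambda>w. cis (of_int k * w)) has_integral (?F pi - ?F (- pi))) {-pi..pi}"
  proof (rule fundamental_theorem_of_calculus)
    fix w :: real assume "w \<in> {-pi..pi}"
    have "((\<lambda>w. exp (\<i> * of_int k * w)) has_vector_derivative \<i> * of_int k * exp (\<i> * of_int k * of_real w))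
       (at w within {-pi..pi})"
    proof -
      have "((\<lambda>z. exp (\<i> * of_int k * z)) has_field_derivative \<i> * of_int k * exp (\<i> * of_int k * of_real w))
        (at (of_real w))"
        by (auto intro!: derivative_eq_intros)
      then show ?thesis
        using has_vector_derivative_real_field has_vector_derivative_at_within by blast
    qed
    then have "((\<lambda>w. - \<i> / of_int k * exp (\<i> * of_int k * of_real w)) has_vector_derivative
        (- \<i> / of_int k) * (\<i> * of_int k * exp (\<i> * of_int k * of_real w))) (at w within {-pi..pi})"
      by (intro has_vector_derivative_mult_right)
    moreover have "(- \<i> / of_int k) * (\<i> * of_int k * exp (\<i> * of_int k * of_real w))
       = exp (\<i> * of_int k * of_real w)"
      using False by (simp add: field_simps)
    ultimately show "(?F has_vector_derivative cis (of_int k * w)) (at w within {-pi..pi})"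
      by (simp add: cis_conv_exp mult.assoc)
  qed simp
  moreover have "cis (of_int k * pi) = cis (of_int k * (- pi))"
  proof -
    have "sin (pi * of_int k) = 0" by (metis sin_int_times_real mult.commute sin_integer_2pi sin_zero_iff_int2)
    then show ?thesis by (simp add: complex_eq_iff mult.commute)
  qed
  ultimately show ?thesis using False by simp
qed

lemma has_integral_ft: "(ft a has_integral (2 * of_real pi * of_real (coef a 0))) {-pi..pi}"
proof (induction a rule: laurent_induct)
  case (mono1 k c)
  have "((\<lambda>w. of_real c * cis (of_int k * w)) has_integral
      (of_real c * (if k = 0 then 2 * of_real pi else 0))) {-pi..pi}"
    by (intro has_integral_mult_right has_integral_cis)
  then show ?case
    by (cases "k = 0") (simp_all add: ft_mono1[abs_def] lookup_single mult_ac)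
next
  case (add a b)
  from has_integral_add[OF this] show ?case
    by (simp add: ft_add[abs_def] lookup_add algebra_simps)
qed

text \<open>The l2 inner product in disguise (\<open>ip_eq_sum\<close>). Written as the constant
  coefficient of a product, it inherits bilinearity and adjoints from the ring laws, and
  \<open>has_integral_ft\<close> turns it into an integral.\<close>

definition ip :: "laurent \<Rightarrow> laurent \<Rightarrow> real" where
  "ip a b = coef (adj a * b) 0"

lemma ip_eq_sum:
  assumes "finite S" "supp a \<subseteq> S \<or> supp b \<subseteq> S"
  shows "ip a b = (\<Sum>k\<in>S. coef a k * coef b k)"
proof -
  have s: "supp (adj a) \<subseteq> uminus ` supp a"
  proof
    fix k assume "k \<in> supp (adj a)"
    then have "- k \<in> supp a" by (simp add: in_keys_iff)
    then show "k \<in> uminus ` supp a" by (metis image_eqI minus_minus)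
  qed
  have "ip a b = (\<Sum>k\<in>uminus ` supp a. coef a (- k) * coef b (- k))"
    unfolding ip_def by (subst coef_mult[OF _ s]) auto
  also have "\<dots> = (\<Sum>k\<in>supp a. coef a k * coef b k)"
    by (subst sum.reindex) auto
  also have "\<dots> = (\<Sum>k\<in>S \<union> supp a. coef a k * coef b k)"
    using assms by (intro sum.mono_neutral_left) (auto simp: in_keys_iff)
  also have "\<dots> = (\<Sum>k\<in>S. coef a k * coef b k)"
    using assms by (intro sum.mono_neutral_right) (auto simp: in_keys_iff)
  finally show ?thesis .
qed

lemma ip_commute: "ip a b = ip b a"
  by (simp add: ip_eq_sum[of "supp a"] mult.commute)

lemma ip_add_left: "ip (a + b) c = ip a c + ip b c"
  by (simp add: ip_def adj_add distrib_right lookup_add)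

lemma ip_add_right: "ip c (a + b) = ip c a + ip c b"
  by (simp add: ip_def distrib_left lookup_add)

lemma ip_diff_right: "ip c (a - b) = ip c a - ip c b"
  by (simp add: ip_def right_diff_distrib lookup_minus)

lemma ip_diff_left: "ip (a - b) c = ip a c - ip b c"
  by (simp add: ip_commute[of _ c] ip_diff_right)

lemma ip_mult_left: "ip (c * a) b = ip a (adj c * b)"
  by (simp add: ip_def adj_mult mult_ac)

definition nrm :: "laurent \<Rightarrow> real" where
  "nrm a = sqrt (ip a a)"

lemma nrm_eq_L2:
  assumes "finite S" "supp a \<subseteq> S"
  shows "nrm a = L2_set (coef a) S"
  unfolding nrm_def L2_set_def using assms by (subst ip_eq_sum[of S]) (auto simp: power2_eq_square)

lemma ip_self_nonneg [simp]: "0 \<le> ip a a"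
  by (subst ip_eq_sum[of "supp a"]) (auto intro!: sum_nonneg)

lemma nrm_nonneg [simp]: "0 \<le> nrm a"
  by (simp add: nrm_def)

lemma nrm_sq: "(nrm a)\<^sup>2 = ip a a"
  by (simp add: nrm_def)

lemma nrm_eq_0D: "nrm a = 0 \<Longrightarrow> a = 0"
proof -
  assume "nrm a = 0"
  then have "L2_set (coef a) (supp a) = 0" by (simp add: nrm_eq_L2[of "supp a"])
  then have "\<forall>k\<in>supp a. coef a k = 0" by (simp add: L2_set_eq_0_iff)
  then show "a = 0" by (intro poly_mapping_eqI) (auto simp: in_keys_iff)
qed

lemma ip_le: "\<bar>ip a b\<bar> \<le> nrm a * nrm b"
proof -
  let ?S = "supp a \<union> supp b"
  have "\<bar>ip a b\<bar> \<le> (\<Sum>k\<in>?S. \<bar>coef a k\<bar> * \<bar>coef b k\<bar>)"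
    by (subst ip_eq_sum[of ?S]) (auto simp flip: abs_mult)
  also have "\<dots> \<le> L2_set (coef a) ?S * L2_set (coef b) ?S"
    by (rule L2_set_mult_ineq)
  finally show ?thesis by (simp add: nrm_eq_L2[of ?S])
qed

lemma nrm_triangle: "nrm (a + b) \<le> nrm a + nrm b"
proof -
  let ?S = "supp a \<union> supp b"
  have "nrm (a + b) = L2_set (\<lambda>k. coef a k + coef b k) ?S"
    using keys_add[of a b] by (subst nrm_eq_L2[of ?S]) (auto simp: lookup_add L2_set_def)
  also have "\<dots> \<le> L2_set (coef a) ?S + L2_set (coef b) ?S"
    by (rule L2_set_triangle_ineq)
  finally show ?thesis by (simp add: nrm_eq_L2[of ?S])
qed

lemma nrm_zero [simp]: "nrm 0 = 0"
  by (simp add: nrm_def ip_def)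

lemma nrm_sum_le: "nrm (\<Sum>x\<in>A. f x) \<le> (\<Sum>x\<in>A. nrm (f x))"
  by (induction A rule: infinite_finite_induct) (auto intro: order_trans[OF nrm_triangle])

lemma nrm_minus_commute: "nrm (a - b) = nrm (b - a)"
proof -
  have "ip (a - b) (a - b) = ip (b - a) (b - a)"
    by (simp add: ip_diff_left ip_diff_right)
  then show ?thesis by (simp add: nrm_def)
qed

lemma coef_le_nrm: "\<bar>coef a k\<bar> \<le> nrm a"
  using member_le_L2_set[of "insert k (supp a)" k "\<lambda>k. \<bar>coef a k\<bar>"]
  by (simp add: nrm_eq_L2[of "insert k (supp a)"] L2_set_def subset_insertI)

text \<open>Parseval: the constant coefficient of \<open>adj a * a\<close> is the squared l2 norm,
  and the transform of that product is the squared modulus of \<open>ft a\<close>.\<close>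

lemma has_integral_nrm:
  "((\<lambda>w. (cmod (ft a w))\<^sup>2) has_integral (2 * pi * (nrm a)\<^sup>2)) {-pi..pi}"
proof -
  have "((\<lambda>w. Re (ft (adj a * a) w)) has_integral Re (2 * of_real pi * of_real (coef (adj a * a) 0))) {-pi..pi}"
    using has_integral_linear[OF has_integral_ft bounded_linear_Re] by (simp add: o_def)
  moreover have "Re (ft (adj a * a) w) = (cmod (ft a w))\<^sup>2" for w
    proof -
    have "ft (adj a * a) w = of_real ((cmod (ft a w))\<^sup>2)"
      by (simp only: ft_mult ft_adj complex_norm_square) (rule mult.commute)
    then show ?thesis by simp
  qed
  ultimately show ?thesis by (simp add: nrm_sq ip_def)
qed

text \<open>On the Fourier side convolution with \<open>c\<close> is pointwise multiplication by
  \<open>ft c\<close>, so a supremum bound for the symbol bounds the operator on l2. The operator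
  bounds used later come from here.\<close>

lemma nrm_mult_le:
  assumes B: "\<And>w. w \<in> {-pi..pi} \<Longrightarrow> cmod (ft c w) \<le> B"
  shows "nrm (c * a) \<le> B * nrm a"
proof -
  have B0: "0 \<le> B" using order_trans[OF norm_ge_zero B[of 0]] by simp
  have "2 * pi * (nrm (c * a))\<^sup>2 \<le> B\<^sup>2 * (2 * pi * (nrm a)\<^sup>2)"
  proof (rule has_integral_le)
    show "((\<lambda>w. (cmod (ft (c * a) w))\<^sup>2) has_integral (2 * pi * (nrm (c * a))\<^sup>2)) {-pi..pi}"
      by (rule has_integral_nrm)
    show "((\<lambda>w. B\<^sup>2 * (cmod (ft a w))\<^sup>2) has_integral (B\<^sup>2 * (2 * pi * (nrm a)\<^sup>2))) {-pi..pi}"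
      by (intro has_integral_mult_right has_integral_nrm)
    fix w :: real assume "w \<in> {-pi..pi}"
    from power_mono[OF B[OF this], of 2]
    show "(cmod (ft (c * a) w))\<^sup>2 \<le> B\<^sup>2 * (cmod (ft a w))\<^sup>2"
      by (simp add: ft_mult norm_mult power_mult_distrib mult_right_mono)
  qed
  then have "(nrm (c * a))\<^sup>2 \<le> (B * nrm a)\<^sup>2" by (simp add: power_mult_distrib)
  then show ?thesis by (rule power2_le_imp_le) (use B0 in auto)
qed

text \<open>The counterpart from below: the quadratic form of a convolution is a mean of the symbol
  weighted by the squared modulus of \<open>ft a\<close>. It makes Toeplitz sections with positive
  symbol coercive.\<close>

lemma ip_mult_self_ge:
  assumes "\<And>w. w \<in> {-pi..pi} \<Longrightarrow> m \<le> Re (ft c w)"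
  shows "m * (nrm a)\<^sup>2 \<le> ip a (c * a)"
proof -
  have "((\<lambda>w. Re (ft (adj a * (c * a)) w)) has_integral
      Re (2 * of_real pi * of_real (coef (adj a * (c * a)) 0))) {-pi..pi}"
    using has_integral_linear[OF has_integral_ft bounded_linear_Re] by (simp add: o_def)
  moreover have "ft (adj a * (c * a)) w = ft c w * of_real ((cmod (ft a w))\<^sup>2)" for w
    by (simp only: ft_mult ft_adj complex_norm_square) (simp add: mult_ac)
  ultimately have 1: "((\<lambda>w. Re (ft c w) * (cmod (ft a w))\<^sup>2) has_integral 2 * pi * ip a (c * a)) {-pi..pi}"
    by (simp add: ip_def)
  have "m * (2 * pi * (nrm a)\<^sup>2) \<le> 2 * pi * ip a (c * a)"
    by (rule has_integral_le[OF has_integral_mult_right[OF has_integral_nrm] 1])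
       (use assms in \<open>auto intro!: mult_right_mono\<close>)
  then show ?thesis by simp
qed

section \<open>Riemann--Stieltjes integrals\<close>

lemma RS_tag_bounds:
  assumes "RS_tagged_partition a b p \<tau>" "k < length p - 1"
  shows "\<tau> ! k \<in> {a..b}" "a \<le> p ! k" "p ! k \<le> p ! Suc k" "p ! Suc k \<le> b"
proof -
  have p: "length p \<ge> 2" "hd p = a" "last p = b" "sorted_wrt (<) p" "length \<tau> = length p - 1"
    and t: "p ! k \<le> \<tau> ! k \<and> \<tau> ! k \<le> p ! (k + 1)"
    using assms by (auto simp: RS_tagged_partition_def)
  have ne: "p \<noteq> []" using p(1) by auto
  have m: "p ! i \<le> p ! j" if "i \<le> j" "j < length p" for i j
    using that p(4) by (cases "i = j") (auto simp: sorted_wrt_iff_nth_less intro!: less_imp_le)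
  have "a = p ! 0" using p(2) ne by (simp add: hd_conv_nth)
  moreover have "b = p ! (length p - 1)" using p(3) ne by (simp add: last_conv_nth)
  ultimately show "a \<le> p ! k" "p ! k \<le> p ! Suc k" "p ! Suc k \<le> b"
    using m[of 0 k] m[of k "Suc k"] m[of "Suc k" "length p - 1"] assms(2) by auto
  then show "\<tau> ! k \<in> {a..b}" using t by auto
qed

text \<open>Equidistant points tagged with their left neighbours. Partitions of arbitrarily small
  mesh are what makes the value of the integral unique.\<close>

lemma RS_tagged_partition_exists:
  assumes "a < b" "\<delta> > 0"
  obtains p \<tau> where "RS_tagged_partition a b p \<tau>" "RS_mesh p < \<delta>"
proof -
  obtain n :: nat where n: "(b - a) / \<delta> < n" using reals_Archimedean2 by blast
  have n0: "n > 0" using n assms by (cases n) (auto simp: field_simps)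
  have h: "(b - a) / n < \<delta>" using n n0 assms by (simp add: field_simps)
  define f where "f i = a + (b - a) * real i / n" for i
  define p where "p = map f [0..<Suc n]"
  have nth: "p ! i = f i" if "i \<le> n" for i
    using that unfolding p_def by (subst nth_map) (auto simp del: upt_Suc)
  have len: "length p = Suc n" by (simp add: p_def)
  have less: "f i < f j" if "i < j" for i j
    using that assms n0 by (auto simp: f_def intro!: divide_strict_right_mono mult_strict_left_mono)
  have ne: "p \<noteq> []" using len by auto
  have "RS_tagged_partition a b p (butlast p)"
    unfolding RS_tagged_partition_def
  proof (intro conjI allI impI)
    show "2 \<le> length p" using len n0 by simp
    show "hd p = a" using ne nth[of 0] by (simp add: hd_conv_nth f_def)
    show "last p = b" using ne nth[of n] n0 len by (simp add: last_conv_nth f_def)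
    show "sorted_wrt (<) p"
      unfolding sorted_wrt_iff_nth_less using len nth less by auto
    show "length (butlast p) = length p - 1" by simp
    fix k assume "k < length (butlast p)"
    then have k: "k < n" using len by simp
    then show "p ! k \<le> butlast p ! k" by (simp add: nth_butlast len)
    show "butlast p ! k \<le> p ! (k + 1)"
      using k nth[of k] nth[of "k + 1"] less[of k "k + 1"] by (simp add: nth_butlast len)
  qed
  moreover have "RS_mesh p < \<delta>"
    unfolding RS_mesh_def
  proof (subst Max_less_iff)
    show "\<forall>y\<in>{p ! (k + 1) - p ! k |k. k < length p - 1} \<union> {0}. y < \<delta>"
    proof
      fix y assume "y \<in> {p ! (k + 1) - p ! k |k. k < length p - 1} \<union> {0}"
      then consider k where "y = p ! (k + 1) - p ! k" "k < n" | "y = 0" using len by auto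
      then show "y < \<delta>"
      proof cases
        case 1
        then have "y = (b - a) / n"
          using nth[of k] nth[of "k + 1"] by (simp add: f_def field_simps)
        with h show ?thesis by simp
      qed (use assms in simp)
    qed
  qed (auto simp: setcompr_eq_image)
  ultimately show thesis by (rule that)
qed

text \<open>Small mesh as a filter: the integral becomes an ordinary limit, so that uniqueness,
  linearity and passage of inequalities to the limit follow from the general limit laws.\<close>

definition RS_filter :: "real \<Rightarrow> real \<Rightarrow> (real list \<times> real list) filter" where
  "RS_filter a b = (INF \<delta>\<in>{0<..}. principal {(p, \<tau>). RS_tagged_partition a b p \<tau> \<and> RS_mesh p < \<delta>})"

lemma eventually_RS_filter:
  "eventually P (RS_filter a b) \<longleftrightarrow>
     (\<exists>\<delta>>0. \<forall>p \<tau>. RS_tagged_partition a b p \<tau> \<and> RS_mesh p < \<delta> \<longrightarrow> P (p, \<tau>))"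
  unfolding RS_filter_def
proof (subst eventually_INF_base)
  show "\<exists>x\<in>{0<..}. principal {(p, \<tau>). RS_tagged_partition a b p \<tau> \<and> RS_mesh p < x}
      \<le> inf (principal {(p, \<tau>). RS_tagged_partition a b p \<tau> \<and> RS_mesh p < c})
          (principal {(p, \<tau>). RS_tagged_partition a b p \<tau> \<and> RS_mesh p < d})"
    if "c \<in> {0<..}" "d \<in> {0<..}" for c d :: real
    using that by (intro bexI[of _ "min c d"]) auto
qed (auto simp: eventually_principal Bex_def)

lemma eventually_RS_tagged: "\<forall>\<^sub>F (p, \<tau>) in RS_filter a b. RS_tagged_partition a b p \<tau>"
  unfolding eventually_RS_filter by (auto intro: exI[of _ 1])

lemma RS_filter_nontrivial: "a < b \<Longrightarrow> RS_filter a b \<noteq> bot"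
  unfolding trivial_limit_def eventually_RS_filter by (metis RS_tagged_partition_exists)

lemma has_RS_integral_tendsto:
  "has_RS_integral g F a b I \<longleftrightarrow> ((\<lambda>(p, \<tau>). RS_sum g F p \<tau>) \<longlongrightarrow> I) (RS_filter a b)"
  by (simp add: has_RS_integral_def tendsto_iff eventually_RS_filter dist_norm)

lemma RS_integral_eq: "a < b \<Longrightarrow> has_RS_integral g F a b I \<Longrightarrow> RS_integral g F a b = I"
  unfolding RS_integral_def
  by (rule the_equality) (auto simp: has_RS_integral_tendsto intro: tendsto_unique[OF RS_filter_nontrivial])

lemma has_RS_integral_add:
  assumes "has_RS_integral f F a b I" "has_RS_integral g F a b J"
  shows "has_RS_integral (\<lambda>w. f w + g w) F a b (I + J)"
  using tendsto_add[OF assms[unfolded has_RS_integral_tendsto]] unfolding has_RS_integral_tendsto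
  by (simp add: RS_sum_def distrib_right sum.distrib case_prod_unfold)

lemma has_RS_integral_cmult:
  assumes "has_RS_integral f F a b I"
  shows "has_RS_integral (\<lambda>w. c * f w) F a b (c * I)"
  using tendsto_mult_left[OF assms[unfolded has_RS_integral_tendsto], of c] unfolding has_RS_integral_tendsto
  by (simp add: RS_sum_def sum_distrib_left mult.assoc case_prod_unfold)

lemma has_RS_integral_sum:
  assumes "\<And>k. k \<in> S \<Longrightarrow> has_RS_integral (f k) F a b (I k)"
  shows "has_RS_integral (\<lambda>w. \<Sum>k\<in>S. f k w) F a b (\<Sum>k\<in>S. I k)"
  using assms
proof (induction S rule: infinite_finite_induct)
  case (insert x S)
  then show ?case by (simp add: has_RS_integral_add)
qed (simp_all add: has_RS_integral_tendsto RS_sum_def case_prod_unfold)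

lemma has_RS_integral_diff:
  assumes "has_RS_integral f F a b I" "has_RS_integral g F a b J"
  shows "has_RS_integral (\<lambda>w. f w - g w) F a b (I - J)"
  using has_RS_integral_add[OF assms(1) has_RS_integral_cmult[OF assms(2), of "- 1"]] by simp

lemma has_RS_integral_ft:
  assumes "\<And>k. has_RS_integral (\<lambda>w. exp (\<i> * of_int k * of_real w)) F a b (R k)"
    and "finite S" "supp q \<subseteq> S"
  shows "has_RS_integral (ft q) F a b (\<Sum>k\<in>S. of_real (coef q k) * R k)"
proof -
  have "has_RS_integral (\<lambda>w. \<Sum>k\<in>S. of_real (coef q k) * exp (\<i> * of_int k * of_real w)) F a b
     (\<Sum>k\<in>S. of_real (coef q k) * R k)"
    by (intro has_RS_integral_sum has_RS_integral_cmult assms)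
  moreover have "(\<lambda>w. \<Sum>k\<in>S. of_real (coef q k) * exp (\<i> * of_int k * of_real w)) = ft q"
    using assms(2,3) by (auto simp: ft_superset cis_conv_exp mult.assoc fun_eq_iff)
  ultimately show ?thesis by simp
qed

section \<open>Bounded variation and uniform limits of integrands\<close>

definition RS_var_le :: "(real \<Rightarrow> complex) \<Rightarrow> real \<Rightarrow> real \<Rightarrow> real \<Rightarrow> bool" where
  "RS_var_le F a b K \<longleftrightarrow> (\<forall>p \<tau>. RS_tagged_partition a b p \<tau> \<longrightarrow>
     (\<Sum>k<length p - 1. norm (F (p ! (k + 1)) - F (p ! k))) \<le> K)"

lemma RS_sum_le:
  assumes "RS_var_le F a b K" "RS_tagged_partition a b p \<tau>"
    and "\<And>w. w \<in> {a..b} \<Longrightarrow> norm (g w) \<le> B" "0 \<le> B"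
  shows "norm (RS_sum g F p \<tau>) \<le> B * K"
proof -
  have "norm (RS_sum g F p \<tau>) \<le> (\<Sum>k<length p - 1. B * norm (F (p ! (k + 1)) - F (p ! k)))"
    unfolding RS_sum_def
    using RS_tag_bounds[OF assms(2)] assms(3)
    by (intro sum_norm_le) (auto simp: norm_mult intro!: mult_right_mono)
  also have "\<dots> \<le> B * K"
    using assms unfolding RS_var_le_def sum_distrib_left[symmetric] by (intro mult_left_mono) auto
  finally show ?thesis .
qed

lemma has_RS_integral_norm_le:
  assumes "a < b" "RS_var_le F a b K" "has_RS_integral g F a b I"
    and "\<And>w. w \<in> {a..b} \<Longrightarrow> norm (g w) \<le> B" "0 \<le> B"
  shows "norm I \<le> B * K"
proof (rule tendsto_upperbound[OF tendsto_norm[OF assms(3)[unfolded has_RS_integral_tendsto]] _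
      RS_filter_nontrivial[OF assms(1)]])
  show "\<forall>\<^sub>F x in RS_filter a b. norm (case x of (p, \<tau>) \<Rightarrow> RS_sum g F p \<tau>) \<le> B * K"
    using eventually_RS_tagged by eventually_elim (auto intro!: RS_sum_le assms)
qed

lemma RS_var_le_nonneg: "a < b \<Longrightarrow> RS_var_le F a b K \<Longrightarrow> 0 \<le> K"
  using has_RS_integral_norm_le[of a b F K "\<lambda>_. 0" 0 1]
  by (simp add: has_RS_integral_tendsto RS_sum_def case_prod_unfold)

text \<open>Existence of the limit integral is part of the conclusion. Bounded variation makes the
  integrals a Cauchy sequence, and the Riemann sums of \<open>f n\<close> and \<open>g\<close> stay
  uniformly close over all partitions, which allows the two limits to be exchanged.\<close>

lemma has_RS_integral_uniform_limit:
  assumes ab: "a < b" and V: "RS_var_le F a b K"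
    and I: "\<And>n. has_RS_integral (f n) F a b (I n)"
    and lim: "uniform_limit {a..b} f g sequentially"
  obtains L where "I \<longlonglongrightarrow> L" "has_RS_integral g F a b L"
proof -
  have K: "0 \<le> K" using RS_var_le_nonneg[OF ab V] .
  \<comment> \<open>Dividing by \<open>K + 1\<close> instead of \<open>K\<close> covers an
    integrator of zero variation.\<close>
  have close: "\<exists>N. \<forall>n\<ge>N. \<forall>w\<in>{a..b}. dist (f n w) (g w) < e / (K + 1)" if "e > 0" for e
    using uniform_limitD[OF lim, of "e / (K + 1)"] that K by (simp add: eventually_sequentially)
  have small: "x / (K + 1) * K \<le> x" if "x > 0" for x
    using K that by (simp add: field_simps)
  have "Cauchy I"
  proof (rule metric_CauchyI)
    fix e :: real assume e: "e > 0"
    \<comment> \<open>Two such errors are added below; \<open>e / 4\<close> leaves a total of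
      \<open>e / 2\<close> and hence a strict inequality.\<close>
    then obtain N where N: "\<forall>n\<ge>N. \<forall>w\<in>{a..b}. dist (f n w) (g w) < e / 4 / (K + 1)"
      using close[of "e / 4"] by auto
    have "dist (I m) (I n) < e" if "m \<ge> N" "n \<ge> N" for m n
    proof -
      have "norm (I m - I n) \<le> 2 * (e / 4 / (K + 1)) * K"
      proof (rule has_RS_integral_norm_le[OF ab V has_RS_integral_diff[OF I I]])
        fix w assume "w \<in> {a..b}"
        then have "dist (f m w) (g w) < e / 4 / (K + 1)" "dist (f n w) (g w) < e / 4 / (K + 1)"
          using N that by auto
        then show "norm (f m w - f n w) \<le> 2 * (e / 4 / (K + 1))"
          using dist_triangle2[of "f m w" "f n w" "g w"] unfolding dist_norm by linarith
      qed (use K e in auto)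
      also have "\<dots> = 2 * (e / 4 / (K + 1) * K)" by (rule mult.assoc)
      finally show ?thesis using small[of "e / 4"] e unfolding dist_norm by linarith
    qed
    then show "\<exists>M. \<forall>m\<ge>M. \<forall>n\<ge>M. dist (I m) (I n) < e" by blast
  qed
  then obtain L where L: "I \<longlonglongrightarrow> L" using Cauchy_convergent convergent_def by blast
  have "has_RS_integral g F a b L"
    unfolding has_RS_integral_tendsto
  proof (rule tendstoI)
    fix e :: real assume e: "e > 0"
    then obtain N where N: "\<forall>n\<ge>N. \<forall>w\<in>{a..b}. dist (f n w) (g w) < e / 3 / (K + 1)"
      using close[of "e / 3"] by auto
    have "\<forall>\<^sub>F n in sequentially. dist (I n) L < e / 3" using e by (intro tendstoD[OF L]) auto
    then obtain n where n: "n \<ge> N" "dist (I n) L < e / 3"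
      by (auto simp: eventually_sequentially) (metis le_cases)
    have "\<forall>\<^sub>F x in RS_filter a b. dist (case x of (p, \<tau>) \<Rightarrow> RS_sum (f n) F p \<tau>) (I n) < e / 3"
      using I[of n] e unfolding has_RS_integral_tendsto by (intro tendstoD) auto
    then show "\<forall>\<^sub>F x in RS_filter a b. dist (case x of (p, \<tau>) \<Rightarrow> RS_sum g F p \<tau>) L < e"
      using eventually_RS_tagged
    proof eventually_elim
      case (elim x)
      obtain p \<tau> where x: "x = (p, \<tau>)" by fastforce
      have "norm (RS_sum (\<lambda>w. f n w - g w) F p \<tau>) \<le> e / 3 / (K + 1) * K"
        using N n(1) e K elim(2) x
        by (intro RS_sum_le[OF V]) (auto simp: dist_norm intro: less_imp_le)
      also have "\<dots> \<le> e / 3" using small[of "e / 3"] e by simp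
      also have "RS_sum (\<lambda>w. f n w - g w) F p \<tau> = RS_sum (f n) F p \<tau> - RS_sum g F p \<tau>"
        by (simp add: RS_sum_def left_diff_distrib sum_subtractf)
      finally show ?case
        using elim(1) n(2) dist_triangle3[of "RS_sum g F p \<tau>" L "RS_sum (f n) F p \<tau>"]
          dist_triangle[of "RS_sum (f n) F p \<tau>" L "I n"] unfolding x by (simp add: dist_norm)
    qed
  qed
  with L show thesis by (rule that)
qed

text \<open>In a positive semidefinite increment the modulus of an off-diagonal entry is at most the
  mean of the two diagonal entries. Diagonal increments are nonnegative and telescope over any
  partition, which bounds the variation of all entries.\<close>

lemma RS_var_le_psd_increments:
  fixes H :: "real \<Rightarrow> complex^'d^'d"
  assumes herm: "\<And>w i j. w \<in> {a..b} \<Longrightarrow> H w $ i $ j = cnj (H w $ j $ i)"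
    and psd: "\<And>u w v. a \<le> u \<Longrightarrow> u \<le> w \<Longrightarrow> w \<le> b \<Longrightarrow>
      Re (\<Sum>i\<in>UNIV. \<Sum>j\<in>UNIV. cnj (v $ i) * (H w $ i $ j - H u $ i $ j) * v $ j) \<ge> 0"
  shows "RS_var_le (\<lambda>w. H w $ i $ j) a b
     ((Re (H b $ i $ i - H a $ i $ i) + Re (H b $ j $ j - H a $ j $ j)) / 2)"
proof -
  have ax: "(\<Sum>l\<in>UNIV. f l * axis i (1::complex) $ l) = f i" for f :: "'d \<Rightarrow> complex" and i
  proof -
    have "f l * axis i (1::complex) $ l = (if l = i then f l else 0)" for l
      by (simp add: axis_def)
    then show ?thesis by simp
  qed
  have ax': "(\<Sum>l\<in>UNIV. cnj (axis i (1::complex) $ l) * f l) = f i" for f :: "'d \<Rightarrow> complex" and i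
  proof -
    have "cnj (axis i (1::complex) $ l) * f l = (if l = i then f l else 0)" for l
      by (simp add: axis_def)
    then show ?thesis by simp
  qed
  have diag: "0 \<le> Re (H w $ i $ i - H u $ i $ i)" if "a \<le> u" "u \<le> w" "w \<le> b" for u w i
  proof -
    have "(\<Sum>k\<in>UNIV. \<Sum>l\<in>UNIV. cnj (axis i (1::complex) $ k) * (H w $ k $ l - H u $ k $ l) * axis i 1 $ l)
      = H w $ i $ i - H u $ i $ i"
      by (simp add: ax ax')
    with psd[OF that, of "axis i 1"] show ?thesis by simp
  qed
  have main: "norm (H w $ i $ j - H u $ i $ j) \<le> (Re (H w $ i $ i - H u $ i $ i) + Re (H w $ j $ j - H u $ j $ j)) / 2"
    if uw: "a \<le> u" "u \<le> w" "w \<le> b" for u w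
  proof (cases "i = j")
    case True
    have "Im (H v $ i $ i) = 0" if "v \<in> {a..b}" for v
      using herm[OF that, of i i] by (simp add: complex_eq_iff)
    then have "H w $ i $ i - H u $ i $ i = of_real (Re (H w $ i $ i - H u $ i $ i))"
      using uw by (simp add: complex_eq_iff)
    then have "norm (H w $ i $ i - H u $ i $ i) = \<bar>Re (H w $ i $ i - H u $ i $ i)\<bar>"
      by (metis norm_of_real)
    then show ?thesis using diag[OF uw, of i] True by simp
  next
    case False
    define D where "D k l = H w $ k $ l - H u $ k $ l" for k l
    have sw: "D j i = cnj (D i j)"
      using herm[of w j i] herm[of u j i] uw by (simp add: D_def)
    show ?thesis
    proof (cases "D i j = 0")
      case True
      then show ?thesis using diag[OF uw, of i] diag[OF uw, of j] by (simp add: D_def)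
    next
      case nz: False
      \<comment> \<open>The unimodular number that rotates \<open>D i j\<close> to the negative real
        axis: testing the form on \<open>axis i 1 + z *s axis j 1\<close> gives the sum of the
        diagonal entries minus twice the modulus of \<open>D i j\<close>.\<close>
      define z where "z = - cnj (D i j) / of_real (norm (D i j))"
      define v :: "complex^'d" where "v = axis i 1 + z *s axis j 1"
      have v1: "(\<Sum>l\<in>UNIV. f l * v $ l) = f i + f j * z" for f
      proof -
        have "(\<Sum>l\<in>UNIV. f l * v $ l) = (\<Sum>l\<in>UNIV. f l * axis i 1 $ l + (f l * z) * axis j 1 $ l)"
          by (simp add: v_def distrib_left mult.assoc)
        then show ?thesis unfolding sum.distrib ax .
      qed
      have v2: "(\<Sum>l\<in>UNIV. cnj (v $ l) * f l) = f i + cnj z * f j" for f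
      proof -
        have "(\<Sum>l\<in>UNIV. cnj (v $ l) * f l) =
            (\<Sum>l\<in>UNIV. cnj (axis i 1 $ l) * f l + cnj (axis j 1 $ l) * (cnj z * f l))"
          by (simp add: v_def algebra_simps)
        then show ?thesis unfolding sum.distrib ax' .
      qed
      have zz: "cnj z * z = 1"
        using nz by (simp add: z_def complex_norm_square[symmetric] power2_eq_square mult.commute)
      have zd: "z * D i j = - of_real (norm (D i j))"
        using nz complex_norm_square[of "D i j"] by (simp add: z_def power2_eq_square mult.commute divide_eq_eq)
      have "(\<Sum>k\<in>UNIV. \<Sum>l\<in>UNIV. cnj (v $ k) * D k l * v $ l) =
          (D i i + D i j * z) + cnj z * (D j i + D j j * z)"
        by (simp only: v1 v2 mult.assoc sum_distrib_left[symmetric])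
      also have "\<dots> = D i i + z * D i j + cnj (z * D i j) + D j j * (cnj z * z)"
        by (simp add: sw algebra_simps)
      finally have "Re (D i i) + Re (D j j) - 2 * norm (D i j) \<ge> 0"
        using psd[OF uw, of v] by (simp add: zz zd D_def[symmetric])
      then show ?thesis by (simp add: D_def)
    qed
  qed
  show ?thesis
    unfolding RS_var_le_def
  proof (intro allI impI)
    fix p \<tau> assume p: "RS_tagged_partition a b p \<tau>"
    have tel: "(\<Sum>k<length p - 1. Re (H (p ! Suc k) $ l $ l - H (p ! k) $ l $ l)) = Re (H b $ l $ l - H a $ l $ l)" for l
    proof -
      have "length p \<ge> 2" "hd p = a" "last p = b" using p by (auto simp: RS_tagged_partition_def)
      then have "p ! 0 = a" "p ! (length p - 1) = b"
        by (metis hd_conv_nth last_conv_nth list.size(3) not_numeral_le_zero)+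
      then show ?thesis
        using sum_lessThan_telescope[of "\<lambda>k. Re (H (p ! k) $ l $ l)" "length p - 1"] by simp
    qed
    have "(\<Sum>k<length p - 1. norm (H (p ! (k + 1)) $ i $ j - H (p ! k) $ i $ j)) \<le>
      (\<Sum>k<length p - 1. (Re (H (p ! Suc k) $ i $ i - H (p ! k) $ i $ i) + Re (H (p ! Suc k) $ j $ j - H (p ! k) $ j $ j)) / 2)"
    proof (rule sum_mono)
      fix k assume "k \<in> {..<length p - 1}"
      then have "k < length p - 1" by simp
      from main[OF RS_tag_bounds(2,3,4)[OF p this]]
      show "norm (H (p ! (k + 1)) $ i $ j - H (p ! k) $ i $ j) \<le> (Re (H (p ! Suc k) $ i $ i - H (p ! k) $ i $ i) +
          Re (H (p ! Suc k) $ j $ j - H (p ! k) $ j $ j)) / 2" by simp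
    qed
    also have "\<dots> = (Re (H b $ i $ i - H a $ i $ i) + Re (H b $ j $ j - H a $ j $ j)) / 2"
      unfolding sum_divide_distrib[symmetric] sum.distrib tel ..
    finally show "(\<Sum>k<length p - 1. norm (H (p ! (k + 1)) $ i $ j - H (p ! k) $ i $ j)) \<le> \<dots>" .
  qed
qed

section \<open>Linear processes\<close>

text \<open>Trades the unconditional sum over the integers for a series over the naturals. The
  default value 0 of \<open>infsum\<close> is kept explicit, since the process must be measurable as
  a function on the whole space and not only where the sum converges.\<close>

lemma infsum_int_decode:
  fixes f :: "int \<Rightarrow> real"
  shows "infsum f UNIV = (if summable (\<lambda>k. \<bar>f (int_decode k)\<bar>) then suminf (\<lambda>k. f (int_decode k)) else 0)"
    and "f summable_on UNIV \<longleftrightarrow> summable (\<lambda>k. \<bar>f (int_decode k)\<bar>)"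
proof -
  have 1: "infsum f UNIV = (\<Sum>\<^sub>\<infinity>k. f (int_decode k))"
    by (rule infsum_reindex_bij_betw[symmetric]) (rule bij_int_decode)
  have "f summable_on UNIV \<longleftrightarrow> (\<lambda>x. \<bar>f x\<bar>) summable_on UNIV"
    using summable_on_iff_abs_summable_on_real[of f UNIV] by simp
  also have "\<dots> \<longleftrightarrow> (\<lambda>k. \<bar>f (int_decode k)\<bar>) summable_on UNIV"
    by (rule summable_on_reindex_bij_betw[symmetric]) (rule bij_int_decode)
  also have "\<dots> \<longleftrightarrow> summable (\<lambda>k. \<bar>f (int_decode k)\<bar>)"
    by (rule summable_on_UNIV_nonneg_real_iff) simp
  finally show 2: "f summable_on UNIV \<longleftrightarrow> summable (\<lambda>k. \<bar>f (int_decode k)\<bar>)" .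
  show "infsum f UNIV = (if summable (\<lambda>k. \<bar>f (int_decode k)\<bar>) then suminf (\<lambda>k. f (int_decode k)) else 0)"
  proof (cases "summable (\<lambda>k. \<bar>f (int_decode k)\<bar>)")
    case True
    then have "((\<lambda>k. f (int_decode k)) has_sum (suminf (\<lambda>k. f (int_decode k)))) UNIV"
      by (intro norm_summable_imp_has_sum) (auto intro: summable_rabs_cancel)
    with True 1 show ?thesis by (simp add: infsumI)
  next
    case False
    with 2 show ?thesis by (simp add: infsum_not_exists)
  qed
qed

text \<open>Factors are exchanged one at a time; all remaining factors have modulus at most 1 and do
  not enlarge the error.\<close>

lemma norm_prod_diff_le:
  fixes z w :: "'i \<Rightarrow> complex"
  assumes "\<And>i. i \<in> I \<Longrightarrow> norm (z i) \<le> 1" "\<And>i. i \<in> I \<Longrightarrow> norm (w i) \<le> 1"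
  shows "norm ((\<Prod>i\<in>I. z i) - (\<Prod>i\<in>I. w i)) \<le> (\<Sum>i\<in>I. norm (z i - w i))"
  using assms
proof (induction I rule: infinite_finite_induct)
  case (insert i I)
  have p: "norm (\<Prod>i\<in>I. w i) \<le> 1"
    using insert.prems(2) by (auto simp: prod_norm[symmetric] intro: prod_le_1)
  have "(\<Prod>i\<in>insert i I. z i) - (\<Prod>i\<in>insert i I. w i) =
     z i * ((\<Prod>i\<in>I. z i) - (\<Prod>i\<in>I. w i)) + (z i - w i) * (\<Prod>i\<in>I. w i)"
    using insert.hyps by (simp add: algebra_simps)
  also have "norm \<dots> \<le> norm (z i) * norm ((\<Prod>i\<in>I. z i) - (\<Prod>i\<in>I. w i)) + norm (z i - w i) * norm (\<Prod>i\<in>I. w i)"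
    by (metis norm_mult norm_triangle_ineq)
  also have "\<dots> \<le> 1 * (\<Sum>i\<in>I. norm (z i - w i)) + norm (z i - w i) * 1"
    using insert p by (intro add_mono mult_mono) auto
  finally show ?case using insert.hyps by simp
qed auto

locale noise = prob_space M for M :: "'a measure" +
  fixes E :: "int \<Rightarrow> 'a \<Rightarrow> real" and \<theta> :: "int \<Rightarrow> real" and \<sigma> :: real
  assumes E_meas [measurable]: "\<And>t. E t \<in> borel_measurable M"
    and E_sq: "\<And>t. integrable M (\<lambda>\<omega>. (E t \<omega>)\<^sup>2)"
    and E_indep: "indep_vars (\<lambda>_. borel) E UNIV"
    and E_mean: "\<And>t. expectation (E t) = 0"
    and E_var: "\<And>t. expectation (\<lambda>\<omega>. (E t \<omega>)\<^sup>2) = \<sigma>\<^sup>2"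
    and \<theta>_abs: "(\<lambda>i. \<bar>\<theta> i\<bar>) summable_on UNIV"
    and unif: "((\<lambda>\<delta>::real. SUP t. \<integral>e. e\<^sup>2 * indicator {e. \<bar>e\<bar> > \<delta>} e \<partial>(distr M borel (E t))) \<longlongrightarrow> 0) at_top"
begin

abbreviation th :: "nat \<Rightarrow> real" where "th k \<equiv> \<theta> (int_decode k)"
abbreviation EE :: "int \<Rightarrow> nat \<Rightarrow> 'a \<Rightarrow> real" where "EE t k \<equiv> E (t - int_decode k)"

definition th1 :: real where "th1 = suminf (\<lambda>k. \<bar>th k\<bar>)"

lemma summable_th: "summable (\<lambda>k. \<bar>th k\<bar>)"
  using \<theta>_abs infsum_int_decode(2)[of "\<lambda>i. \<bar>\<theta> i\<bar>"] by simp

lemma sum_th_le: "(\<Sum>k<n. \<bar>th k\<bar>) \<le> th1"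
  unfolding th1_def by (rule sum_le_suminf[OF summable_th]) auto

lemma th1_nonneg: "0 \<le> th1"
  unfolding th1_def by (rule suminf_nonneg[OF summable_th]) auto

lemma E_int: "integrable M (E t)"
  using square_integrable_imp_integrable[OF E_meas E_sq] .

lemma E_mult: 
  "integrable M (\<lambda>\<omega>. E s \<omega> * E t \<omega>)" "expectation (\<lambda>\<omega>. E s \<omega> * E t \<omega>) = (if s = t then \<sigma>\<^sup>2 else 0)"
proof -
  have "integrable M (\<lambda>\<omega>. E s \<omega> * E t \<omega>) \<and> expectation (\<lambda>\<omega>. E s \<omega> * E t \<omega>) = (if s = t then \<sigma>\<^sup>2 else 0)"
  proof (cases "s = t")
    case True
    then show ?thesis using E_sq[of t] E_var[of t] by (simp add: power2_eq_square)
  next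
    case False
    have "indep_vars (\<lambda>_. borel) E {s, t}"
      using indep_vars_subset[OF E_indep] by simp
    from indep_vars_lebesgue_integral[OF _ this] indep_vars_integrable[OF _ this] False
    show ?thesis by (simp add: E_int E_mean)
  qed
  then show "integrable M (\<lambda>\<omega>. E s \<omega> * E t \<omega>)" "expectation (\<lambda>\<omega>. E s \<omega> * E t \<omega>) = (if s = t then \<sigma>\<^sup>2 else 0)"
    by auto
qed

definition Up :: "nat \<Rightarrow> int \<Rightarrow> 'a \<Rightarrow> real" where
  "Up n t \<omega> = (\<Sum>k<n. th k * EE t k \<omega>)"

abbreviation U :: "int \<Rightarrow> 'a \<Rightarrow> real" where "U \<equiv> lin_proc \<theta> E"

text \<open>A random variable that dominates the square of every partial sum \<open>Up n t\<close>
  and of \<open>U t\<close>, up to the factor \<open>th1\<close> (\<open>Up_bound\<close>,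
  \<open>U_bound\<close>). It is the integrable majorant for all uses of dominated convergence
  below.\<close>

definition Q :: "int \<Rightarrow> 'a \<Rightarrow> real" where
  "Q t \<omega> = suminf (\<lambda>k. \<bar>th k\<bar> * (EE t k \<omega>)\<^sup>2)"

definition good :: "int \<Rightarrow> 'a \<Rightarrow> bool" where
  "good t \<omega> \<longleftrightarrow> summable (\<lambda>k. \<bar>th k\<bar> * (EE t k \<omega>)\<^sup>2)"

lemma Up_measurable [measurable]: "Up n t \<in> borel_measurable M"
  unfolding Up_def by measurable

text \<open>Expressing summability by finiteness of an \<open>ennreal\<close> series makes the case
  distinction measurable.\<close>

lemma U_alt: "U t \<omega> = (if suminf (\<lambda>k. ennreal \<bar>th k * EE t k \<omega>\<bar>) \<noteq> top then suminf (\<lambda>k. th k * EE t k \<omega>) else 0)"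
proof -
  have "summable (\<lambda>k. \<bar>th k * EE t k \<omega>\<bar>) \<longleftrightarrow> suminf (\<lambda>k. ennreal \<bar>th k * EE t k \<omega>\<bar>) \<noteq> top"
  proof
    assume "summable (\<lambda>k. \<bar>th k * EE t k \<omega>\<bar>)"
    from suminf_ennreal2[OF _ this]
    show "suminf (\<lambda>k. ennreal \<bar>th k * EE t k \<omega>\<bar>) \<noteq> top" by (simp del: suminf_ennreal)
  qed (rule summable_suminf_not_top, simp)
  then show ?thesis
    unfolding lin_proc_def using infsum_int_decode(1)[of "\<lambda>i. \<theta> i * E (t - i) \<omega>"] by simp
qed

lemma U_measurable [measurable]: "U t \<in> borel_measurable M"
  unfolding U_alt[abs_def] by measurable

lemma Q_measurable [measurable]: "Q t \<in> borel_measurable M"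
  unfolding Q_def[abs_def] by measurable

text \<open>Monotone convergence: the expected value of the series is the squared standard deviation
  \<open>\<sigma>\<close> times the summable series of the \<open>\<bar>th k\<bar>\<close>, hence
  finite.\<close>

lemma AE_good: "AE \<omega> in M. good t \<omega>" and Q_integrable: "integrable M (Q t)"
proof -
  let ?q = "\<lambda>k \<omega>. \<bar>th k\<bar> * (EE t k \<omega>)\<^sup>2"
  have sm: "summable (\<lambda>k. \<bar>th k\<bar> * \<sigma>\<^sup>2)"
    using summable_th by (rule summable_mult2)
  have "(\<integral>\<^sup>+\<omega>. suminf (\<lambda>k. ennreal (?q k \<omega>)) \<partial>M) = suminf (\<lambda>k. \<integral>\<^sup>+\<omega>. ennreal (?q k \<omega>) \<partial>M)"
    by (rule nn_integral_suminf) measurable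
  also have "\<dots> = suminf (\<lambda>k. ennreal (\<bar>th k\<bar> * \<sigma>\<^sup>2))"
    by (subst nn_integral_eq_integral) (auto simp: E_sq E_var)
  also have "\<dots> = ennreal (suminf (\<lambda>k. \<bar>th k\<bar> * \<sigma>\<^sup>2))"
    using sm by (intro suminf_ennreal2) auto
  finally have "(\<integral>\<^sup>+\<omega>. suminf (\<lambda>k. ennreal (?q k \<omega>)) \<partial>M) \<noteq> \<infinity>" by simp
  then have "AE \<omega> in M. suminf (\<lambda>k. ennreal (?q k \<omega>)) \<noteq> \<infinity>"
    by (intro nn_integral_PInf_AE) auto
  then show *: "AE \<omega> in M. good t \<omega>"
    by eventually_elim (auto simp: good_def intro!: summable_suminf_not_top)
  show "integrable M (Q t)"
    unfolding Q_def[abs_def]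
  proof (rule integrable_suminf)
    show "integrable M (?q k)" for k by (simp add: E_sq)
    show "AE \<omega> in M. summable (\<lambda>k. norm (?q k \<omega>))"
      using * by (simp add: good_def)
    show "summable (\<lambda>k. expectation (\<lambda>\<omega>. norm (?q k \<omega>)))"
      using sm by (simp add: E_var)
  qed
qed

lemma Q_nonneg: "good t \<omega> \<Longrightarrow> 0 \<le> Q t \<omega>"
  unfolding Q_def good_def by (rule suminf_nonneg) auto

text \<open>Cauchy-Schwarz after splitting \<open>\<bar>th k\<bar>\<close> into two square roots:
  one factor is at most \<open>th1\<close>, the other at most \<open>Q\<close>, both independently
  of \<open>n\<close>.\<close>

lemma Up_bound:
  assumes "good t \<omega>"
  shows "(Up n t \<omega>)\<^sup>2 \<le> th1 * Q t \<omega>"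
proof -
  have "\<bar>Up n t \<omega>\<bar> \<le> (\<Sum>k<n. sqrt \<bar>th k\<bar> * (sqrt \<bar>th k\<bar> * \<bar>EE t k \<omega>\<bar>))"
    unfolding Up_def
    by (rule order_trans[OF sum_abs]) (simp add: abs_mult mult.assoc[symmetric])
  then have "(Up n t \<omega>)\<^sup>2 \<le> (\<Sum>k<n. sqrt \<bar>th k\<bar> * (sqrt \<bar>th k\<bar> * \<bar>EE t k \<omega>\<bar>))\<^sup>2"
    by (rule power2_le_iff_abs_le[THEN iffD2, rotated]) (auto intro: sum_nonneg)
  also have "\<dots> \<le> (\<Sum>k<n. (sqrt \<bar>th k\<bar>)\<^sup>2) * (\<Sum>k<n. (sqrt \<bar>th k\<bar> * \<bar>EE t k \<omega>\<bar>)\<^sup>2)"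
    by (rule Cauchy_Schwarz_ineq_sum)
  also have "\<dots> = (\<Sum>k<n. \<bar>th k\<bar>) * (\<Sum>k<n. \<bar>th k\<bar> * (EE t k \<omega>)\<^sup>2)"
    by (simp add: power_mult_distrib)
  also have "\<dots> \<le> th1 * Q t \<omega>"
    unfolding Q_def using assms
    by (intro mult_mono sum_th_le sum_le_suminf th1_nonneg sum_nonneg) (auto simp: good_def)
  finally show ?thesis .
qed

lemma Up_tendsto:
  assumes "good t \<omega>"
  shows "(\<lambda>n. Up n t \<omega>) \<longlonglongrightarrow> U t \<omega>"
proof -
  have "summable (\<lambda>k. \<bar>th k\<bar> + \<bar>th k\<bar> * (EE t k \<omega>)\<^sup>2)"
    using assms by (intro summable_add summable_th) (simp add: good_def)
  then have s: "summable (\<lambda>k. \<bar>th k * EE t k \<omega>\<bar>)"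
  proof (rule summable_comparison_test'[where N = 0])
    fix k
    \<comment> \<open>Bounding a number by one plus its square reduces absolute convergence of the
      process to the two series already known to converge.\<close>
    have "\<bar>EE t k \<omega>\<bar> \<le> 1 + (EE t k \<omega>)\<^sup>2"
      using sum_power2_ge_zero[of "\<bar>EE t k \<omega>\<bar> - 1" "EE t k \<omega>"]
      by (auto simp: power2_eq_square algebra_simps abs_if split: if_splits)
    then have "\<bar>th k\<bar> * \<bar>EE t k \<omega>\<bar> \<le> \<bar>th k\<bar> * (1 + (EE t k \<omega>)\<^sup>2)"
      by (rule mult_left_mono) simp
    then show "norm \<bar>th k * EE t k \<omega>\<bar> \<le> \<bar>th k\<bar> + \<bar>th k\<bar> * (EE t k \<omega>)\<^sup>2"
      by (simp add: abs_mult distrib_left)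
  qed
  then have "U t \<omega> = suminf (\<lambda>k. th k * EE t k \<omega>)"
    unfolding lin_proc_def using infsum_int_decode(1)[of "\<lambda>i. \<theta> i * E (t - i) \<omega>"] by simp
  then show ?thesis
    unfolding Up_def using summable_LIMSEQ[OF summable_rabs_cancel[OF s]] by simp
qed

lemma U_bound: "good t \<omega> \<Longrightarrow> (U t \<omega>)\<^sup>2 \<le> th1 * Q t \<omega>"
  using Up_bound by (intro LIMSEQ_le_const2[OF tendsto_power[OF Up_tendsto]]) auto

lemma abs_mult_le_half_sq: "\<bar>a * b\<bar> \<le> (a\<^sup>2 + b\<^sup>2) / (2::real)"
  using sum_squares_bound[of "\<bar>a\<bar>" "\<bar>b\<bar>"] by (simp add: abs_mult)

lemma U_mult_bound:
  assumes "good s \<omega>" "good t \<omega>"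
  shows "\<bar>Up n s \<omega> * Up n t \<omega>\<bar> \<le> th1 * (Q s \<omega> + Q t \<omega>)"
    and "\<bar>U s \<omega> * U t \<omega>\<bar> \<le> th1 * (Q s \<omega> + Q t \<omega>)"
proof -
  have "0 \<le> th1 * (Q s \<omega> + Q t \<omega>)"
    using Q_nonneg assms th1_nonneg by simp
  then show "\<bar>Up n s \<omega> * Up n t \<omega>\<bar> \<le> th1 * (Q s \<omega> + Q t \<omega>)"
    "\<bar>U s \<omega> * U t \<omega>\<bar> \<le> th1 * (Q s \<omega> + Q t \<omega>)"
    using abs_mult_le_half_sq[of "Up n s \<omega>" "Up n t \<omega>"] Up_bound[OF assms(1), of n] Up_bound[OF assms(2), of n]
      abs_mult_le_half_sq[of "U s \<omega>" "U t \<omega>"] U_bound[OF assms(1)] U_bound[OF assms(2)]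
    by (simp_all add: distrib_left)
qed

lemma U_mult_integrable: "integrable M (\<lambda>\<omega>. U s \<omega> * U t \<omega>)"
proof (rule Bochner_Integration.integrable_bound)
  show "integrable M (\<lambda>\<omega>. th1 * (Q s \<omega> + Q t \<omega>))"
    using Q_integrable by simp
  show "AE \<omega> in M. norm (U s \<omega> * U t \<omega>) \<le> norm (th1 * (Q s \<omega> + Q t \<omega>))"
    using AE_good[of s] AE_good[of t]
    by eventually_elim (unfold real_norm_def, rule order_trans[OF U_mult_bound(2) abs_ge_self])
qed simp

lemma Up_mult_tendsto:
  "(\<lambda>n. expectation (\<lambda>\<omega>. Up n s \<omega> * Up n t \<omega>)) \<longlonglongrightarrow> expectation (\<lambda>\<omega>. U s \<omega> * U t \<omega>)"
proof (rule integral_dominated_convergence)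
  show "integrable M (\<lambda>\<omega>. th1 * (Q s \<omega> + Q t \<omega>))"
    using Q_integrable by simp
  show "AE \<omega> in M. (\<lambda>n. Up n s \<omega> * Up n t \<omega>) \<longlonglongrightarrow> U s \<omega> * U t \<omega>"
    using AE_good[of s] AE_good[of t]
    by eventually_elim (intro tendsto_mult Up_tendsto)
  show "AE \<omega> in M. norm (Up n s \<omega> * Up n t \<omega>) \<le> th1 * (Q s \<omega> + Q t \<omega>)" for n
    using AE_good[of s] AE_good[of t]
    by eventually_elim (use U_mult_bound(1) in auto)
qed auto

lemma U_mean: "expectation (U t) = 0"
proof -
  have "(\<lambda>n. expectation (Up n t)) \<longlonglongrightarrow> expectation (U t)"
  proof (rule integral_dominated_convergence)
    show "integrable M (\<lambda>\<omega>. 1 + th1 * Q t \<omega>)"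
      using Q_integrable by simp
    show "AE \<omega> in M. (\<lambda>n. Up n t \<omega>) \<longlonglongrightarrow> U t \<omega>"
      using AE_good[of t] by eventually_elim (rule Up_tendsto)
    show "AE \<omega> in M. norm (Up n t \<omega>) \<le> 1 + th1 * Q t \<omega>" for n
      using AE_good[of t]
    proof eventually_elim
      case (elim \<omega>)
      have "\<bar>Up n t \<omega> * 1\<bar> \<le> ((Up n t \<omega>)\<^sup>2 + 1\<^sup>2) / 2" by (rule abs_mult_le_half_sq)
      with Up_bound[OF elim, of n] show ?case by simp
    qed
  qed auto
  moreover have "expectation (Up n t) = 0" for n
    unfolding Up_def[abs_def] by (simp add: E_int E_mean)
  ultimately show ?thesis by (simp add: LIMSEQ_const_iff)
qed

section \<open>Autocovariances of the linear process\<close>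

definition gam :: "nat \<Rightarrow> int \<Rightarrow> real" where
  "gam n i = (\<Sum>k<n. \<Sum>l<n. if int_decode l = int_decode k + i then \<sigma>\<^sup>2 * th k * th l else 0)"

lemma Up_mult_expectation: "expectation (\<lambda>\<omega>. Up n s \<omega> * Up n t \<omega>) = gam n (t - s)"
proof -
  have "expectation (\<lambda>\<omega>. Up n s \<omega> * Up n t \<omega>) =
      expectation (\<lambda>\<omega>. \<Sum>k<n. \<Sum>l<n. th k * th l * (EE s k \<omega> * EE t l \<omega>))"
    unfolding Up_def by (simp add: sum_product mult_ac)
  also have "\<dots> = (\<Sum>k<n. \<Sum>l<n. th k * th l * expectation (\<lambda>\<omega>. EE s k \<omega> * EE t l \<omega>))"
    by (simp add: E_mult(1))
  also have "\<dots> = gam n (t - s)"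
    unfolding gam_def E_mult(2) by (intro sum.cong refl) auto
  finally show ?thesis .
qed

definition \<gamma> :: "int \<Rightarrow> real" where "\<gamma> i = expectation (\<lambda>\<omega>. U 0 \<omega> * U i \<omega>)"

lemma gam_tendsto: "(\<lambda>n. gam n i) \<longlonglongrightarrow> \<gamma> i"
  using Up_mult_tendsto[of 0 i] by (simp add: Up_mult_expectation \<gamma>_def)

lemma U_mult_expectation: "expectation (\<lambda>\<omega>. U s \<omega> * U t \<omega>) = \<gamma> (t - s)"
  using LIMSEQ_unique[OF Up_mult_tendsto[of s t, unfolded Up_mult_expectation] gam_tendsto] .

lemma \<gamma>_even: "\<gamma> (- i) = \<gamma> i"
  using U_mult_expectation[of 0 i] U_mult_expectation[of i 0] by (simp add: mult.commute)

lemma cov_U: "cov M (U 0) (U i) = \<gamma> i"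
  unfolding cov_def U_mean by (simp add: \<gamma>_def)

text \<open>Each pair of lags contributes to only one index \<open>i\<close>, so summing over
  \<open>i\<close> cannot exceed the full double sum. The bound does not depend on \<open>n\<close>
  and therefore survives the limit in \<open>\<gamma>_summable\<close>.\<close>

lemma sum_gam_le:
  assumes "finite K" shows "(\<Sum>i\<in>K. \<bar>gam n i\<bar>) \<le> \<sigma>\<^sup>2 * th1\<^sup>2"
proof -
  have "(\<Sum>i\<in>K. \<bar>gam n i\<bar>) \<le> (\<Sum>i\<in>K. \<Sum>k<n. \<Sum>l<n. if i = int_decode l - int_decode k then \<sigma>\<^sup>2 * (\<bar>th k\<bar> * \<bar>th l\<bar>) else 0)"
    unfolding gam_def
    by (intro sum_mono order_trans[OF sum_abs]) (auto simp: abs_mult)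
  also have "\<dots> = (\<Sum>k<n. \<Sum>l<n. \<Sum>i\<in>K. if i = int_decode l - int_decode k then \<sigma>\<^sup>2 * (\<bar>th k\<bar> * \<bar>th l\<bar>) else 0)"
    by (subst sum.swap, intro sum.cong refl, rule sum.swap)
  also have "\<dots> \<le> (\<Sum>k<n. \<Sum>l<n. \<sigma>\<^sup>2 * (\<bar>th k\<bar> * \<bar>th l\<bar>))"
    using assms by (intro sum_mono) auto
  also have "\<dots> = \<sigma>\<^sup>2 * (\<Sum>k<n. \<Sum>l<n. \<bar>th k\<bar> * \<bar>th l\<bar>)"
    by (simp only: sum_distrib_left)
  also have "(\<Sum>k<n. \<Sum>l<n. \<bar>th k\<bar> * \<bar>th l\<bar>) = (\<Sum>k<n. \<bar>th k\<bar>)\<^sup>2"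
    by (simp add: power2_eq_square sum_product)
  also have "\<sigma>\<^sup>2 * (\<Sum>k<n. \<bar>th k\<bar>)\<^sup>2 \<le> \<sigma>\<^sup>2 * th1\<^sup>2"
    by (intro mult_left_mono power_mono sum_th_le sum_nonneg) auto
  finally show ?thesis .
qed

lemma \<gamma>_summable: "(\<lambda>i. \<bar>\<gamma> i\<bar>) summable_on UNIV"
proof (rule nonneg_bdd_above_summable_on)
  show "bdd_above (sum (\<lambda>i. \<bar>\<gamma> i\<bar>) ` {F. F \<subseteq> UNIV \<and> finite F})"
  proof (rule bdd_aboveI2)
    fix K :: "int set" assume "K \<in> {F. F \<subseteq> UNIV \<and> finite F}"
    then have "finite K" by simp
    show "(\<Sum>i\<in>K. \<bar>\<gamma> i\<bar>) \<le> \<sigma>\<^sup>2 * th1\<^sup>2"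
      by (rule LIMSEQ_le_const2[of "\<lambda>n. \<Sum>i\<in>K. \<bar>gam n i\<bar>"])
        (auto intro!: tendsto_intros gam_tendsto sum_gam_le \<open>finite K\<close>)
  qed
qed simp

section \<open>Linear functionals of the process and of its truncations\<close>

definition W :: "laurent \<Rightarrow> 'a \<Rightarrow> real" where
  "W v \<omega> = (\<Sum>t\<in>supp v. coef v t * U t \<omega>)"

definition Wn :: "nat \<Rightarrow> laurent \<Rightarrow> 'a \<Rightarrow> real" where
  "Wn n v \<omega> = (\<Sum>t\<in>supp v. coef v t * Up n t \<omega>)"

definition LE :: "laurent \<Rightarrow> 'a \<Rightarrow> real" where
  "LE a \<omega> = (\<Sum>s\<in>supp a. coef a s * E s \<omega>)"

lemma W_superset: "finite S \<Longrightarrow> supp v \<subseteq> S \<Longrightarrow> W v \<omega> = (\<Sum>t\<in>S. coef v t * U t \<omega>)"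
  unfolding W_def by (intro sum.mono_neutral_left) (auto simp: in_keys_iff)

lemma LE_superset: "finite S \<Longrightarrow> supp a \<subseteq> S \<Longrightarrow> LE a \<omega> = (\<Sum>t\<in>S. coef a t * E t \<omega>)"
  unfolding LE_def by (intro sum.mono_neutral_left) (auto simp: in_keys_iff)

lemma LE_add: "LE (a + b) \<omega> = LE a \<omega> + LE b \<omega>"
proof -
  have "supp (a + b) \<subseteq> supp a \<union> supp b" by (rule keys_add)
  then show ?thesis
    by (subst (1 2 3) LE_superset[of "supp a \<union> supp b"])
      (auto simp: lookup_add distrib_right sum.distrib)
qed

lemma LE_zero: "LE 0 \<omega> = 0"
  by (simp add: LE_def)

lemma LE_sum: "LE (\<Sum>x\<in>A. f x) \<omega> = (\<Sum>x\<in>A. LE (f x) \<omega>)"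
  by (induction A rule: infinite_finite_induct) (auto simp: LE_add LE_zero)

lemma LE_mono1: "LE (mono1 k c) \<omega> = c * E k \<omega>"
  by (subst LE_superset[of "{k}"]) auto

text \<open>The transpose of the truncated filter, hence the negated exponents. A weighted sum of
  \<open>Up n t\<close> with weights \<open>v\<close> is the weighted sum of the independent
  innovations with weights \<open>cn n * v\<close> (\<open>LE_cn\<close>).\<close>

definition cn :: "nat \<Rightarrow> laurent" where
  "cn n = (\<Sum>k<n. mono1 (- int_decode k) (th k))"

lemma LE_cn: "LE (cn n * v) \<omega> = Wn n v \<omega>"
proof -
  have "v = restr (supp v) (coef v)" by (simp add: restr_coef)
  then have "cn n * v = cn n * restr (supp v) (coef v)" by simp
  also have "LE \<dots> \<omega> = (\<Sum>t\<in>supp v. coef v t * Up n t \<omega>)"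
    unfolding cn_def restr_def sum_product LE_sum mult_single LE_mono1 Up_def
    by (subst sum.swap) (simp add: sum_distrib_left mult_ac)
  finally show ?thesis by (simp add: Wn_def)
qed

text \<open>Together with \<open>nrm_cn_le\<close>: filtering inflates the largest weight and the l2
  norm by at most \<open>th1\<close>, whatever the truncation \<open>n\<close>. This uniformity lets
  the Gaussian bound pass to the full process.\<close>

lemma coef_mult_abs_le:
  assumes "\<And>s. \<bar>coef v s\<bar> \<le> m"
  shows "\<bar>coef (cn n * v) s\<bar> \<le> th1 * m"
proof -
  have m: "0 \<le> m" using order_trans[OF abs_ge_zero assms] .
  have "\<bar>coef (cn n * v) s\<bar> \<le> (\<Sum>k<n. \<bar>th k\<bar> * \<bar>coef v (s + int_decode k)\<bar>)"
    unfolding cn_def sum_distrib_right lookup_sum coef_mono1_mult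
    by (rule order_trans[OF sum_abs]) (simp add: abs_mult)
  also have "\<dots> \<le> (\<Sum>k<n. \<bar>th k\<bar> * m)"
    by (intro sum_mono mult_left_mono assms) auto
  also have "\<dots> = (\<Sum>k<n. \<bar>th k\<bar>) * m" by (simp add: sum_distrib_right)
  also have "\<dots> \<le> th1 * m" by (intro mult_right_mono sum_th_le m)
  finally show ?thesis .
qed

lemma nrm_cn_le: "nrm (cn n * v) \<le> th1 * nrm v"
proof -
  have "cmod (ft (cn n) w) \<le> th1" for w
    unfolding cn_def ft_sum ft_mono1
    by (rule order_trans[OF _ sum_th_le[of n]], rule sum_norm_le) (simp add: norm_mult)
  then show ?thesis by (intro nrm_mult_le)
qed

lemma LE_measurable [measurable]: "LE a \<in> borel_measurable M"
  unfolding LE_def[abs_def] by measurable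

lemma W_measurable [measurable]: "W a \<in> borel_measurable M"
  unfolding W_def[abs_def] by measurable

lemma Wn_measurable [measurable]: "Wn n a \<in> borel_measurable M"
  unfolding Wn_def[abs_def] by measurable

lemma LE_sq: "expectation (\<lambda>\<omega>. (LE a \<omega>)\<^sup>2) = \<sigma>\<^sup>2 * (nrm a)\<^sup>2"
proof -
  have "expectation (\<lambda>\<omega>. (LE a \<omega>)\<^sup>2) =
     expectation (\<lambda>\<omega>. \<Sum>s\<in>supp a. \<Sum>t\<in>supp a. coef a s * coef a t * (E s \<omega> * E t \<omega>))"
    unfolding LE_def power2_eq_square sum_product by (simp add: mult_ac)
  also have "\<dots> = (\<Sum>s\<in>supp a. \<Sum>t\<in>supp a. coef a s * coef a t * (if s = t then \<sigma>\<^sup>2 else 0))"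
    by (simp add: E_mult)
  also have "\<dots> = (\<Sum>s\<in>supp a. \<sigma>\<^sup>2 * (coef a s * coef a s))"
    by (intro sum.cong refl) (simp add: if_distrib[of "\<lambda>x. _ * x"] mult_ac cong: if_cong)
  also have "\<dots> = \<sigma>\<^sup>2 * ip a a"
    by (simp add: ip_eq_sum[of "supp a"] sum_distrib_left)
  finally show ?thesis by (simp add: nrm_sq)
qed

lemma W_sq_integrable: "integrable M (\<lambda>\<omega>. (W v \<omega>)\<^sup>2)"
proof -
  have "(\<lambda>\<omega>. (W v \<omega>)\<^sup>2) = (\<lambda>\<omega>. \<Sum>s\<in>supp v. \<Sum>t\<in>supp v. (coef v s * coef v t) * (U s \<omega> * U t \<omega>))"
    unfolding W_def power2_eq_square sum_product by (simp add: mult_ac)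
  then show ?thesis by (simp add: U_mult_integrable)
qed

lemma W_sq: 
  assumes "finite S" "supp v \<subseteq> S"
  shows "expectation (\<lambda>\<omega>. (W v \<omega>)\<^sup>2) = (\<Sum>s\<in>S. \<Sum>t\<in>S. coef v s * \<gamma> (t - s) * coef v t)"
proof -
  have "expectation (\<lambda>\<omega>. (W v \<omega>)\<^sup>2) =
    expectation (\<lambda>\<omega>. \<Sum>s\<in>S. \<Sum>t\<in>S. (coef v s * coef v t) * (U s \<omega> * U t \<omega>))"
    unfolding W_superset[OF assms] power2_eq_square sum_product by (simp add: mult_ac)
  also have "\<dots> = (\<Sum>s\<in>S. \<Sum>t\<in>S. (coef v s * coef v t) * \<gamma> (t - s))"
    by (simp add: U_mult_integrable U_mult_expectation)
  finally show ?thesis by (simp add: mult_ac)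
qed

lemma Wn_sq_tendsto: "(\<lambda>n. expectation (\<lambda>\<omega>. (Wn n v \<omega>)\<^sup>2)) \<longlonglongrightarrow> expectation (\<lambda>\<omega>. (W v \<omega>)\<^sup>2)"
proof -
  have EEint: "integrable M (\<lambda>\<omega>. Up n s \<omega> * Up n t \<omega>)" for n s t
  proof -
    have "(\<lambda>\<omega>. Up n s \<omega> * Up n t \<omega>) = (\<lambda>\<omega>. \<Sum>k<n. \<Sum>l<n. th k * th l * (EE s k \<omega> * EE t l \<omega>))"
      unfolding Up_def by (simp add: sum_product mult_ac)
    then show ?thesis by (simp add: E_mult(1))
  qed
  have "expectation (\<lambda>\<omega>. (Wn n v \<omega>)\<^sup>2) = (\<Sum>s\<in>supp v. \<Sum>t\<in>supp v. coef v s * gam n (t - s) * coef v t)" for n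
  proof -
    have "expectation (\<lambda>\<omega>. (Wn n v \<omega>)\<^sup>2) =
      expectation (\<lambda>\<omega>. \<Sum>s\<in>supp v. \<Sum>t\<in>supp v. (coef v s * coef v t) * (Up n s \<omega> * Up n t \<omega>))"
      unfolding Wn_def power2_eq_square sum_product by (simp add: mult_ac)
    also have "\<dots> = (\<Sum>s\<in>supp v. \<Sum>t\<in>supp v. (coef v s * coef v t) * gam n (t - s))"
      by (simp add: EEint Up_mult_expectation)
    finally show ?thesis by (simp add: mult_ac)
  qed
  then show ?thesis
    unfolding W_sq[OF finite_keys subset_refl] by (auto intro!: tendsto_intros gam_tendsto)
qed

lemma Wn_char_tendsto:
  "(\<lambda>n. CLINT \<omega>|M. iexp (Wn n v \<omega>)) \<longlonglongrightarrow> (CLINT \<omega>|M. iexp (W v \<omega>))"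
proof (rule integral_dominated_convergence[where w = "\<lambda>_. 1"])
  \<comment> \<open>The index set is countable, so one null set serves all times at once.\<close>
  have "AE \<omega> in M. \<forall>t. good t \<omega>"
    using AE_good by (simp add: AE_all_countable)
  then show "AE \<omega> in M. (\<lambda>n. iexp (Wn n v \<omega>)) \<longlonglongrightarrow> iexp (W v \<omega>)"
    by eventually_elim (auto simp: Wn_def W_def intro!: tendsto_intros Up_tendsto)
qed auto

section \<open>Lindeberg's comparison with a Gaussian characteristic function\<close>

definition tail :: "real \<Rightarrow> real" where
  "tail \<delta> = (SUP t. \<integral>e. e\<^sup>2 * indicator {e. \<bar>e\<bar> > \<delta>} e \<partial>(distr M borel (E t)))"

lemma tail_int:
  "(\<integral>e. e\<^sup>2 * indicator {e. \<bar>e\<bar> > \<delta>} e \<partial>(distr M borel (E t))) = expectation (\<lambda>\<omega>. (E t \<omega>)\<^sup>2 * indicator {e. \<bar>e\<bar> > \<delta>} (E t \<omega>))"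
  by (subst integral_distr) auto

lemma E_sq_tail_integrable: "integrable M (\<lambda>\<omega>. (E t \<omega>)\<^sup>2 * indicator {e. \<bar>e\<bar> > \<delta>} (E t \<omega>))"
  by (rule Bochner_Integration.integrable_bound[OF E_sq[of t]]) (auto simp: indicator_def)

text \<open>The supremum is taken over real numbers and must be shown to be bounded; the common
  variance is an upper bound.\<close>

lemma le_tail: "expectation (\<lambda>\<omega>. (E t \<omega>)\<^sup>2 * indicator {e. \<bar>e\<bar> > \<delta>} (E t \<omega>)) \<le> tail \<delta>"
  unfolding tail_def tail_int
proof (rule cSUP_upper)
  show "bdd_above (range (\<lambda>t. expectation (\<lambda>\<omega>. (E t \<omega>)\<^sup>2 * indicator {e. \<bar>e\<bar> > \<delta>} (E t \<omega>))))"
  proof (rule bdd_aboveI2)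
    fix t
    show "expectation (\<lambda>\<omega>. (E t \<omega>)\<^sup>2 * indicator {e. \<bar>e\<bar> > \<delta>} (E t \<omega>)) \<le> \<sigma>\<^sup>2"
      unfolding E_var[of t, symmetric]
      by (intro integral_mono E_sq_tail_integrable E_sq) (auto simp: indicator_def)
  qed
qed simp

text \<open>The error per unit of squared weight when all weights are at most \<open>m\<close>:
  innovations beyond \<open>\<delta>\<close>, the cubic Taylor term of those below
  \<open>\<delta>\<close>, and the second-order error of the Gaussian exponential.\<close>

definition lind :: "real \<Rightarrow> real \<Rightarrow> real" where
  "lind \<delta> m = tail \<delta> + m * \<delta> * \<sigma>\<^sup>2 / 6 + \<sigma>^4 * m\<^sup>2 / 8"

text \<open>Both functions are compared with \<open>1 - a\<^sup>2 * \<sigma>\<^sup>2 / 2\<close>. In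
  the Taylor remainder, a minimum of a quadratic and a cubic term, the quadratic one is used where
  the innovation exceeds \<open>\<delta>\<close> and the cubic one elsewhere.\<close>

lemma char_E_bound:
  assumes "\<bar>a\<bar> \<le> m" "0 \<le> \<delta>"
  shows "cmod (char (distr M borel (E t)) a - of_real (exp (- (\<sigma>\<^sup>2 * a\<^sup>2) / 2))) \<le> a\<^sup>2 * lind \<delta> m"
proof -
  interpret D: real_distribution "distr M borel (E t)" by simp
  have m: "0 \<le> m" using assms(1) by linarith
  have "cmod (char (distr M borel (E t)) a - (1 - a\<^sup>2 * \<sigma>\<^sup>2 / 2)) \<le>
    (a\<^sup>2 / 6) * D.expectation (\<lambda>x. min (6 * x\<^sup>2) (\<bar>a\<bar> * \<bar>x\<bar> ^ 3))"
    by (rule D.char_approx3) (auto simp: integrable_distr_eq integral_distr E_int E_sq E_mean E_var)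
  also have "D.expectation (\<lambda>x. min (6 * x\<^sup>2) (\<bar>a\<bar> * \<bar>x\<bar> ^ 3)) = expectation (\<lambda>\<omega>. min (6 * (E t \<omega>)\<^sup>2) (\<bar>a\<bar> * \<bar>E t \<omega>\<bar> ^ 3))"
    by (subst integral_distr) auto
  also have "\<dots> \<le> expectation (\<lambda>\<omega>. 6 * ((E t \<omega>)\<^sup>2 * indicator {e. \<bar>e\<bar> > \<delta>} (E t \<omega>)) + m * \<delta> * (E t \<omega>)\<^sup>2)"
  proof (rule integral_mono)
    show "integrable M (\<lambda>\<omega>. min (6 * (E t \<omega>)\<^sup>2) (\<bar>a\<bar> * \<bar>E t \<omega>\<bar> ^ 3))"
      by (rule Bochner_Integration.integrable_bound[of _ "\<lambda>\<omega>. 6 * (E t \<omega>)\<^sup>2"]) (auto simp: E_sq min_def)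
    show "integrable M (\<lambda>\<omega>. 6 * ((E t \<omega>)\<^sup>2 * indicator {e. \<bar>e\<bar> > \<delta>} (E t \<omega>)) + m * \<delta> * (E t \<omega>)\<^sup>2)"
      using E_sq E_sq_tail_integrable by simp
    fix \<omega>
    show "min (6 * (E t \<omega>)\<^sup>2) (\<bar>a\<bar> * \<bar>E t \<omega>\<bar> ^ 3) \<le> 6 * ((E t \<omega>)\<^sup>2 * indicator {e. \<bar>e\<bar> > \<delta>} (E t \<omega>)) + m * \<delta> * (E t \<omega>)\<^sup>2"
    proof (cases "\<bar>E t \<omega>\<bar> > \<delta>")
      case True
      then show ?thesis using m assms by (simp add: min.coboundedI1)
    next
      case False
      have "\<bar>a\<bar> * \<bar>E t \<omega>\<bar> ^ 3 = \<bar>a\<bar> * \<bar>E t \<omega>\<bar> * (E t \<omega>)\<^sup>2"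
        by (simp add: power3_eq_cube power2_eq_square flip: abs_mult)
      also have "\<dots> \<le> m * \<delta> * (E t \<omega>)\<^sup>2"
        using False assms m by (intro mult_right_mono mult_mono) auto
      finally show ?thesis using False by (simp add: min.coboundedI2)
    qed
  qed
  also have "\<dots> = 6 * expectation (\<lambda>\<omega>. (E t \<omega>)\<^sup>2 * indicator {e. \<bar>e\<bar> > \<delta>} (E t \<omega>)) + m * \<delta> * \<sigma>\<^sup>2"
    using E_sq E_sq_tail_integrable by (simp add: E_var)
  also have "\<dots> \<le> 6 * tail \<delta> + m * \<delta> * \<sigma>\<^sup>2"
    using le_tail by simp
  finally have 1: "cmod (char (distr M borel (E t)) a - (1 - a\<^sup>2 * \<sigma>\<^sup>2 / 2)) \<le> (a\<^sup>2 / 6) * (6 * tail \<delta> + m * \<delta> * \<sigma>\<^sup>2)"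
    by (simp add: mult_left_mono)
  have "cmod (1 - a\<^sup>2 * \<sigma>\<^sup>2 / 2 - of_real (exp (- (\<sigma>\<^sup>2 * a\<^sup>2) / 2))) \<le> (\<sigma>\<^sup>2 * a\<^sup>2 / 2)\<^sup>2 / 2"
  proof -
    define x where "x = \<sigma>\<^sup>2 * a\<^sup>2 / 2"
    have x: "0 \<le> x" by (simp add: x_def)
    have lo: "1 - x \<le> exp (- x)" using exp_ge_add_one_self[of "- x"] by simp
    have hi: "exp (- x) \<le> 1 - x + x\<^sup>2 / 2"
    proof -
      have "1 / exp x \<le> 1 / (1 + x + x\<^sup>2 / 2)"
        using x exp_lower_Taylor_quadratic[OF x] by (intro divide_left_mono) (auto intro!: mult_pos_pos add_pos_nonneg)
      also have "\<dots> \<le> 1 - x + x\<^sup>2 / 2"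
      proof -
        \<comment> \<open>The product equals \<open>1 + x ^ 4 / 4\<close>.\<close>
        have "1 \<le> (1 - x + x\<^sup>2 / 2) * (1 + x + x\<^sup>2 / 2)"
          using x by (simp add: power2_eq_square algebra_simps)
        then show ?thesis using x by (subst divide_le_eq) (auto simp: add_pos_nonneg)
      qed
      finally show ?thesis by (simp add: exp_minus inverse_eq_divide)
    qed
    have "1 - a\<^sup>2 * \<sigma>\<^sup>2 / 2 - of_real (exp (- (\<sigma>\<^sup>2 * a\<^sup>2) / 2)) = complex_of_real (1 - x - exp (- x))"
      by (simp add: x_def mult.commute)
    then have "cmod (1 - a\<^sup>2 * \<sigma>\<^sup>2 / 2 - of_real (exp (- (\<sigma>\<^sup>2 * a\<^sup>2) / 2))) = \<bar>1 - x - exp (- x)\<bar>"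
      by (simp only: norm_of_real)
    also have "\<dots> \<le> x\<^sup>2 / 2" using lo hi by simp
    finally show ?thesis by (simp add: x_def)
  qed
  also have "\<dots> = a\<^sup>2 * (\<sigma>^4 * a\<^sup>2 / 8)"
    by (simp add: power2_eq_square power4_eq_xxxx)
  also have "\<dots> \<le> a\<^sup>2 * (\<sigma>^4 * m\<^sup>2 / 8)"
    using assms(1) m by (intro mult_left_mono divide_right_mono) (auto simp: abs_le_square_iff[symmetric])
  finally have 2: "cmod (1 - a\<^sup>2 * \<sigma>\<^sup>2 / 2 - of_real (exp (- (\<sigma>\<^sup>2 * a\<^sup>2) / 2))) \<le> a\<^sup>2 * (\<sigma>^4 * m\<^sup>2 / 8)" .
  have "cmod (char (distr M borel (E t)) a - of_real (exp (- (\<sigma>\<^sup>2 * a\<^sup>2) / 2))) \<le>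
    cmod (char (distr M borel (E t)) a - (1 - a\<^sup>2 * \<sigma>\<^sup>2 / 2)) + cmod (1 - a\<^sup>2 * \<sigma>\<^sup>2 / 2 - of_real (exp (- (\<sigma>\<^sup>2 * a\<^sup>2) / 2)))"
    by (rule order_trans[OF _ norm_triangle_ineq]) simp
  also have "\<dots> \<le> (a\<^sup>2 / 6) * (6 * tail \<delta> + m * \<delta> * \<sigma>\<^sup>2) + a\<^sup>2 * (\<sigma>^4 * m\<^sup>2 / 8)"
    by (rule add_mono[OF 1 2])
  also have "\<dots> = a\<^sup>2 * lind \<delta> m" by (simp add: lind_def field_simps)
  finally show ?thesis .
qed

text \<open>By independence the characteristic function is a product, and the Gaussian one with the
  same variance factors alike. The errors per factor add up to the squared norm of the weights times
  \<open>lind\<close>.\<close>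

lemma LE_char_bound:
  assumes "\<And>s. \<bar>coef a s\<bar> \<le> m" "0 \<le> \<delta>"
  shows "cmod ((CLINT \<omega>|M. iexp (LE a \<omega>)) - of_real (exp (- expectation (\<lambda>\<omega>. (LE a \<omega>)\<^sup>2) / 2))) \<le> (nrm a)\<^sup>2 * lind \<delta> m"
proof -
  have rd: "real_distribution (distr M borel (E s))" for s by simp
  have "indep_vars (\<lambda>_. borel) (\<lambda>s \<omega>. coef a s * E s \<omega>) (supp a)"
    by (rule indep_vars_compose2[OF indep_vars_subset[OF E_indep], where Y = "\<lambda>s x. coef a s * x"]) auto
  from char_distr_sum[OF this, of 1]
  have "(CLINT \<omega>|M. iexp (LE a \<omega>)) = (\<Prod>s\<in>supp a. char (distr M borel (\<lambda>\<omega>. coef a s * E s \<omega>)) 1)"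
    by (simp add: char_def integral_distr LE_def)
  also have "\<dots> = (\<Prod>s\<in>supp a. char (distr M borel (E s)) (coef a s))"
    by (simp add: char_def integral_distr)
  finally have 1: "(CLINT \<omega>|M. iexp (LE a \<omega>)) = \<dots>" .
  have "of_real (exp (- expectation (\<lambda>\<omega>. (LE a \<omega>)\<^sup>2) / 2)) =
     (\<Prod>s\<in>supp a. complex_of_real (exp (- (\<sigma>\<^sup>2 * (coef a s)\<^sup>2) / 2)))"
    unfolding LE_sq nrm_sq of_real_prod[symmetric] exp_sum[OF finite_keys, symmetric]
    by (simp add: ip_eq_sum[of "supp a"] sum_negf sum_distrib_left sum_divide_distrib power2_eq_square)
  then have "cmod ((CLINT \<omega>|M. iexp (LE a \<omega>)) - of_real (exp (- expectation (\<lambda>\<omega>. (LE a \<omega>)\<^sup>2) / 2))) \<le>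
    (\<Sum>s\<in>supp a. cmod (char (distr M borel (E s)) (coef a s) - complex_of_real (exp (- (\<sigma>\<^sup>2 * (coef a s)\<^sup>2) / 2))))"
    unfolding 1 by (simp only:) (intro norm_prod_diff_le real_distribution.cmod_char_le_1 rd, simp)
  also have "\<dots> \<le> (\<Sum>s\<in>supp a. (coef a s)\<^sup>2 * lind \<delta> m)"
    by (intro sum_mono char_E_bound assms)
  also have "\<dots> = (nrm a)\<^sup>2 * lind \<delta> m"
    unfolding nrm_sq by (simp add: ip_eq_sum[of "supp a"] power2_eq_square sum_distrib_right)
  finally show ?thesis .
qed

lemma tail_nonneg: "0 \<le> tail \<delta>"
  by (rule order_trans[OF _ le_tail[of 0]]) (auto intro!: integral_nonneg_AE)

lemma lind_nonneg: "0 \<le> \<delta> \<Longrightarrow> 0 \<le> m \<Longrightarrow> 0 \<le> lind \<delta> m"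
  unfolding lind_def by (intro add_nonneg_nonneg tail_nonneg) auto

lemma W_char_bound:
  assumes m: "\<And>s. \<bar>coef v s\<bar> \<le> m" and d: "0 \<le> \<delta>"
  shows "cmod ((CLINT \<omega>|M. iexp (W v \<omega>)) - of_real (exp (- expectation (\<lambda>\<omega>. (W v \<omega>)\<^sup>2) / 2))) \<le> (th1 * nrm v)\<^sup>2 * lind \<delta> (th1 * m)"
proof (rule LIMSEQ_le_const2)
  show "(\<lambda>n. cmod ((CLINT \<omega>|M. iexp (Wn n v \<omega>)) - of_real (exp (- expectation (\<lambda>\<omega>. (Wn n v \<omega>)\<^sup>2) / 2))))
     \<longlonglongrightarrow> cmod ((CLINT \<omega>|M. iexp (W v \<omega>)) - of_real (exp (- expectation (\<lambda>\<omega>. (W v \<omega>)\<^sup>2) / 2)))"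
    by (intro tendsto_norm tendsto_diff Wn_char_tendsto tendsto_of_real tendsto_exp tendsto_divide
        tendsto_minus Wn_sq_tendsto tendsto_const) simp
  have m0: "0 \<le> m" using order_trans[OF abs_ge_zero m] .
  have "cmod ((CLINT \<omega>|M. iexp (Wn n v \<omega>)) - of_real (exp (- expectation (\<lambda>\<omega>. (Wn n v \<omega>)\<^sup>2) / 2)))
    \<le> (th1 * nrm v)\<^sup>2 * lind \<delta> (th1 * m)" for n
  proof -
    have "cmod ((CLINT \<omega>|M. iexp (LE (cn n * v) \<omega>)) - of_real (exp (- expectation (\<lambda>\<omega>. (LE (cn n * v) \<omega>)\<^sup>2) / 2)))
       \<le> (nrm (cn n * v))\<^sup>2 * lind \<delta> (th1 * m)"
      by (rule LE_char_bound[OF coef_mult_abs_le[OF m] d])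
    also have "\<dots> \<le> (th1 * nrm v)\<^sup>2 * lind \<delta> (th1 * m)"
      using m0 d th1_nonneg by (intro mult_right_mono power_mono nrm_cn_le lind_nonneg) auto
    finally show ?thesis by (simp add: LE_cn)
  qed
  then show "\<exists>N. \<forall>n\<ge>N. cmod ((CLINT \<omega>|M. iexp (Wn n v \<omega>)) - of_real (exp (- expectation (\<lambda>\<omega>. (Wn n v \<omega>)\<^sup>2) / 2)))
    \<le> (th1 * nrm v)\<^sup>2 * lind \<delta> (th1 * m)" by blast
qed

text \<open>The order of choices is the point: first \<open>\<delta>\<close>, to make the uniform
  tail small, then \<open>n\<close>, to make the remaining terms of \<open>lind\<close> vanish with
  the largest weight. The limit variance \<open>V\<close> may be 0.\<close>

theorem linear_process_clt:
  assumes B: "\<forall>\<^sub>F n in sequentially. nrm (v n) \<le> B"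
    and m: "\<forall>\<^sub>F n in sequentially. \<forall>s. \<bar>coef (v n) s\<bar> \<le> m n" "m \<longlonglongrightarrow> 0"
    and V: "(\<lambda>n. expectation (\<lambda>\<omega>. (W (v n) \<omega>)\<^sup>2)) \<longlonglongrightarrow> V"
  shows "(\<lambda>n. CLINT \<omega>|M. iexp (W (v n) \<omega>)) \<longlonglongrightarrow> of_real (exp (- V / 2))"
proof -
  let ?D = "\<lambda>n. (CLINT \<omega>|M. iexp (W (v n) \<omega>)) - of_real (exp (- expectation (\<lambda>\<omega>. (W (v n) \<omega>)\<^sup>2) / 2))"
  have bound: "\<forall>\<^sub>F n in sequentially. cmod (?D n) \<le> (th1 * B)\<^sup>2 * lind \<delta> (th1 * m n)" if "0 \<le> \<delta>" for \<delta>
    using B m(1)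
  proof eventually_elim
    case (elim n)
    have m0: "0 \<le> m n" using elim(2) order_trans[OF abs_ge_zero] by blast
    have "cmod (?D n) \<le> (th1 * nrm (v n))\<^sup>2 * lind \<delta> (th1 * m n)"
      using elim that by (intro W_char_bound) auto
    also have "\<dots> \<le> (th1 * B)\<^sup>2 * lind \<delta> (th1 * m n)"
      using elim that m0 th1_nonneg by (intro mult_right_mono power_mono mult_left_mono lind_nonneg) auto
    finally show ?case .
  qed
  have D0: "?D \<longlonglongrightarrow> 0"
  proof (rule tendstoI)
    fix e :: real assume e: "e > 0"
    \<comment> \<open>The added 1 keeps the divisor positive when \<open>th1 * B\<close> is
      0.\<close>
    define b where "b = (th1 * B)\<^sup>2 + 1"
    have b: "b > 0" "(th1 * B)\<^sup>2 \<le> b" by (auto simp: b_def add_nonneg_pos)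
    have "\<forall>\<^sub>F \<delta> in at_top. tail \<delta> < e / (2 * b)"
      using order_tendstoD(2)[OF unif, of "e / (2 * b)"] e b by (simp add: tail_def)
    then obtain \<delta> where \<delta>: "tail \<delta> < e / (2 * b)" "0 \<le> \<delta>"
      using eventually_happens[OF eventually_conj[OF _ eventually_ge_at_top[of 0]]] by fastforce
    have "(\<lambda>n. lind \<delta> (th1 * m n)) \<longlonglongrightarrow> tail \<delta> + (th1 * 0) * \<delta> * \<sigma>\<^sup>2 / 6 + \<sigma>^4 * (th1 * 0)\<^sup>2 / 8"
      unfolding lind_def by (intro tendsto_intros m(2)) auto
    then have "\<forall>\<^sub>F n in sequentially. lind \<delta> (th1 * m n) < e / (2 * b)"
      using \<delta>(1) by (intro order_tendstoD(2)) auto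
    with bound[OF \<delta>(2)] show "\<forall>\<^sub>F n in sequentially. dist (?D n) 0 < e"
    proof eventually_elim
      case (elim n)
      have "cmod (?D n) \<le> (th1 * B)\<^sup>2 * (e / (2 * b))"
        using elim by (meson less_imp_le mult_left_mono order_trans zero_le_power2)
      also have "\<dots> \<le> b * (e / (2 * b))"
        using b e by (intro mult_right_mono) auto
      also have "\<dots> < e" using b e by simp
      finally show ?case by simp
    qed
  qed
  have "(\<lambda>n. complex_of_real (exp (- expectation (\<lambda>\<omega>. (W (v n) \<omega>)\<^sup>2) / 2))) \<longlonglongrightarrow> of_real (exp (- V / 2))"
    by (intro tendsto_intros V) auto
  from tendsto_add[OF D0 this] show ?thesis by simp
qed

end

section \<open>Convergence in law and the multivariate normal distribution\<close>

lemma quad_shift: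
  fixes C :: "'d::finite \<Rightarrow> 'd \<Rightarrow> real"
  assumes sym: "\<And>i j. C i j = C j i"
  defines "Q \<equiv> \<lambda>v. \<Sum>i\<in>UNIV. \<Sum>j\<in>UNIV. v i * C i j * v j"
  shows "Q (\<lambda>i. v i + (if i = x then t else 0)) = Q v + 2 * t * (\<Sum>j\<in>UNIV. C x j * v j) + t\<^sup>2 * C x x"
proof -
  have "Q (\<lambda>i. v i + (if i = x then t else 0)) =
     (\<Sum>i\<in>UNIV. \<Sum>j\<in>UNIV. v i * C i j * v j + (if j = x then v i * C i j * t else 0)
       + (if i = x then t * C i j * v j else 0) + (if j = x then (if i = x then t * C i j * t else 0) else 0))"
    unfolding Q_def by (intro sum.cong refl) (auto simp: algebra_simps)
  also have "\<dots> = Q v + (\<Sum>i\<in>UNIV. v i * C i x * t) + (\<Sum>i\<in>UNIV. \<Sum>j\<in>UNIV. if i = x then t * C i j * v j else 0) + t * C x x * t"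
    unfolding Q_def sum.distrib by simp
  also have "(\<Sum>i\<in>UNIV. \<Sum>j\<in>UNIV. if i = x then t * C i j * v j else 0) = (\<Sum>j\<in>UNIV. t * C x j * v j)"
    by (subst sum.swap) simp
  also have "(\<Sum>i\<in>UNIV. v i * C i x * t) = t * (\<Sum>j\<in>UNIV. C x j * v j)"
    using sym by (auto simp: sum_distrib_left mult_ac intro!: sum.cong)
  also have "(\<Sum>j\<in>UNIV. t * C x j * v j) = t * (\<Sum>j\<in>UNIV. C x j * v j)"
    by (simp add: sum_distrib_left mult_ac)
  finally show ?thesis by (simp add: power2_eq_square)
qed

text \<open>Cholesky factorisation by induction on the set \<open>S\<close> of possibly nonzero
  rows: either row \<open>x\<close> vanishes, or its rank-one contribution is split off and the
  Schur complement \<open>D\<close> is supported on the smaller set.\<close>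

lemma psd_sum_of_squares:
  fixes C :: "'d::finite \<Rightarrow> 'd \<Rightarrow> real"
  assumes "finite S" "\<And>i j. C i j = C j i"
    and "\<And>v. 0 \<le> (\<Sum>i\<in>UNIV. \<Sum>j\<in>UNIV. v i * C i j * v j)"
    and "\<And>i j. i \<notin> S \<Longrightarrow> C i j = 0"
  shows "\<exists>l. \<forall>i j. C i j = (\<Sum>k\<in>S. l k i * l k j)"
  using assms
proof (induction S arbitrary: C)
  case empty
  then show ?case by simp
next
  case (insert x S)
  note sym = insert.prems(1) and psd = insert.prems(2)
  have diag: "(\<Sum>i\<in>UNIV. \<Sum>j\<in>UNIV. (if i = k then 1 else 0) * C i j * (if j = k then 1 else 0)) = C k k" for k
  proof -
    have "(if i = k then 1 else 0) * C i j * (if j = k then 1 else 0) = (if j = k then (if i = k then C i j else 0) else 0)"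
      for i j by simp
    then show ?thesis by simp
  qed
  have psd': "0 \<le> (\<Sum>i\<in>UNIV. \<Sum>j\<in>UNIV. v i * C i j * v j) + 2 * t * (\<Sum>j\<in>UNIV. C x j * v j) + t\<^sup>2 * C x x" for v t
    using psd[of "\<lambda>i. v i + (if i = x then t else 0)"] by (simp only: quad_shift[OF sym])
  have xx: "C x x \<ge> 0" using psd[of "\<lambda>i. if i = x then 1 else 0"] by (simp only: diag)
  show ?case
  proof (cases "C x x = 0")
    case True
    have "C x k = 0" for k
    proof (rule ccontr)
      assume nz: "C x k \<noteq> 0"
      have "(\<Sum>j\<in>UNIV. C x j * (if j = k then 1 else 0)) = C x k"
        by (simp add: if_distrib[of "\<lambda>z. _ * z"] cong: if_cong)
      then have "0 \<le> C k k + 2 * t * C x k" for t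
        using psd'[of "\<lambda>i. if i = k then 1 else 0" t] by (simp only: diag True)
      \<comment> \<open>With a zero diagonal entry the form is affine in \<open>t\<close>; this
        \<open>t\<close> makes it equal to \<open>- 1\<close>.\<close>
      from this[of "- (C k k + 1) / (2 * C x k)"] have "0 \<le> C k k - (C k k + 1)"
        using nz by (simp add: field_simps)
      then show False by simp
    qed
    then have "C i j = 0" if "i \<notin> S" for i j
      using insert.prems(3) that by (cases "i = x") auto
    then obtain l where l: "\<forall>i j. C i j = (\<Sum>k\<in>S. l k i * l k j)"
      using insert.IH[OF sym psd] by blast
    have "\<forall>i j. C i j = (\<Sum>k\<in>insert x S. (l(x := \<lambda>_. 0)) k i * (l(x := \<lambda>_. 0)) k j)"
      using insert.hyps l by (auto intro!: sum.cong)
    then show ?thesis by blast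
  next
    case False
    with xx have pos: "C x x > 0" by simp
    define D where "D i j = C i j - C x i * C x j / C x x" for i j
    have "\<exists>l. \<forall>i j. D i j = (\<Sum>k\<in>S. l k i * l k j)"
    proof (rule insert.IH)
      show "D i j = D j i" for i j using sym by (simp add: D_def mult.commute)
      show "D i j = 0" if "i \<notin> S" for i j
        using insert.prems(3)[of i] that pos sym[of x i] by (cases "i = x") (auto simp: D_def)
      fix v
      let ?b = "\<Sum>j\<in>UNIV. C x j * v j"
      have "(\<Sum>i\<in>UNIV. \<Sum>j\<in>UNIV. v i * D i j * v j) =
        (\<Sum>i\<in>UNIV. \<Sum>j\<in>UNIV. v i * C i j * v j) - (\<Sum>i\<in>UNIV. \<Sum>j\<in>UNIV. (C x i * v i) * (C x j * v j)) / C x x"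
        by (simp add: D_def sum_subtractf[symmetric] sum_divide_distrib algebra_simps)
      also have "(\<Sum>i\<in>UNIV. \<Sum>j\<in>UNIV. (C x i * v i) * (C x j * v j)) = ?b\<^sup>2"
        by (simp add: power2_eq_square sum_product)
      \<comment> \<open>The form of the Schur complement is the minimum over \<open>t\<close> of the
        shifted form, attained at \<open>- ?b / C x x\<close>.\<close>
      also have "(\<Sum>i\<in>UNIV. \<Sum>j\<in>UNIV. v i * C i j * v j) - ?b\<^sup>2 / C x x =
         (\<Sum>i\<in>UNIV. \<Sum>j\<in>UNIV. v i * C i j * v j) + 2 * (- ?b / C x x) * ?b + (- ?b / C x x)\<^sup>2 * C x x"
        using pos by (simp add: power2_eq_square field_simps)
      also have "0 \<le> \<dots>" by (rule psd')
      finally show "0 \<le> (\<Sum>i\<in>UNIV. \<Sum>j\<in>UNIV. v i * D i j * v j)" .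
    qed
    then obtain l where l: "\<forall>i j. D i j = (\<Sum>k\<in>S. l k i * l k j)" by blast
    define l' where "l' = l(x := \<lambda>i. C x i / sqrt (C x x))"
    have "C i j = (\<Sum>k\<in>insert x S. l' k i * l' k j)" for i j
    proof -
      have "(\<Sum>k\<in>insert x S. l' k i * l' k j) = l' x i * l' x j + (\<Sum>k\<in>S. l k i * l k j)"
        using insert.hyps by (auto simp: l'_def intro!: sum.cong)
      also have "\<dots> = C x i * C x j / C x x + D i j"
        using l pos by (simp add: l'_def)
      finally show ?thesis by (simp add: D_def)
    qed
    then show ?thesis by blast
  qed
qed

text \<open>Guarantees that the choice operator in \<open>mvn\<close> selects an actual square
  root.\<close>

lemma psd_matrix_sqrt:
  fixes C :: "real^'d^'d"
  assumes sym: "\<And>i j. C $ i $ j = C $ j $ i" and psd: "\<And>v. 0 \<le> v \<bullet> (C *v v)"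
  obtains L :: "real^'d^'d" where "L ** transpose L = C"
proof -
  have "0 \<le> (\<Sum>i\<in>UNIV. \<Sum>j\<in>UNIV. v i * C $ i $ j * v j)" for v
    using psd[of "\<chi> i. v i"]
    by (simp add: inner_vec_def matrix_vector_mult_def sum_distrib_left mult.assoc)
  then have "\<exists>l. \<forall>i j. C $ i $ j = (\<Sum>k\<in>(UNIV::'d set). l k i * l k j)"
    using sym by (intro psd_sum_of_squares[where S = UNIV and C = "\<lambda>i j. C $ i $ j"]) simp_all
  then obtain l where l: "\<forall>i j. C $ i $ j = (\<Sum>k\<in>(UNIV::'d set). l k i * l k j)" by blast
  have "(\<chi> i k. l k i) ** transpose (\<chi> i k. l k i) = C"
    by (simp add: vec_eq_iff matrix_matrix_mult_def transpose_def l)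
  then show thesis by (rule that)
qed

section \<open>The standard normal vector and its linear images\<close>

lemma std_normal_vec_density_eq:
  fixes z :: "real^'d"
  shows "(2 * pi) powr (- real CARD('d) / 2) * exp (- (norm z * norm z) / 2)
    = (\<Prod>b\<in>Basis. std_normal_density (z \<bullet> b))"
proof -
  have "(\<Prod>b\<in>(Basis::(real^'d) set). std_normal_density (z \<bullet> b))
     = (1 / sqrt (2 * pi)) ^ CARD('d) * exp (\<Sum>b\<in>Basis. - (z \<bullet> b)\<^sup>2 / 2)"
    unfolding std_normal_density_def prod.distrib by (simp add: exp_sum)
  also have "(\<Sum>b\<in>Basis. - (z \<bullet> b)\<^sup>2 / 2) = - (norm z * norm z) / 2"
    by (simp add: sum_divide_distrib[symmetric] sum_negf power2_eq_square
        euclidean_inner[of z z, symmetric] flip: power2_norm_eq_inner)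
  also have "(1 / sqrt (2 * pi)) ^ CARD('d) = (2 * pi) powr (- real CARD('d) / 2)"
  proof -
    have "1 / sqrt (2 * pi) = (2 * pi) powr (- (1 / 2))"
      by (simp add: powr_minus_divide powr_half_sqrt)
    then have "(1 / sqrt (2 * pi)) ^ CARD('d) = ((2 * pi) powr (- (1 / 2))) powr (real CARD('d))"
      by (simp add: powr_realpow)
    then show ?thesis by (simp add: powr_powr)
  qed
  finally show ?thesis by simp
qed

lemma std_normal_vec_alt:
  "(std_normal_vec :: (real^'d) measure) = density lborel (\<lambda>z. ennreal (\<Prod>b\<in>Basis. std_normal_density (z \<bullet> b)))"
  unfolding std_normal_vec_def std_normal_vec_density_eq ..

lemma sets_std_normal_vec [simp, measurable_cong]: "sets std_normal_vec = sets borel"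
  by (simp add: std_normal_vec_def)

lemma prob_space_std_normal_vec: "prob_space (std_normal_vec :: (real^'d) measure)"
proof
  have "emeasure (std_normal_vec :: (real^'d) measure) (space std_normal_vec)
     = (\<integral>\<^sup>+z. ennreal (\<Prod>b\<in>Basis. std_normal_density (z \<bullet> b)) \<partial>(lborel :: (real^'d) measure))"
    unfolding std_normal_vec_alt by (subst emeasure_density) auto
  also have "\<dots> = (\<integral>\<^sup>+z. (\<Prod>b\<in>Basis. ennreal (std_normal_density (z \<bullet> b))) \<partial>(lborel :: (real^'d) measure))"
    by (simp add: prod_ennreal)
  also have "\<dots> = (\<Prod>b\<in>(Basis :: (real^'d) set). \<integral>\<^sup>+x. ennreal (std_normal_density x) \<partial>lborel)"
    by (rule nn_integral_lborel_prod) auto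
  also have "(\<integral>\<^sup>+x. ennreal (std_normal_density x) \<partial>lborel) = 1"
    using prob_space.emeasure_space_1[OF prob_space_normal_density[of 1 0]]
    by (simp add: emeasure_density)
  finally show "emeasure (std_normal_vec :: (real^'d) measure) (space std_normal_vec) = 1" by simp
qed

text \<open>Density and exponential both factor over the coordinates, so the integral is a product
  of one-dimensional normal characteristic functions.\<close>

lemma char_std_normal_vec:
  fixes \<xi> :: "real^'d"
  shows "(CLINT z|std_normal_vec. iexp (\<xi> \<bullet> z)) = of_real (exp (- (\<xi> \<bullet> \<xi>) / 2))"
proof -
  let ?f = "\<lambda>b x. std_normal_density x *\<^sub>R iexp ((\<xi> \<bullet> b) * x)"
  have int: "integrable lborel (?f b)" for b
  proof -
    interpret N: real_distribution std_normal_distribution by (rule real_dist_normal_dist)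
    have "integrable std_normal_distribution (\<lambda>x. iexp ((\<xi> \<bullet> b) * x))"
      by (rule N.integrable_const_bound[of _ 1]) auto
    then show ?thesis
      by (subst (asm) integrable_density) auto
  qed
  have val: "(LINT x|lborel. ?f b x) = of_real (exp (- ((\<xi> \<bullet> b)\<^sup>2) / 2))" for b
  proof -
    have "(LINT x|lborel. ?f b x) = char std_normal_distribution (\<xi> \<bullet> b)"
      unfolding char_def by (subst integral_density) auto
    then show ?thesis by (simp add: char_std_normal_distribution)
  qed
  interpret product_sigma_finite "\<lambda>_::real^'d. lborel :: real measure" ..
  have "(CLINT z|std_normal_vec. iexp (\<xi> \<bullet> z)) =
    (CLINT z|lborel. (\<Prod>b\<in>Basis. std_normal_density (z \<bullet> b)) *\<^sub>R iexp (\<xi> \<bullet> z))"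
    unfolding std_normal_vec_alt by (subst integral_density) (auto intro!: prod_nonneg)
  also have "\<dots> = (CLINT z|lborel. (\<Prod>b\<in>Basis. ?f b (z \<bullet> b)))"
  proof (rule Bochner_Integration.integral_cong[OF refl])
    fix z :: "real^'d"
    have "iexp (\<xi> \<bullet> z) = (\<Prod>b\<in>Basis. iexp ((\<xi> \<bullet> b) * (z \<bullet> b)))"
      by (subst euclidean_inner) (simp add: exp_sum sum_distrib_left)
    then show "(\<Prod>b\<in>Basis. std_normal_density (z \<bullet> b)) *\<^sub>R iexp (\<xi> \<bullet> z) = (\<Prod>b\<in>Basis. ?f b (z \<bullet> b))"
      by (simp add: scaleR_conv_of_real prod.distrib)
  qed
  also have "\<dots> = (CLINT x|(\<Pi>\<^sub>M b\<in>(Basis::(real^'d) set). lborel). (\<Prod>b\<in>Basis. ?f b ((\<Sum>b\<in>Basis. x b *\<^sub>R b) \<bullet> b)))"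
    by (subst lborel_eq, subst integral_distr) auto
  also have "\<dots> = (CLINT x|(\<Pi>\<^sub>M b\<in>(Basis::(real^'d) set). lborel). (\<Prod>b\<in>Basis. ?f b (x b)))"
    by (intro Bochner_Integration.integral_cong refl prod.cong) (simp_all add: inner_sum_left_Basis)
  also have "\<dots> = (\<Prod>b\<in>(Basis::(real^'d) set). LINT x|lborel. ?f b x)"
    by (rule product_integral_prod) (simp, rule int)
  also have "\<dots> = of_real (exp (\<Sum>b\<in>(Basis::(real^'d) set). - ((\<xi> \<bullet> b)\<^sup>2) / 2))"
    by (simp only: val) (simp add: exp_sum)
  also have "(\<Sum>b\<in>(Basis::(real^'d) set). - ((\<xi> \<bullet> b)\<^sup>2) / 2) = - (\<xi> \<bullet> \<xi>) / 2"
    by (subst euclidean_inner[of \<xi> \<xi>])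
      (simp add: sum_divide_distrib[symmetric] sum_negf power2_eq_square)
  finally show ?thesis .
qed

lemma borel_measurable_matrix_vector_mult [measurable]:
  fixes L :: "real^'d^'d"
  shows "(\<lambda>z. L *v z) \<in> borel_measurable borel"
  by (intro borel_measurable_continuous_onI matrix_vector_mult_linear_continuous_on)

lemma
  shows prob_space_mvn: "prob_space (mvn C)"
    and sets_mvn [simp, measurable_cong]: "sets (mvn C) = sets borel"
  unfolding mvn_def
  by (auto intro!: prob_space.prob_space_distr prob_space_std_normal_vec)

text \<open>The selected root \<open>L\<close> enters only through \<open>L ** transpose L\<close>,
  so the law does not depend on which root is chosen.\<close>

lemma char_mvn:
  fixes C :: "real^'d^'d"
  assumes "\<And>i j. C $ i $ j = C $ j $ i" "\<And>v. 0 \<le> v \<bullet> (C *v v)"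
  shows "(CLINT z|mvn C. iexp (\<xi> \<bullet> z)) = of_real (exp (- (\<xi> \<bullet> (C *v \<xi>)) / 2))"
proof -
  define L where "L = (SOME L::real^'d^'d. L ** transpose L = C)"
  have L: "L ** transpose L = C"
    unfolding L_def by (rule someI_ex) (metis psd_matrix_sqrt[OF assms])
  have "(CLINT z|mvn C. iexp (\<xi> \<bullet> z)) = (CLINT z|std_normal_vec. iexp (\<xi> \<bullet> (L *v z)))"
    unfolding mvn_def L_def[symmetric] by (subst integral_distr) auto
  also have "\<dots> = (CLINT z|std_normal_vec. iexp ((transpose L *v \<xi>) \<bullet> z))"
    by (simp add: dot_lmul_matrix[symmetric])
  also have "\<dots> = of_real (exp (- ((transpose L *v \<xi>) \<bullet> (transpose L *v \<xi>)) / 2))"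
    by (rule char_std_normal_vec)
  also have "(transpose L *v \<xi>) \<bullet> (transpose L *v \<xi>) = \<xi> \<bullet> (C *v \<xi>)"
    unfolding L[symmetric] by (simp add: dot_lmul_matrix matrix_vector_mul_assoc[symmetric])
  finally show ?thesis .
qed

section \<open>Trigonometric polynomials as test functions\<close>

inductive trig_poly :: "(real^'d \<Rightarrow> complex) \<Rightarrow> bool" where
  char: "trig_poly (\<lambda>x. c * iexp (\<xi> \<bullet> x))"
| add: "trig_poly f \<Longrightarrow> trig_poly g \<Longrightarrow> trig_poly (\<lambda>x. f x + g x)"

lemma trig_poly_const: "trig_poly (\<lambda>x. c)"
  using trig_poly.char[of c 0] by simp

lemma trig_poly_sum: "(\<And>k. k \<in> S \<Longrightarrow> trig_poly (f k)) \<Longrightarrow> trig_poly (\<lambda>x. \<Sum>k\<in>S. f k x)"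
  by (induction S rule: infinite_finite_induct) (auto intro: trig_poly_const trig_poly.add)

lemma trig_poly_mult:
  assumes "trig_poly f" "trig_poly g" shows "trig_poly (\<lambda>x. f x * g x)"
  using assms(1)
proof induction
  case (char c \<xi>)
  show ?case
    using assms(2)
  proof induction
    case (char d \<zeta>)
    have "(c * iexp (\<xi> \<bullet> x)) * (d * iexp (\<zeta> \<bullet> x)) = (c * d) * iexp ((\<xi> + \<zeta>) \<bullet> x)" for x
      by (simp add: inner_add_left distrib_left exp_add)
    then show ?case using trig_poly.char[of "c * d" "\<xi> + \<zeta>"] by presburger
  next
    case (add f g)
    then show ?case by (simp add: distrib_left trig_poly.add)
  qed
next
  case (add f g)
  then show ?case by (simp add: distrib_right trig_poly.add)
qed

lemma trig_poly_sin: "trig_poly (\<lambda>x :: real^'d. of_real (sin (x $ i / R)))"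
proof -
  have "of_real (sin (x $ i / R)) =
     (- \<i> / 2) * iexp (axis i (1 / R) \<bullet> x) + (\<i> / 2) * iexp (axis i (- 1 / R) \<bullet> x)" for x :: "real^'d"
    by (simp add: inner_axis' complex_eq_iff Re_exp Im_exp)
  then show ?thesis by (simp only:) (intro trig_poly.char trig_poly.add)
qed

text \<open>The sine of a coordinate is a combination of two characters, and characters are closed
  under products. Hence a polynomial in such sines has expectations determined by the characteristic
  function.\<close>

lemma trig_poly_real_polynomial:
  assumes "real_polynomial_function (p :: real^'d \<Rightarrow> real)"
  shows "trig_poly (\<lambda>x. of_real (p (\<chi> i. sin (x $ i / R))))"
  using assms
proof induction
  case (linear f)
  then interpret f: bounded_linear f .
  have fy: "f y = (\<Sum>i\<in>UNIV. y $ i * f (axis i 1))" for y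
  proof -
    have "f y = f (\<Sum>i\<in>UNIV. y $ i *\<^sub>R axis i 1)"
      by (rule arg_cong[where f = f]) (simp only: basis_expansion flip: scalar_mult_eq_scaleR)
    then show ?thesis by (simp add: f.sum f.scaleR)
  qed
  have "of_real (f (\<chi> i. sin (x $ i / R))) = (\<Sum>i\<in>UNIV. complex_of_real (sin (x $ i / R)) * of_real (f (axis i 1)))" for x
    by (subst fy) simp
  then show ?case
    by (simp only:) (intro trig_poly_sum trig_poly_mult trig_poly_sin trig_poly_const)
next
  case (const c)
  show ?case by (rule trig_poly_const)
next
  case (add f g)
  then show ?case using trig_poly.add by fastforce
next
  case (mult f g)
  then show ?case using trig_poly_mult by fastforce
qed

lemma trig_poly_bounded_measurable:
  assumes "trig_poly f"
  shows "f \<in> borel_measurable borel \<and> (\<exists>B. \<forall>x. norm (f x) \<le> B)"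
  using assms
proof induction
  case (char c \<xi>)
  have "norm (c * iexp (\<xi> \<bullet> x)) \<le> norm c" for x
    by (simp add: norm_mult)
  then show ?case by auto
next
  case (add f g)
  then obtain A B where "\<forall>x. norm (f x) \<le> A" "\<forall>x. norm (g x) \<le> B" by blast
  then have "norm (f x + g x) \<le> A + B" for x
    by (intro norm_triangle_le add_mono) auto
  with add show ?case by auto
qed

lemma trig_poly_integrable:
  assumes "trig_poly f" "prob_space M" "X \<in> borel_measurable M"
  shows "integrable M (\<lambda>\<omega>. f (X \<omega>))"
proof -
  interpret prob_space M by fact
  from trig_poly_bounded_measurable[OF assms(1)] obtain B where
    "f \<in> borel_measurable borel" "\<And>x. norm (f x) \<le> B" by blast
  with assms(3) show ?thesis by (intro integrable_const_bound[of _ B]) auto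
qed

lemma trig_poly_integral_tendsto:
  assumes "trig_poly f" "prob_space M" "\<And>n. X n \<in> borel_measurable M"
    and "prob_space N" "sets N = sets borel"
    and char: "\<And>\<xi>. (\<lambda>n. CLINT \<omega>|M. iexp (\<xi> \<bullet> X n \<omega>)) \<longlonglongrightarrow> (CLINT z|N. iexp (\<xi> \<bullet> z))"
  shows "(\<lambda>n. LINT \<omega>|M. f (X n \<omega>)) \<longlonglongrightarrow> (LINT z|N. f z)"
  using assms(1)
proof induction
  case (char c \<xi>)
  then show ?case using tendsto_mult_left[OF assms(6), of c \<xi>] by simp
next
  case (add f g)
  have id: "(\<lambda>z. z) \<in> borel_measurable N" using assms(5) by (simp add: measurable_ident_sets)
  show ?case
    using tendsto_add[OF add.IH] trig_poly_integrable[OF _ assms(2,3)] add.hyps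
      trig_poly_integrable[OF _ assms(4) id]
    by simp
qed

text \<open>Splits the error into a uniform part and one that lives outside a ball; tightness makes
  the latter small.\<close>

lemma integral_close_off_ball:
  fixes g h :: "real^'d \<Rightarrow> real"
  assumes "prob_space M" "X \<in> borel_measurable M"
    and "integrable M (\<lambda>\<omega>. g (X \<omega>))" "integrable M (\<lambda>\<omega>. h (X \<omega>))"
    and le: "\<And>x. \<bar>g x - h x\<bar> \<le> a + b * indicator {x. K < norm x} x"
  shows "\<bar>(LINT \<omega>|M. g (X \<omega>)) - (LINT \<omega>|M. h (X \<omega>))\<bar> \<le> a + b * measure M {\<omega> \<in> space M. K < norm (X \<omega>)}"
proof -
  interpret prob_space M by fact
  note [measurable] = assms(2)
  let ?A = "{\<omega> \<in> space M. K < norm (X \<omega>)}"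
  have A: "?A \<in> sets M" by measurable
  have "\<bar>(LINT \<omega>|M. g (X \<omega>)) - (LINT \<omega>|M. h (X \<omega>))\<bar> = \<bar>LINT \<omega>|M. g (X \<omega>) - h (X \<omega>)\<bar>"
    using assms by simp
  also have "\<dots> \<le> (LINT \<omega>|M. \<bar>g (X \<omega>) - h (X \<omega>)\<bar>)"
    by (rule integral_abs_bound)
  also have "\<dots> \<le> (LINT \<omega>|M. a + b * indicator ?A \<omega>)"
  proof (rule integral_mono)
    show "integrable M (\<lambda>\<omega>. a + b * indicator ?A \<omega>)"
      using A by (intro Bochner_Integration.integrable_add integrable_mult_right) (auto simp: integrable_indicator_iff emeasure_eq_measure)
    fix \<omega> assume "\<omega> \<in> space M"
    then show "\<bar>g (X \<omega>) - h (X \<omega>)\<bar> \<le> a + b * indicator ?A \<omega>"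
      using le[of "X \<omega>"] by (auto simp: indicator_def)
  qed (use assms in auto)
  also have "\<dots> = a + b * measure M ?A"
    using A by (subst Bochner_Integration.integral_add) (auto simp: prob_space emeasure_eq_measure)
  finally show ?thesis .
qed

lemma norm_sin_rescaling_le:
  fixes x :: "real^'d"
  assumes "R > 0"
  shows "norm ((\<chi> i. R * sin (x $ i / R)) - x) \<le> real CARD('d) * (norm x)\<^sup>2 / (2 * R)"
proof -
  have 1: "\<bar>R * sin (u / R) - u\<bar> \<le> u\<^sup>2 / (2 * R)" for u
  proof -
    have "\<bar>sin (u / R) - (\<Sum>m<2. sin_coeff m * (u / R) ^ m)\<bar> \<le> inverse (fact 2) * \<bar>u / R\<bar> ^ 2"
      by (rule Maclaurin_sin_bound)
    then have "\<bar>sin (u / R) - u / R\<bar> \<le> (u / R)\<^sup>2 / 2"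
      by (simp add: numeral_2_eq_2 sin_coeff_def)
    then have "R * \<bar>sin (u / R) - u / R\<bar> \<le> R * ((u / R)\<^sup>2 / 2)"
      using assms by (intro mult_left_mono) auto
    also have "R * \<bar>sin (u / R) - u / R\<bar> = \<bar>R * sin (u / R) - u\<bar>"
      using assms abs_mult[of R "sin (u / R) - u / R"] by (simp add: right_diff_distrib)
    also have "R * ((u / R)\<^sup>2 / 2) = u\<^sup>2 / (2 * R)"
      using assms by (simp add: power2_eq_square)
    finally show ?thesis .
  qed
  have "norm ((\<chi> i. R * sin (x $ i / R)) - x) \<le> (\<Sum>i\<in>UNIV. \<bar>((\<chi> i. R * sin (x $ i / R)) - x) $ i\<bar>)"
    by (rule norm_le_l1_cart)
  also have "\<dots> \<le> (\<Sum>i\<in>(UNIV::'d set). (norm x)\<^sup>2 / (2 * R))"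
  proof (rule sum_mono)
    fix i
    have "(x $ i)\<^sup>2 \<le> (norm x)\<^sup>2"
      using component_le_norm_cart[of x i] by (metis abs_le_square_iff abs_norm_cancel)
    then have "(x $ i)\<^sup>2 / (2 * R) \<le> (norm x)\<^sup>2 / (2 * R)"
      using assms by (intro divide_right_mono) auto
    with 1[of "x $ i"] show "\<bar>((\<chi> i. R * sin (x $ i / R)) - x) $ i\<bar> \<le> (norm x)\<^sup>2 / (2 * R)"
      by simp
  qed
  finally show ?thesis by simp
qed

text \<open>The map \<open>x \<mapsto> R sin (x / R)\<close> is close to the identity on compact sets and has compact range, so that
  a polynomial approximation of the test function on that range is a trigonometric polynomial that is
  uniformly bounded on the whole space.\<close>

lemma conv_in_lawI:
  fixes X :: "nat \<Rightarrow> 'a \<Rightarrow> real^'d"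
  assumes M: "prob_space M" and X [measurable]: "\<And>n. X n \<in> borel_measurable M"
    and N: "prob_space N" and sN [measurable_cong]: "sets N = sets borel"
    and char: "\<And>\<xi>. (\<lambda>n. CLINT \<omega>|M. iexp (\<xi> \<bullet> X n \<omega>)) \<longlonglongrightarrow> (CLINT z|N. iexp (\<xi> \<bullet> z))"
    and tight: "\<And>e. e > 0 \<Longrightarrow> \<exists>K. \<forall>\<^sub>F n in sequentially. measure M {\<omega> \<in> space M. K < norm (X n \<omega>)} \<le> e"
  shows "conv_in_law M X N"
  unfolding conv_in_law_def
proof (intro allI impI)
  fix g :: "real^'d \<Rightarrow> real"
  assume g: "continuous_on UNIV g \<and> bounded (range g)"
  then have [measurable]: "g \<in> borel_measurable borel"
    by (auto intro: borel_measurable_continuous_onI)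
  obtain G where G: "G > 0" "\<And>x. \<bar>g x\<bar> \<le> G"
    using g by (auto simp: bounded_pos)
  interpret M: prob_space M by fact
  interpret N: prob_space N by fact
  have id [measurable]: "(\<lambda>z. z) \<in> borel_measurable N" using sN by (simp add: measurable_ident_sets)
  have intg: "integrable M (\<lambda>\<omega>. g (X n \<omega>))" for n
    by (rule M.integrable_const_bound[of _ G]) (auto simp: G)
  have intgN: "integrable N g"
    by (rule N.integrable_const_bound[of _ G]) (auto simp: G)
  show "(\<lambda>n. LINT \<omega>|M. g (X n \<omega>)) \<longlonglongrightarrow> (LINT z|N. g z)"
  proof (rule LIMSEQ_I)
    fix r :: real assume "r > 0"
    \<comment> \<open>Passing from \<open>g\<close> to \<open>P\<close> costs
      \<open>2 * e + 2 * G * e' = 3 * e\<close> under the law of \<open>X n\<close> and again under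
      \<open>N\<close>; the integrals of \<open>P\<close> differ by less than \<open>e / 2\<close>.
      The total is below \<open>7 * e\<close>.\<close>
    define e where "e = r / 7"
    have e: "e > 0" using \<open>r > 0\<close> by (simp add: e_def)
    define e' where "e' = e / (2 * G)"
    have e': "e' > 0" using e G by (simp add: e'_def)
    obtain K1 where K1: "\<forall>\<^sub>F n in sequentially. measure M {\<omega> \<in> space M. K1 < norm (X n \<omega>)} \<le> e'"
      using tight[OF e'] by blast
    have "(\<lambda>n. measure N {z \<in> space N. real n < norm z}) \<longlonglongrightarrow> measure N (\<Inter>n. {z \<in> space N. real n < norm z})"
      by (intro N.finite_Lim_measure_decseq) (auto simp: decseq_def)
    moreover have "(\<Inter>n. {z \<in> space N. real n < norm z}) = {}"
      by auto (metis less_asym reals_Archimedean2)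
    ultimately have "(\<lambda>n. measure N {z \<in> space N. real n < norm z}) \<longlonglongrightarrow> 0" by simp
    then obtain K2 where K2: "measure N {z \<in> space N. real K2 < norm z} < e'"
      using e' by (metis (no_types, lifting) LIMSEQ_D abs_of_nonneg diff_zero measure_nonneg order_refl real_norm_def)
    define K where "K = max \<bar>K1\<bar> (real K2)"
    have K0: "0 \<le> K" by (simp add: K_def)
    have KN: "measure N {z \<in> space N. K < norm z} \<le> e'"
      by (rule order_trans[OF N.finite_measure_mono less_imp_le[OF K2]]) (auto simp: K_def)
    have KM: "\<forall>\<^sub>F n in sequentially. measure M {\<omega> \<in> space M. K < norm (X n \<omega>)} \<le> e'"
      using K1
    proof eventually_elim
      case (elim n)
      have "measure M {\<omega> \<in> space M. K < norm (X n \<omega>)} \<le> measure M {\<omega> \<in> space M. K1 < norm (X n \<omega>)}"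
        by (rule M.finite_measure_mono) (auto simp: K_def)
      with elim show ?case by simp
    qed
    have "uniformly_continuous_on (cball 0 (K + 1)) g"
      using g by (intro compact_uniformly_continuous) (auto intro: continuous_on_subset)
    then obtain d where d: "d > 0"
      "\<And>x y. x \<in> cball 0 (K + 1) \<Longrightarrow> y \<in> cball 0 (K + 1) \<Longrightarrow> dist y x < d \<Longrightarrow> dist (g y) (g x) < e"
      using e unfolding uniformly_continuous_on_def by metis
    define c where "c = real CARD('d) * K\<^sup>2 / 2"
    have c0: "0 \<le> c" by (simp add: c_def)
    \<comment> \<open>Large enough for the displacement of a point of the ball by the sine map, at
      most \<open>c / R\<close>, to be below \<open>min d 1\<close>. The 1 keeps the image in the
      ball of radius \<open>K + 1\<close>, where the modulus of continuity \<open>d\<close> is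
      valid.\<close>
    define R where "R = (c + 1) / min d 1 + 1"
    have "min d 1 > 0" using d by simp
    then have R0: "R > 0" using c0 by (simp add: R_def add_pos_pos)
    have "c / R < min d 1"
    proof -
      have "c < (c + 1) + min d 1" using \<open>min d 1 > 0\<close> by simp
      also have "\<dots> = min d 1 * R" using \<open>min d 1 > 0\<close> by (simp only: R_def distrib_left[of "min d 1" "_ / _"]) simp
      finally show ?thesis by (simp only: pos_divide_less_eq[OF R0])
    qed
    define s where "s x = (\<chi> i. R * sin (x $ i / R))" for x :: "real^'d"
    have close: "\<bar>g x - g (s x)\<bar> \<le> e" if "norm x \<le> K" for x
    proof -
      have "norm (s x - x) \<le> real CARD('d) * (norm x)\<^sup>2 / (2 * R)"
        unfolding s_def by (rule norm_sin_rescaling_le[OF R0])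
      also have "\<dots> \<le> real CARD('d) * K\<^sup>2 / (2 * R)"
        using that R0 by (intro divide_right_mono mult_left_mono power_mono) auto
      also have "\<dots> = c / R" by (simp add: c_def)
      finally have n: "norm (s x - x) < min d 1" using \<open>c / R < min d 1\<close> by simp
      moreover have "norm (s x) \<le> norm x + norm (s x - x)" by (rule norm_triangle_sub)
      ultimately have "dist (g (s x)) (g x) < e"
        using that by (intro d(2)) (auto simp: dist_norm)
      then show ?thesis by (simp add: dist_real_def)
    qed
    have cp: "compact (cbox (- 1) 1 :: (real^'d) set)" by (rule compact_cbox)
    have ch: "continuous_on (cbox (- 1) 1) (\<lambda>y. g (R *\<^sub>R y))"
      by (rule continuous_on_compose2[of UNIV g _ "\<lambda>y. R *\<^sub>R y"])
        (simp_all add: g continuous_on_scaleR)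
    obtain p where p: "real_polynomial_function p"
      "\<And>y. y \<in> cbox (- 1) 1 \<Longrightarrow> \<bar>g (R *\<^sub>R y) - p y\<bar> < e"
      using Stone_Weierstrass_real_polynomial_function[OF cp ch e] by metis
    define P where "P x = p (\<chi> i. sin (x $ i / R))" for x :: "real^'d"
    have tP: "trig_poly (\<lambda>x. of_real (P x))"
      unfolding P_def by (rule trig_poly_real_polynomial[OF p(1)])
    have sP: "\<bar>g (s x) - P x\<bar> < e" for x
    proof -
      have "s x = R *\<^sub>R (\<chi> i. sin (x $ i / R))" by (simp add: s_def vec_eq_iff)
      moreover have "(\<chi> i. sin (x $ i / R)) \<in> cbox (- 1) 1"
        by (simp add: mem_box_cart)
      ultimately show ?thesis using p(2) by (simp add: P_def)
    qed
    have gP: "\<bar>g x - P x\<bar> \<le> 2 * e + 2 * G * indicator {x. K < norm x} x" for x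
    proof (cases "norm x \<le> K")
      case True
      then show ?thesis using close[OF True] sP[of x] by (auto simp: indicator_def)
    next
      case False
      then show ?thesis using G(2)[of x] G(2)[of "s x"] sP[of x] e by (auto simp: indicator_def)
    qed
    have iP: "integrable M (\<lambda>\<omega>. P (X n \<omega>))" for n
      using trig_poly_integrable[OF tP M X, of n] by (simp only: complex_of_real_integrable_eq)
    have iPN: "integrable N P"
      using trig_poly_integrable[OF tP N id] by (simp only: complex_of_real_integrable_eq)
    have "(\<lambda>n. CLINT \<omega>|M. of_real (P (X n \<omega>))) \<longlonglongrightarrow> (CLINT z|N. of_real (P z))"
      by (rule trig_poly_integral_tendsto[OF tP M X N sN char])
    then have PL: "(\<lambda>n. LINT \<omega>|M. P (X n \<omega>)) \<longlonglongrightarrow> (LINT z|N. P z)"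
      by (simp only: integral_complex_of_real tendsto_of_real_iff)
    then have ev: "\<forall>\<^sub>F n in sequentially. \<bar>(LINT \<omega>|M. P (X n \<omega>)) - (LINT z|N. P z)\<bar> < e / 2"
      using e tendstoD[OF PL, of "e / 2"] by (simp add: dist_real_def)
    have N1: "\<bar>(LINT z|N. g z) - (LINT z|N. P z)\<bar> \<le> 2 * e + 2 * G * e'"
      using integral_close_off_ball[OF N id intgN iPN gP] KN G(1)
      by (smt (verit) mult_left_mono)
    have "\<forall>\<^sub>F n in sequentially. norm ((LINT \<omega>|M. g (X n \<omega>)) - (LINT z|N. g z)) < r"
      using ev KM
    proof eventually_elim
      case (elim n)
      have "\<bar>(LINT \<omega>|M. g (X n \<omega>)) - (LINT \<omega>|M. P (X n \<omega>))\<bar> \<le> 2 * e + 2 * G * e'"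
        using integral_close_off_ball[OF M X intg iP gP, of n] elim(2) G(1)
        by (smt (verit) mult_left_mono)
      moreover have "2 * G * e' = e" using G(1) by (simp add: e'_def)
      moreover have "r = 7 * e" by (simp add: e_def)
      ultimately show ?case unfolding real_norm_def using N1 elim(1) e by linarith
    qed
    then show "\<exists>n0. \<forall>n\<ge>n0. norm ((LINT \<omega>|M. g (X n \<omega>)) - (LINT z|N. g z)) < r"
      by (simp add: eventually_sequentially)
  qed
qed

section \<open>Symbols of Toeplitz matrices\<close>

text \<open>\<open>2 * pi\<close> times the spectral density. Its exponent has the sign opposite to
  that in \<open>ft\<close>; evenness of \<open>c\<close> reconciles the two in
  \<open>ft_trunc_approx\<close>.\<close>

definition symb :: "(int \<Rightarrow> real) \<Rightarrow> real \<Rightarrow> complex" where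
  "symb c w = (\<Sum>\<^sub>\<infinity>i. complex_of_real (c i) * exp (- \<i> * of_int i * of_real w))"

lemma spec_dens_symb: "spec_dens c w = symb c w / (2 * of_real pi)"
  by (simp add: spec_dens_def symb_def)

definition trunc :: "(int \<Rightarrow> real) \<Rightarrow> nat \<Rightarrow> laurent" where
  "trunc c n = restr {- int n..int n} c"

definition l1norm :: "(int \<Rightarrow> real) \<Rightarrow> real" where
  "l1norm c = (\<Sum>\<^sub>\<infinity>i. \<bar>c i\<bar>)"

definition l1tail :: "(int \<Rightarrow> real) \<Rightarrow> nat \<Rightarrow> real" where
  "l1tail c n = (\<Sum>\<^sub>\<infinity>i\<in>- {- int n..int n}. \<bar>c i\<bar>)"

lemma coef_trunc: "coef (trunc c n) k = (if \<bar>k\<bar> \<le> int n then c k else 0)"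
  by (auto simp: trunc_def coef_restr)

locale even_l1 =
  fixes c :: "int \<Rightarrow> real"
  assumes even_c: "\<And>i. c (- i) = c i" and summ: "(\<lambda>i. \<bar>c i\<bar>) summable_on UNIV"
begin

lemma l1norm_nonneg: "0 \<le> l1norm c"
  unfolding l1norm_def by (rule infsum_nonneg) simp

lemma l1tail_nonneg: "0 \<le> l1tail c n"
  unfolding l1tail_def by (rule infsum_nonneg) simp

lemma l1tail_eq: "l1tail c n = l1norm c - (\<Sum>i\<in>{- int n..int n}. \<bar>c i\<bar>)"
  unfolding l1tail_def l1norm_def Compl_eq_Diff_UNIV
  by (subst infsum_Diff[OF summ]) auto

lemma l1tail_tendsto: "l1tail c \<longlonglongrightarrow> 0"
proof -
  have "filterlim (\<lambda>n. {- int n..int n}) (finite_subsets_at_top UNIV) sequentially"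
    unfolding filterlim_finite_subsets_at_top
  proof (intro allI impI)
    fix X :: "int set" assume X: "finite X \<and> X \<subseteq> UNIV"
    have "\<forall>\<^sub>F n in sequentially. \<forall>x\<in>X. \<bar>x\<bar> \<le> int n"
      unfolding eventually_ball_finite_distrib[OF conjunct1[OF X]]
    proof
      fix x
      show "\<forall>\<^sub>F n in sequentially. \<bar>x\<bar> \<le> int n"
        using eventually_ge_at_top[of "nat \<bar>x\<bar>"] by eventually_elim auto
    qed
    then show "\<forall>\<^sub>F n in sequentially. finite {- int n..int n} \<and> X \<subseteq> {- int n..int n} \<and> {- int n..int n} \<subseteq> UNIV"
      by eventually_elim (auto simp: abs_le_iff)
  qed
  moreover have "(sum (\<lambda>i. \<bar>c i\<bar>) \<longlongrightarrow> l1norm c) (finite_subsets_at_top UNIV)"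
    using has_sum_infsum[OF summ] by (simp add: has_sum_def l1norm_def)
  ultimately have "(\<lambda>n. \<Sum>i\<in>{- int n..int n}. \<bar>c i\<bar>) \<longlonglongrightarrow> l1norm c"
    by (rule filterlim_compose[rotated])
  from tendsto_diff[OF tendsto_const[of "l1norm c"] this] show ?thesis
    by (simp add: l1tail_eq[abs_def])
qed

lemma l1tail_antimono: "n \<le> k \<Longrightarrow> l1tail c k \<le> l1tail c n"
  unfolding l1tail_eq by (intro diff_left_mono sum_mono2) auto

lemma adj_trunc: "adj (trunc c n) = trunc c n"
  by (rule poly_mapping_eqI) (simp add: coef_trunc even_c)

lemma supp_trunc: "supp (trunc c n) \<subseteq> {- int n..int n}"
  unfolding trunc_def by (rule supp_restr) simp

lemma cmod_ft_trunc_le: "cmod (ft (trunc c n) w) \<le> l1norm c"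
proof -
  have "cmod (ft (trunc c n) w) \<le> (\<Sum>k\<in>{- int n..int n}. \<bar>coef (trunc c n) k\<bar>)"
    by (rule cmod_ft_le[OF _ supp_trunc]) simp
  also have "\<dots> = (\<Sum>k\<in>{- int n..int n}. \<bar>c k\<bar>)"
    by (intro sum.cong) (auto simp: coef_trunc)
  also have "\<dots> \<le> l1norm c"
    unfolding l1norm_def by (rule finite_sum_le_infsum[OF summ]) auto
  finally show ?thesis .
qed

lemma symb_abs_summable: "(\<lambda>i. norm (complex_of_real (c i) * exp (- \<i> * of_int i * of_real w))) summable_on A"
proof -
  have "norm (complex_of_real (c i) * exp (- \<i> * of_int i * of_real w)) = \<bar>c i\<bar>" for i
    by (simp add: norm_mult norm_exp_eq_Re)
  then show ?thesis using summable_on_subset[OF summ] by simp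
qed

lemma ft_trunc_approx: "cmod (ft (trunc c n) w - symb c w) \<le> l1tail c n"
proof -
  let ?g = "\<lambda>i. complex_of_real (c i) * exp (- \<i> * of_int i * of_real w)"
  have g: "?g summable_on A" for A
    by (rule abs_summable_summable[OF symb_abs_summable])
  have "ft (trunc c n) w = (\<Sum>i\<in>{- int n..int n}. complex_of_real (c i) * cis (of_int i * w))"
    unfolding trunc_def by (rule ft_restr) simp
  also have "\<dots> = (\<Sum>i\<in>{- int n..int n}. complex_of_real (c (- i)) * cis (of_int (- i) * w))"
    by (rule sum.reindex_bij_witness[of _ uminus uminus]) auto
  also have "\<dots> = (\<Sum>i\<in>{- int n..int n}. ?g i)"
    by (simp add: even_c cis_conv_exp mult_ac)
  finally have "symb c w - ft (trunc c n) w = infsum ?g (- {- int n..int n})"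
    unfolding symb_def Compl_eq_Diff_UNIV by (subst infsum_Diff[OF g]) auto
  also have "norm \<dots> \<le> (\<Sum>\<^sub>\<infinity>i\<in>- {- int n..int n}. norm (?g i))"
    by (rule norm_infsum_bound[OF symb_abs_summable])
  also have "\<dots> = l1tail c n"
    unfolding l1tail_def by (simp add: norm_mult norm_exp_eq_Re)
  finally show ?thesis by (simp add: norm_minus_commute)
qed

lemma uniform_limit_trunc: "uniform_limit S (\<lambda>n. ft (trunc c n)) (symb c) sequentially"
proof (rule uniform_limitI)
  fix e :: real assume "e > 0"
  then have "\<forall>\<^sub>F n in sequentially. l1tail c n < e"
    using order_tendstoD(2)[OF l1tail_tendsto] by blast
  then show "\<forall>\<^sub>F n in sequentially. \<forall>w\<in>S. dist (ft (trunc c n) w) (symb c w) < e"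
    by eventually_elim (auto simp: dist_norm intro: le_less_trans[OF ft_trunc_approx])
qed

lemma cmod_symb_le: "cmod (symb c w) \<le> l1norm c"
proof -
  have "cmod (symb c w) \<le> (\<Sum>\<^sub>\<infinity>i. norm (complex_of_real (c i) * exp (- \<i> * of_int i * of_real w)))"
    unfolding symb_def by (rule norm_infsum_bound[OF symb_abs_summable])
  then show ?thesis by (simp add: l1norm_def norm_mult norm_exp_eq_Re)
qed

lemma nrm_trunc_mult_le: "nrm (trunc c n * a) \<le> l1norm c * nrm a"
  by (rule nrm_mult_le) (rule cmod_ft_trunc_le)

text \<open>Both truncations are compared with the full symbol, which accounts for the factor
  2.\<close>

lemma nrm_trunc_diff_mult_le: "n \<le> k \<Longrightarrow> nrm ((trunc c k - trunc c n) * a) \<le> 2 * l1tail c n * nrm a"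
proof (rule nrm_mult_le)
  fix w assume "n \<le> k"
  have "cmod (ft (trunc c k - trunc c n) w) \<le> cmod (ft (trunc c k) w - symb c w) + cmod (ft (trunc c n) w - symb c w)"
    unfolding ft_diff by (metis dist_norm dist_triangle2)
  then show "cmod (ft (trunc c k - trunc c n) w) \<le> 2 * l1tail c n"
    using ft_trunc_approx[of k w] ft_trunc_approx[of n w] l1tail_antimono[OF \<open>n \<le> k\<close>] by linarith
qed

text \<open>Positions in \<open>{1..int T}\<close> differ by less than \<open>T\<close>, so
  truncation at lag \<open>T\<close> removes no entry of the Toeplitz matrix. This is the passage
  between matrices and the ring.\<close>

lemma coef_trunc_mult:
  assumes "supp b \<subseteq> {1..int T}" "t \<in> {1..int T}"
  shows "coef (trunc c T * b) t = (\<Sum>q\<in>{1..int T}. c (t - q) * coef b q)"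
proof -
  have "coef (trunc c T * b) t = (\<Sum>q\<in>{1..int T}. coef b q * coef (trunc c T) (t - q))"
    by (subst mult.commute, rule coef_mult[OF _ assms(1)]) simp
  also have "\<dots> = (\<Sum>q\<in>{1..int T}. c (t - q) * coef b q)"
    using assms(2) by (intro sum.cong) (auto simp: coef_trunc)
  finally show ?thesis .
qed

lemma ip_trunc_mult:
  assumes "supp a \<subseteq> {1..int T}" "supp b \<subseteq> {1..int T}"
  shows "ip a (trunc c T * b) = (\<Sum>p\<in>{1..int T}. \<Sum>q\<in>{1..int T}. coef a p * c (p - q) * coef b q)"
proof -
  have "ip a (trunc c T * b) = (\<Sum>p\<in>{1..int T}. coef a p * coef (trunc c T * b) p)"
    using assms(1) by (intro ip_eq_sum) auto
  also have "\<dots> = (\<Sum>p\<in>{1..int T}. coef a p * (\<Sum>q\<in>{1..int T}. c (p - q) * coef b q))"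
    by (intro sum.cong refl) (simp only: coef_trunc_mult[OF assms(2)])
  finally show ?thesis by (simp add: sum_distrib_left mult.assoc)
qed

end

lemma adj_one [simp]: "adj 1 = 1"
  using adj_mono1[of 0 1] by simp

lemma adj_diff: "adj (a - b) = adj a - adj b"
  by (rule poly_mapping_eqI) (simp add: lookup_minus)

lemma adj_power: "adj (a ^ n) = adj a ^ n"
  by (induction n) (auto simp: adj_mult)

lemma adj_sum: "adj (\<Sum>x\<in>A. f x) = (\<Sum>x\<in>A. adj (f x))"
  by (rule poly_mapping_eqI) (simp add: lookup_sum)

lemma ft_self_adj: "adj a = a \<Longrightarrow> ft a w = of_real (Re (ft a w))"
  using ft_adj[of a w] by (simp add: complex_eq_iff)

text \<open>The factor \<open>2\<close> leaves room for replacing the symbol by that of a truncation.\<close>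

locale pos_symbol = even_l1 \<eta> for \<eta> +
  fixes m :: real
  assumes m_pos: "m > 0" and symb_ge: "\<And>w. w \<in> {-pi..pi} \<Longrightarrow> 2 * m \<le> Re (symb \<eta> w)"
begin

lemma m_le_l1norm: "2 * m \<le> l1norm \<eta>"
  using symb_ge[of 0] cmod_symb_le[of 0] complex_Re_le_cmod[of "symb \<eta> 0"] by simp

lemma l1norm_pos: "l1norm \<eta> > 0"
  using m_le_l1norm m_pos by linarith

lemma cmod_symb_ge: "w \<in> {-pi..pi} \<Longrightarrow> 2 * m \<le> cmod (symb \<eta> w)"
  by (rule order_trans[OF symb_ge complex_Re_le_cmod])

lemma Re_ft_trunc_ge:
  assumes "l1tail \<eta> n \<le> m" "w \<in> {-pi..pi}"
  shows "m \<le> Re (ft (trunc \<eta> n) w)"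
proof -
  have "\<bar>Re (ft (trunc \<eta> n) w - symb \<eta> w)\<bar> \<le> m"
    using ft_trunc_approx[of n w] assms(1) abs_Re_le_cmod[of "ft (trunc \<eta> n) w - symb \<eta> w"] by linarith
  then show ?thesis using symb_ge[OF assms(2)] by simp
qed

text \<open>The inverse symbol is approximated by the Neumann series of a truncation.\<close>

lemma approx_inverse_exists:
  assumes "e > 0"
  shows "\<exists>p. adj p = p \<and> (\<forall>w\<in>{-pi..pi}. cmod (1 - symb \<eta> w * ft p w) \<le> e)"
proof -
  define L where "L = l1norm \<eta>"
  have L: "L > 0" "2 * m \<le> L" using l1norm_pos m_le_l1norm by (auto simp: L_def)
  \<comment> \<open>The truncated symbol is real with values in \<open>[m, L]\<close>; scaled by
    \<open>1 / L\<close>, its distance from 1 is at most \<open>r < 1\<close>.\<close>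
  define r where "r = 1 - m / L"
  have r: "0 \<le> r" "r < 1" using L m_pos by (auto simp: r_def field_simps)
  have "(\<lambda>N. r ^ N) \<longlonglongrightarrow> 0" using r by (intro LIMSEQ_realpow_zero) auto
  then have "\<forall>\<^sub>F N in sequentially. r ^ N < e / 2"
    using assms by (intro order_tendstoD(2)) auto
  then obtain N where N: "r ^ N < e / 2" by (auto simp: eventually_sequentially)
  \<comment> \<open>The Neumann sum with \<open>N\<close> terms has modulus at most
    \<open>N / L\<close>, so this accuracy makes the cost of truncating the symbol at most
    \<open>e / 2\<close>. The bound by \<open>m\<close> keeps the truncated symbol above
    \<open>m\<close>.\<close>
  define b where "b = min m (e / (2 * (real N / L + 1)))"
  have bpos: "b > 0" using m_pos assms L by (auto simp: b_def intro!: divide_pos_pos add_nonneg_pos)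
  have "\<forall>\<^sub>F n in sequentially. l1tail \<eta> n < b"
    using order_tendstoD(2)[OF l1tail_tendsto bpos] .
  then obtain n where n: "l1tail \<eta> n < b" by (auto simp: eventually_sequentially)
  define c where "c = trunc \<eta> n"
  define \<tau> where "\<tau> = mono1 0 (1 / L)"
  define p where "p = \<tau> * (\<Sum>k<N. (1 - \<tau> * c) ^ k)"
  have ft\<tau>: "ft \<tau> w = of_real (1 / L)" for w by (simp add: \<tau>_def ft_mono1)
  have "adj p = p"
    by (simp add: p_def adj_mult adj_sum adj_power adj_diff c_def adj_trunc \<tau>_def adj_mono1)
  moreover have "cmod (1 - symb \<eta> w * ft p w) \<le> e" if w: "w \<in> {-pi..pi}" for w
  proof -
    \<comment> \<open>The geometric sum: the defect of the approximate inverse is a pure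
      power.\<close>
    have cp: "1 - c * p = (1 - \<tau> * c) ^ N"
      using one_diff_power_eq[of "1 - \<tau> * c" N] by (simp add: p_def algebra_simps)
    define y where "y = Re (ft c w)"
    have y: "ft c w = of_real y" unfolding y_def by (rule ft_self_adj) (simp add: c_def adj_trunc)
    have y1: "m \<le> y" using Re_ft_trunc_ge[OF _ w, of n] n by (simp add: b_def y_def c_def)
    have y2: "y \<le> L" using cmod_ft_trunc_le[of n w] complex_Re_le_cmod[of "ft c w"] by (simp add: c_def y_def L_def)
    have z: "ft (1 - \<tau> * c) w = of_real (1 - y / L)"
      by (simp add: ft_diff ft_mult ft\<tau> y)
    have zr: "cmod (ft (1 - \<tau> * c) w) \<le> r"
      unfolding z norm_of_real using y1 y2 L by (simp add: r_def divide_right_mono)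
    have 1: "cmod (1 - ft c w * ft p w) \<le> e / 2"
    proof -
      have "1 - ft c w * ft p w = ft (1 - c * p) w" by (simp add: ft_diff ft_mult)
      then have "cmod (1 - ft c w * ft p w) = cmod (ft (1 - \<tau> * c) w) ^ N"
        unfolding cp by (simp add: ft_power norm_power)
      also have "\<dots> \<le> r ^ N" using zr by (intro power_mono) auto
      finally show ?thesis using N by linarith
    qed
    have "cmod (ft p w) \<le> (1 / L) * (\<Sum>k<N. 1)"
    proof -
      have "cmod (\<Sum>k<N. ft (1 - \<tau> * c) w ^ k) \<le> (\<Sum>k<N. 1)"
        using zr r by (intro sum_norm_le) (auto simp: norm_power intro!: power_le_one)
      then show ?thesis
        using L by (simp add: p_def ft_mult ft_sum ft_power ft\<tau> norm_mult norm_divide divide_right_mono)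
    qed
    then have p2: "cmod (ft p w) \<le> real N / L" by simp
    have "cmod ((ft c w - symb \<eta> w) * ft p w) \<le> b * (real N / L)"
      unfolding norm_mult c_def using n p2 ft_trunc_approx[of n w] bpos by (intro mult_mono) auto
    also have "\<dots> \<le> e / 2"
    proof -
      have "b * (real N / L) \<le> b * (real N / L + 1)" using bpos by (intro mult_left_mono) auto
      also have "\<dots> \<le> (e / (2 * (real N / L + 1))) * (real N / L + 1)"
        using L by (intro mult_right_mono) (auto simp: b_def)
      also have "\<dots> = e / 2" 
      proof -
        have "(e / (2 * D)) * D = e / 2" if "D > 0" for D
          using that by simp
        moreover have "real N / L + 1 > 0" using L by (intro add_nonneg_pos) auto
        ultimately show ?thesis by blast
      qed
      finally show ?thesis .
    qed
    finally have 2: "cmod ((ft c w - symb \<eta> w) * ft p w) \<le> e / 2" .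
    have "1 - symb \<eta> w * ft p w = (1 - ft c w * ft p w) + (ft c w - symb \<eta> w) * ft p w"
      by (simp add: algebra_simps)
    also have "cmod \<dots> \<le> e / 2 + e / 2"
      by (rule order_trans[OF norm_triangle_ineq add_mono[OF 1 2]])
    finally show ?thesis by simp
  qed
  ultimately show ?thesis by blast
qed

definition ainv :: "nat \<Rightarrow> laurent" where
  "ainv n = (SOME p. adj p = p \<and> (\<forall>w\<in>{-pi..pi}. cmod (1 - symb \<eta> w * ft p w) \<le> 1 / (real n + 1)))"

lemma adj_ainv: "adj (ainv n) = ainv n"
  and ainv_approx: "w \<in> {-pi..pi} \<Longrightarrow> cmod (1 - symb \<eta> w * ft (ainv n) w) \<le> 1 / (real n + 1)"
proof -
  have "adj (ainv n) = ainv n \<and> (\<forall>w\<in>{-pi..pi}. cmod (1 - symb \<eta> w * ft (ainv n) w) \<le> 1 / (real n + 1))"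
    unfolding ainv_def by (rule someI_ex, rule approx_inverse_exists) simp
  then show "adj (ainv n) = ainv n" "w \<in> {-pi..pi} \<Longrightarrow> cmod (1 - symb \<eta> w * ft (ainv n) w) \<le> 1 / (real n + 1)"
    by auto
qed

lemma ft_ainv_approx:
  assumes "w \<in> {-pi..pi}"
  shows "cmod (ft (ainv n) w - 1 / symb \<eta> w) \<le> 1 / (real n + 1) / (2 * m)"
proof -
  have nz: "symb \<eta> w \<noteq> 0" using cmod_symb_ge[OF assms] m_pos by auto
  have "ft (ainv n) w - 1 / symb \<eta> w = - (1 - symb \<eta> w * ft (ainv n) w) / symb \<eta> w"
    using nz by (simp add: field_simps)
  then have "cmod (ft (ainv n) w - 1 / symb \<eta> w) = cmod (1 - symb \<eta> w * ft (ainv n) w) / cmod (symb \<eta> w)"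
    by (simp only: norm_divide norm_minus_cancel)
  also have "\<dots> \<le> 1 / (real n + 1) / (2 * m)"
    using ainv_approx[OF assms, of n] cmod_symb_ge[OF assms] m_pos by (intro frac_le) auto
  finally show ?thesis .
qed

lemma cmod_ft_ainv_le:
  assumes "w \<in> {-pi..pi}" shows "cmod (ft (ainv n) w) \<le> 1 / m"
proof -
  have "cmod (ft (ainv n) w) \<le> cmod (1 / symb \<eta> w) + cmod (ft (ainv n) w - 1 / symb \<eta> w)"
    by (rule norm_triangle_sub)
  also have "\<dots> \<le> 1 / (2 * m) + 1 / (real n + 1) / (2 * m)"
    using cmod_symb_ge[OF assms] m_pos
    by (intro add_mono ft_ainv_approx assms) (auto simp: norm_divide intro!: divide_left_mono mult_pos_pos)
  also have "1 / (real n + 1) / (2 * m) \<le> 1 / (2 * m)"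
    using m_pos by (intro divide_right_mono) auto
  finally show ?thesis using m_pos by (simp add: field_simps)
qed

lemma uniform_limit_ainv: "uniform_limit {-pi..pi} (\<lambda>n. ft (ainv n)) (\<lambda>w. 1 / symb \<eta> w) sequentially"
proof (rule uniform_limitI)
  fix e :: real assume "e > 0"
  have "(\<lambda>n. 1 / (real n + 1) / (2 * m)) \<longlonglongrightarrow> 0"
    using tendsto_divide[OF LIMSEQ_inverse_real_of_nat tendsto_const[of "2 * m"]] m_pos
    by (simp add: inverse_eq_divide add.commute)
  then have "\<forall>\<^sub>F n in sequentially. 1 / (real n + 1) / (2 * m) < e"
    using \<open>e > 0\<close> by (rule order_tendstoD(2))
  then show "\<forall>\<^sub>F n in sequentially. \<forall>w\<in>{-pi..pi}. dist (ft (ainv n) w) (1 / symb \<eta> w) < e"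
    by eventually_elim (auto simp: dist_norm intro: le_less_trans[OF ft_ainv_approx])
qed

text \<open>Stability of the truncated equation: \<open>p z\<close> almost solves it, up to an edge effect, and the Toeplitz
  matrix is bounded below by \<open>m\<close>.\<close>

lemma toeplitz_solution_approx:
  assumes T: "l1tail \<eta> T \<le> m" and w: "supp w \<subseteq> {1..int T}" and z: "supp z \<subseteq> {1..int T}"
    and eq: "\<And>t. t \<in> {1..int T} \<Longrightarrow> coef (trunc \<eta> T * w) t = coef z t"
    and B: "\<And>w. w \<in> {-pi..pi} \<Longrightarrow> cmod (1 - ft (trunc \<eta> T) w * ft p w) \<le> B"
    and d: "d = nrm (p * z - restr {1..int T} (coef (p * z)))"
  shows "nrm (w - p * z) \<le> (B * nrm z + l1norm \<eta> * d) / m + d"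
proof -
  define P where "P = restr {1..int T} (coef (p * z))"
  define e where "e = w - P"
  let ?c = "trunc \<eta> T"
  have supp_e: "supp e \<subseteq> {1..int T}"
    using w supp_restr[of "{1..int T}"] keys_diff[of w P] by (force simp: e_def P_def)
  have B0: "0 \<le> B" using order_trans[OF norm_ge_zero B[of 0]] by simp
  have dP: "d = nrm (p * z - P)" by (simp add: d P_def)
  have d0: "0 \<le> d" by (simp add: d)
  \<comment> \<open>The error \<open>e\<close> lives on \<open>{1..int T}\<close>, so only the
    positions at which the equation is assumed enter.\<close>
  have ipz: "ip e (?c * w) = ip e z"
    unfolding ip_eq_sum[OF finite_atLeastAtMost_int disjI1[OF supp_e]]
    using eq by (intro sum.cong) auto
  have "m * (nrm e)\<^sup>2 \<le> ip e (?c * e)"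
    using T by (intro ip_mult_self_ge Re_ft_trunc_ge)
  also have "ip e (?c * e) = ip e ((1 - ?c * p) * z) + ip e (?c * (p * z - P))"
  proof -
    have "ip e (?c * e) = ip e (?c * w) - ip e (?c * P)"
      unfolding e_def right_diff_distrib ip_diff_right ..
    also have "\<dots> = ip e (z - ?c * P)" by (simp add: ipz ip_diff_right)
    \<comment> \<open>The residual splits into the defect of \<open>p\<close> as an inverse of the
      symbol and the part of \<open>p * z\<close> cut off at the ends.\<close>
    also have "z - ?c * P = (1 - ?c * p) * z + ?c * (p * z - P)"
      by (simp add: algebra_simps)
    finally show ?thesis by (simp only: ip_add_right)
  qed
  also have "\<dots> \<le> nrm e * nrm ((1 - ?c * p) * z) + nrm e * nrm (?c * (p * z - P))"
    using ip_le[of e "(1 - ?c * p) * z"] ip_le[of e "?c * (p * z - P)"] by linarith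
  also have "\<dots> \<le> nrm e * (B * nrm z) + nrm e * (l1norm \<eta> * d)"
    unfolding dP using B
    by (intro add_mono mult_left_mono nrm_trunc_mult_le nrm_mult_le) (auto simp: ft_diff ft_mult)
  finally have "nrm e * (m * nrm e) \<le> nrm e * (B * nrm z + l1norm \<eta> * d)"
    by (simp add: power2_eq_square algebra_simps)
  then have "m * nrm e \<le> B * nrm z + l1norm \<eta> * d"
  proof (cases "nrm e = 0")
    case True
    then show ?thesis using B0 d0 l1norm_nonneg by simp
  next
    case False
    then have "nrm e > 0" using nrm_nonneg[of e] by linarith
    with \<open>nrm e * (m * nrm e) \<le> _\<close> show ?thesis by (simp only: mult_le_cancel_left_pos)
  qed
  then have 1: "nrm e \<le> (B * nrm z + l1norm \<eta> * d) / m"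
    using m_pos by (simp add: pos_le_divide_eq mult.commute)
  have "w - p * z = e + (P - p * z)" by (simp add: e_def)
  then have "nrm (w - p * z) \<le> nrm e + nrm (P - p * z)" using nrm_triangle by metis
  also have "nrm (P - p * z) = d" unfolding dP by (rule nrm_minus_commute)
  finally show ?thesis using 1 by linarith
qed

end

text \<open>Convolution with \<open>p\<close> spills over by at most \<open>K\<close> positions on
  either side, and every entry there is at most the l1 norm of \<open>p\<close> times the largest
  entry of \<open>z\<close>.\<close>

lemma edge_effect_le:
  assumes z: "supp z \<subseteq> {1..int T}" and \<mu>: "\<And>t. \<bar>coef z t\<bar> \<le> \<mu>" and p: "supp p \<subseteq> {- int K..int K}"
  shows "nrm (p * z - restr {1..int T} (coef (p * z))) \<le> 2 * real K * ((\<Sum>k\<in>supp p. \<bar>coef p k\<bar>) * \<mu>)"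
proof -
  define a where "a = p * z - restr {1..int T} (coef (p * z))"
  let ?S = "{1 - int K..0} \<union> {int T + 1..int T + int K}"
  let ?C = "(\<Sum>k\<in>supp p. \<bar>coef p k\<bar>) * \<mu>"
  have \<mu>0: "0 \<le> \<mu>" using order_trans[OF abs_ge_zero \<mu>] .
  have C0: "0 \<le> ?C" using \<mu>0 by (intro mult_nonneg_nonneg sum_nonneg) auto
  have coef: "\<bar>coef (p * z) t\<bar> \<le> ?C" for t
  proof -
    have "\<bar>coef (p * z) t\<bar> \<le> (\<Sum>k\<in>supp p. \<bar>coef p k\<bar> * \<bar>coef z (t - k)\<bar>)"
      unfolding coef_mult[OF finite_keys subset_refl] by (rule order_trans[OF sum_abs]) (simp add: abs_mult)
    also have "\<dots> \<le> (\<Sum>k\<in>supp p. \<bar>coef p k\<bar> * \<mu>)"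
      by (intro sum_mono mult_left_mono \<mu>) auto
    finally show ?thesis by (simp add: sum_distrib_right)
  qed
  have supp_a: "supp a \<subseteq> ?S"
  proof
    fix t assume "t \<in> supp a"
    then have "coef a t \<noteq> 0" by (simp add: in_keys_iff)
    then have t: "t \<notin> {1..int T}" "coef (p * z) t \<noteq> 0"
      by (auto simp: a_def lookup_minus coef_restr split: if_splits)
    then have "t \<in> supp (p * z)" by (simp add: in_keys_iff)
    then obtain k l where "k \<in> supp p" "l \<in> supp z" "t = k + l"
      using keys_mult[of p z] by blast
    with t(1) z p show "t \<in> ?S" by fastforce
  qed
  have "nrm a = L2_set (coef a) ?S" using supp_a by (intro nrm_eq_L2) auto
  also have "\<dots> \<le> (\<Sum>t\<in>?S. \<bar>coef a t\<bar>)" by (rule L2_set_le_sum_abs)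
  also have "\<dots> \<le> (\<Sum>t\<in>?S. ?C)"
    using coef C0 by (intro sum_mono) (auto simp: a_def lookup_minus coef_restr)
  also have "\<dots> = real (card ?S) * ?C" by simp
  also have "\<dots> \<le> 2 * real K * ?C"
  proof (rule mult_right_mono[OF _ C0])
    have "card ?S \<le> card {1 - int K..0} + card {int T + 1..int T + int K}" by (rule card_Un_le)
    then show "real (card ?S) \<le> 2 * real K" by simp
  qed
  finally show ?thesis by (simp add: a_def)
qed

lemma supp_bounded: "\<exists>K::nat. supp p \<subseteq> {- int K..int K}"
proof -
  obtain B :: int where B: "\<And>k. k \<in> supp p \<Longrightarrow> \<bar>k\<bar> \<le> B"
    using bdd_above_finite[of "abs ` supp p"] by (auto simp: bdd_above_def)
  have "supp p \<subseteq> {- int (nat B)..int (nat B)}"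
    using B by (force simp: abs_le_iff)
  then show ?thesis by blast
qed

text \<open>The exchange of limits behind all approximations by \<open>ainv N\<close>: the error
  \<open>e N\<close> is attained for all large \<open>T\<close>, where the threshold for
  \<open>T\<close> may depend on \<open>N\<close>.\<close>

lemma tendsto_double_limit:
  fixes a :: "nat \<Rightarrow> real"
  assumes close: "\<And>N. \<forall>\<^sub>F T in sequentially. \<bar>a T - b N T\<bar> \<le> e N" and e: "e \<longlonglongrightarrow> 0"
    and b: "\<And>N. b N \<longlonglongrightarrow> S N" and S: "S \<longlonglongrightarrow> L"
  shows "a \<longlonglongrightarrow> L"
proof (rule tendstoI)
  fix r :: real assume r: "r > 0"
  have "\<forall>\<^sub>F N in sequentially. e N < r / 3 \<and> dist (S N) L < r / 3"
    using r by (intro eventually_conj order_tendstoD(2)[OF e] tendstoD[OF S]) auto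
  then obtain N where N: "e N < r / 3" "dist (S N) L < r / 3" by (auto simp: eventually_sequentially)
  have "\<forall>\<^sub>F T in sequentially. dist (b N T) (S N) < r / 3"
    using r by (intro tendstoD[OF b]) auto
  with close[of N] show "\<forall>\<^sub>F T in sequentially. dist (a T) L < r"
  proof eventually_elim
    case (elim T)
    have "dist (a T) L \<le> \<bar>a T - b N T\<bar> + dist (b N T) (S N) + dist (S N) L"
      by (simp add: dist_real_def)
    with elim N show ?case by linarith
  qed
qed

section \<open>Quadratic forms in the generalised least squares weights\<close>

abbreviation scal :: "real \<Rightarrow> laurent \<Rightarrow> laurent" where "scal c a \<equiv> mono1 0 c * a"

lemma coef_scal: "coef (scal c a) t = c * coef a t"
  by (simp add: coef_mono1_mult)

lemma ip_scal_left: "ip (scal c a) b = c * ip a b"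
proof -
  have "ip (scal c a) b = ip a (scal c b)" by (simp add: ip_mult_left adj_mono1)
  also have "\<dots> = (\<Sum>k\<in>supp a. coef a k * (c * coef b k))"
    by (simp only: ip_eq_sum[OF finite_keys disjI1[OF subset_refl], of a] coef_scal)
  finally show ?thesis by (simp add: ip_eq_sum[of "supp a"] sum_distrib_left mult_ac)
qed

lemma ip_scal_right: "ip a (scal c b) = c * ip a b"
  using ip_scal_left[of c b a] by (simp add: ip_commute)

lemma ip_sum_left: "ip (\<Sum>x\<in>A. f x) b = (\<Sum>x\<in>A. ip (f x) b)"
  by (induction A rule: infinite_finite_induct) (auto simp: ip_add_left ip_eq_sum[of "{}"])

lemma ip_sum_right: "ip b (\<Sum>x\<in>A. f x) = (\<Sum>x\<in>A. ip b (f x))"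
  using ip_sum_left[of f A b] by (simp add: ip_commute[of b])

lemma ip_lin_comb:
  fixes v :: "'d::finite \<Rightarrow> real"
  shows "ip (\<Sum>i\<in>UNIV. scal (v i) (a i)) (\<Sum>j\<in>UNIV. scal (u j) (b j)) = (\<Sum>i\<in>UNIV. \<Sum>j\<in>UNIV. v i * ip (a i) (b j) * u j)"
  unfolding ip_sum_left ip_scal_left by (simp only: ip_sum_right ip_scal_right sum_distrib_left) (simp add: mult_ac)

text \<open>The supremum norm; the inserted 0 covers the zero polynomial.\<close>

definition mxc :: "laurent \<Rightarrow> real" where
  "mxc a = Max (insert 0 ((\<lambda>t. \<bar>coef a t\<bar>) ` supp a))"

lemma mxc_ge: "\<bar>coef a t\<bar> \<le> mxc a"
  by (cases "t \<in> supp a") (auto simp: mxc_def in_keys_iff)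

lemma mxc_le: "(\<And>t. \<bar>coef a t\<bar> \<le> b) \<Longrightarrow> mxc a \<le> b"
  unfolding mxc_def using order_trans[OF abs_ge_zero] by (subst Max_le_iff) auto

lemma mxc_nonneg: "0 \<le> mxc a"
  unfolding mxc_def by (rule Max_ge) auto

text \<open>\<open>Z\<close> holds the normalised regressors and \<open>w\<close> the corresponding
  solutions of the Toeplitz equations, required only for large \<open>T\<close>. \<open>F\<close>
  stands for the entries of \<open>H\<close> with variation bounds \<open>K\<close>, and
  \<open>\<mu>\<close> bounds the largest regressor entry. The shift by \<open>- k\<close> pairs
  time \<open>t\<close> with time \<open>t + k\<close>.\<close>

locale grenander = pos_symbol \<eta> m for \<eta> m +
  fixes Z w :: "'d::finite \<Rightarrow> nat \<Rightarrow> laurent" and R :: "int \<Rightarrow> 'd \<Rightarrow> 'd \<Rightarrow> real"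
    and F :: "'d \<Rightarrow> 'd \<Rightarrow> real \<Rightarrow> complex" and K :: "'d \<Rightarrow> 'd \<Rightarrow> real" and \<mu> :: "'d \<Rightarrow> nat \<Rightarrow> real"
  assumes Z_supp: "\<And>i T. supp (Z i T) \<subseteq> {1..int T}"
    and Z_nrm: "\<And>i T. nrm (Z i T) \<le> 1"
    and Z_max: "\<And>i T t. \<bar>coef (Z i T) t\<bar> \<le> \<mu> i T" and \<mu>_lim: "\<And>i. \<mu> i \<longlonglongrightarrow> 0"
    and Z_lim: "\<And>i j k. (\<lambda>T. ip (Z i T) (mono1 (- k) 1 * Z j T)) \<longlonglongrightarrow> R k i j"
    and F_rep: "\<And>i j k. has_RS_integral (\<lambda>w. exp (\<i> * of_int k * of_real w)) (F i j) (- pi) pi (of_real (R k i j))"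
    and F_var: "\<And>i j. RS_var_le (F i j) (- pi) pi (K i j)"
    and w_supp: "\<And>i T. supp (w i T) \<subseteq> {1..int T}"
    and w_eq: "\<And>i. \<forall>\<^sub>F T in sequentially. \<forall>t\<in>{1..int T}. coef (trunc \<eta> T * w i T) t = coef (Z i T) t"
begin

text \<open>Multiplication by the monomial of degree \<open>k\<close> produces lag
  \<open>- k\<close> in the inner product, whereas the integral of \<open>ft q\<close> produces lag
  \<open>k\<close>; the symmetry of \<open>q\<close> makes the two sums equal.\<close>

lemma quadratic_form_limit:
  assumes "adj q = q"
  obtains S where "(\<lambda>T. ip (Z i T) (q * Z j T)) \<longlonglongrightarrow> S" "has_RS_integral (ft q) (F i j) (- pi) pi (of_real S)"
proof -
  have ev: "coef q (- k) = coef q k" for k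
    using coef_adj[of q k] assms by simp
  define S where "S = (\<Sum>k\<in>supp q. coef q k * R (- k) i j)"
  have q: "q = (\<Sum>k\<in>supp q. mono1 k (coef q k))"
    using restr_coef[of "supp q" q] by (simp add: restr_def)
  have "ip (Z i T) (q * Z j T) = (\<Sum>k\<in>supp q. coef q k * ip (Z i T) (mono1 (- (- k)) 1 * Z j T))" for T
  proof -
    have "mono1 k (coef q k) = scal (coef q k) (mono1 k 1)" for k
      by (simp add: mult_single)
    then have "q * Z j T = (\<Sum>k\<in>supp q. scal (coef q k) (mono1 k 1 * Z j T))"
      by (subst q) (simp only: sum_distrib_right mult.assoc)
    then show ?thesis by (simp add: ip_sum_right ip_scal_right)
  qed
  then have "(\<lambda>T. ip (Z i T) (q * Z j T)) \<longlonglongrightarrow> S"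
    unfolding S_def by (simp only:) (intro tendsto_intros Z_lim)
  moreover have "has_RS_integral (ft q) (F i j) (- pi) pi (\<Sum>k\<in>supp q. of_real (coef q k) * of_real (R k i j))"
    by (rule has_RS_integral_ft[OF F_rep]) auto
  moreover have "(\<Sum>k\<in>supp q. of_real (coef q k) * of_real (R k i j)) = complex_of_real S"
  proof -
    have neg: "- k \<in> supp q" if "k \<in> supp q" for k using that ev by (simp add: in_keys_iff)
    have "(\<Sum>k\<in>supp q. coef q k * R k i j) = S"
      unfolding S_def by (rule sum.reindex_bij_witness[of _ uminus uminus]) (auto simp: ev neg)
    then show ?thesis by (simp flip: of_real_mult of_real_sum)
  qed
  ultimately show thesis using that by metis
qed

text \<open>Twice the limit, as \<open>T\<close> grows, of the bound in
  \<open>toeplitz_solution_approx\<close> for \<open>ainv N\<close>; the factor 2 gives the strict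
  gap needed for an eventual inequality.\<close>

definition dl :: "nat \<Rightarrow> real" where "dl N = 2 / ((real N + 1) * m)"

lemma dl_pos: "dl N > 0"
  using m_pos by (auto simp: dl_def intro!: divide_pos_pos mult_pos_pos)

lemma dl_tendsto: "dl \<longlonglongrightarrow> 0"
proof -
  have "(\<lambda>N. 2 / m * inverse (real (Suc N))) \<longlonglongrightarrow> 2 / m * 0"
    by (intro tendsto_mult tendsto_const LIMSEQ_inverse_real_of_nat)
  moreover have "dl = (\<lambda>N. 2 / m * inverse (real (Suc N)))"
    by (simp add: dl_def fun_eq_iff field_simps)
  ultimately show ?thesis by simp
qed

lemma edge_tendsto:
  obtains d where "d \<longlonglongrightarrow> 0" "\<And>T. nrm (p * Z i T - restr {1..int T} (coef (p * Z i T))) \<le> d T"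
proof -
  obtain k :: nat where k: "supp p \<subseteq> {- int k..int k}" using supp_bounded by blast
  define d where "d T = 2 * real k * ((\<Sum>k\<in>supp p. \<bar>coef p k\<bar>) * \<mu> i T)" for T
  have "d \<longlonglongrightarrow> 2 * real k * ((\<Sum>k\<in>supp p. \<bar>coef p k\<bar>) * 0)"
    unfolding d_def by (intro tendsto_mult tendsto_const \<mu>_lim)
  then show thesis
    using edge_effect_le[OF Z_supp Z_max k] by (intro that[of d]) (auto simp: d_def)
qed

text \<open>For fixed \<open>N\<close> the edge effect and the tail of the symbol vanish as
  \<open>T\<close> grows, so only the defect \<open>1 / (N + 1)\<close> of the approximate inverse,
  divided by the coercivity constant, remains.\<close>

lemma w_close: "\<forall>\<^sub>F T in sequentially. nrm (w i T - ainv N * Z i T) \<le> dl N"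
proof -
  obtain d where d: "d \<longlonglongrightarrow> 0" "\<And>T. nrm (ainv N * Z i T - restr {1..int T} (coef (ainv N * Z i T))) \<le> d T"
    using edge_tendsto by blast
  let ?B = "\<lambda>T. 1 / (real N + 1) + l1tail \<eta> T * (1 / m)"
  have "(\<lambda>T. (?B T * 1 + l1norm \<eta> * d T) / m + d T) \<longlonglongrightarrow> ((1 / (real N + 1) + 0 * (1 / m)) * 1 + l1norm \<eta> * 0) / m + 0"
    using m_pos by (intro tendsto_intros l1tail_tendsto d(1)) auto
  moreover have "((1 / (real N + 1) + 0 * (1 / m)) * 1 + l1norm \<eta> * 0) / m + 0 < dl N"
    using m_pos by (simp add: dl_def divide_strict_right_mono)
  ultimately have "\<forall>\<^sub>F T in sequentially. (?B T * 1 + l1norm \<eta> * d T) / m + d T < dl N"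
    by (rule order_tendstoD(2))
  moreover have "\<forall>\<^sub>F T in sequentially. l1tail \<eta> T < m"
    using order_tendstoD(2)[OF l1tail_tendsto m_pos] .
  ultimately show ?thesis
    using w_eq[of i]
  proof eventually_elim
    case (elim T)
    let ?d = "nrm (ainv N * Z i T - restr {1..int T} (coef (ainv N * Z i T)))"
    have B: "cmod (1 - ft (trunc \<eta> T) w * ft (ainv N) w) \<le> ?B T" if w: "w \<in> {-pi..pi}" for w
    proof -
      have "1 - ft (trunc \<eta> T) w * ft (ainv N) w =
        (1 - symb \<eta> w * ft (ainv N) w) - (ft (trunc \<eta> T) w - symb \<eta> w) * ft (ainv N) w"
        by (simp add: algebra_simps)
      also have "cmod \<dots> \<le> cmod (1 - symb \<eta> w * ft (ainv N) w) + cmod (ft (trunc \<eta> T) w - symb \<eta> w) * cmod (ft (ainv N) w)"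
        by (rule order_trans[OF norm_triangle_ineq4]) (simp add: norm_mult)
      also have "\<dots> \<le> ?B T"
        using l1tail_nonneg by (intro add_mono mult_mono ainv_approx ft_trunc_approx cmod_ft_ainv_le w) auto
      finally show ?thesis .
    qed
    have "nrm (w i T - ainv N * Z i T) \<le> (?B T * nrm (Z i T) + l1norm \<eta> * ?d) / m + ?d"
      by (rule toeplitz_solution_approx[OF _ w_supp Z_supp _ B refl]) (use elim in auto)
    also have "\<dots> \<le> (?B T * 1 + l1norm \<eta> * d T) / m + d T"
      using m_pos l1tail_nonneg l1norm_nonneg
      by (intro add_mono divide_right_mono mult_left_mono d(2) Z_nrm) auto
    finally show ?case using elim(1) by linarith
  qed
qed

lemma nrm_ainv_mult_le: "nrm (ainv N * a) \<le> 1 / m * nrm a"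
  by (rule nrm_mult_le) (rule cmod_ft_ainv_le)

lemma nrm_ainv_Z_le: "nrm (ainv N * Z i T) \<le> 1 / m"
proof -
  have "nrm (ainv N * Z i T) \<le> 1 / m * nrm (Z i T)" by (rule nrm_ainv_mult_le)
  also have "\<dots> \<le> 1 / m * 1" using m_pos by (intro mult_left_mono Z_nrm) auto
  finally show ?thesis by simp
qed

lemma nrm_w_le:
  assumes "nrm (w i T - ainv N * Z i T) \<le> dl N"
  shows "nrm (w i T) \<le> 1 / m + dl N"
proof -
  have "nrm (w i T) \<le> nrm (ainv N * Z i T) + nrm (w i T - ainv N * Z i T)"
    using nrm_triangle[of "ainv N * Z i T" "w i T - ainv N * Z i T"] by simp
  with assms nrm_ainv_Z_le[of N i T] show ?thesis by linarith
qed

lemma w_bounded: "\<forall>\<^sub>F T in sequentially. nrm (w i T) \<le> 1 / m + dl 0"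
  using w_close[of i 0] by eventually_elim (rule nrm_w_le)

text \<open>An entry of \<open>w\<close> is an entry of \<open>ainv N * Z\<close>, which tends to 0
  for fixed \<open>N\<close> with the largest regressor entry, plus an error bounded by the l2
  distance \<open>dl N\<close>.\<close>

lemma mxc_w_tendsto: "(\<lambda>T. mxc (w i T)) \<longlonglongrightarrow> 0"
proof (rule tendsto_double_limit[where b = "\<lambda>N T. 0" and S = "\<lambda>N. 0"])
  fix N
  let ?C = "\<Sum>k\<in>supp (ainv N). \<bar>coef (ainv N) k\<bar>"
  have "(\<lambda>T. ?C * \<mu> i T) \<longlonglongrightarrow> ?C * 0" by (intro tendsto_mult tendsto_const \<mu>_lim)
  then have "\<forall>\<^sub>F T in sequentially. ?C * \<mu> i T < dl N"
    using dl_pos by (intro order_tendstoD(2)) auto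
  with w_close[of i N] show "\<forall>\<^sub>F T in sequentially. \<bar>mxc (w i T) - 0\<bar> \<le> 2 * dl N"
  proof eventually_elim
    case (elim T)
    have "\<bar>coef (w i T) t\<bar> \<le> 2 * dl N" for t
    proof -
      have "\<bar>coef (ainv N * Z i T) t\<bar> \<le> (\<Sum>k\<in>supp (ainv N). \<bar>coef (ainv N) k\<bar> * \<bar>coef (Z i T) (t - k)\<bar>)"
        unfolding coef_mult[OF finite_keys subset_refl] by (rule order_trans[OF sum_abs]) (simp add: abs_mult)
      also have "\<dots> \<le> ?C * \<mu> i T"
        unfolding sum_distrib_right by (intro sum_mono mult_left_mono Z_max) auto
      finally have "\<bar>coef (ainv N * Z i T) t\<bar> \<le> dl N" using elim(2) by linarith
      moreover have "\<bar>coef (w i T - ainv N * Z i T) t\<bar> \<le> dl N"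
        by (rule order_trans[OF coef_le_nrm elim(1)])
      ultimately show ?thesis unfolding lookup_minus by linarith
    qed
    then show ?case using mxc_le mxc_nonneg by simp
  qed
next
  show "(\<lambda>N. 2 * dl N) \<longlonglongrightarrow> 0" using tendsto_mult[OF tendsto_const dl_tendsto, of 2] by simp
qed auto

lemma real_RS_limit:
  assumes "\<And>N. has_RS_integral (f N) (F i j) (- pi) pi (of_real (S N))"
    and "uniform_limit {-pi..pi} f g sequentially"
  obtains L where "S \<longlonglongrightarrow> L" "has_RS_integral g (F i j) (- pi) pi (of_real L)"
proof -
  obtain L where L: "(\<lambda>N. complex_of_real (S N)) \<longlonglongrightarrow> L" "has_RS_integral g (F i j) (- pi) pi L"
    using has_RS_integral_uniform_limit[OF _ F_var assms] by auto
  have "L = of_real (Re L)"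
    using LIMSEQ_unique[OF tendsto_Im[OF L(1)], of 0] by (simp add: complex_eq_iff)
  with L show thesis using that[of "Re L"] tendsto_Re[OF L(1)] by simp
qed

text \<open>The limit and the value of the integral are obtained together: both are limits over
  \<open>N\<close> of the same numbers \<open>S N\<close>.\<close>

lemma design_limit:
  obtains A where "(\<lambda>T. ip (Z i T) (w j T)) \<longlonglongrightarrow> A"
    "has_RS_integral (\<lambda>v. 1 / symb \<eta> v) (F i j) (- pi) pi (of_real A)"
proof -
  have "\<exists>S. (\<lambda>T. ip (Z i T) (ainv N * Z j T)) \<longlonglongrightarrow> S \<and> has_RS_integral (ft (ainv N)) (F i j) (- pi) pi (of_real S)" for N
    using quadratic_form_limit[OF adj_ainv] by metis
  then obtain S where S: "\<And>N. (\<lambda>T. ip (Z i T) (ainv N * Z j T)) \<longlonglongrightarrow> S N"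
    "\<And>N. has_RS_integral (ft (ainv N)) (F i j) (- pi) pi (of_real (S N))" by metis
  obtain A where A: "S \<longlonglongrightarrow> A" "has_RS_integral (\<lambda>v. 1 / symb \<eta> v) (F i j) (- pi) pi (of_real A)"
    using real_RS_limit[OF S(2) uniform_limit_ainv] by blast
  have "(\<lambda>T. ip (Z i T) (w j T)) \<longlonglongrightarrow> A"
  proof (rule tendsto_double_limit[OF _ dl_tendsto S(1) A(1)])
    fix N
    show "\<forall>\<^sub>F T in sequentially. \<bar>ip (Z i T) (w j T) - ip (Z i T) (ainv N * Z j T)\<bar> \<le> dl N"
      using w_close[of j N]
    proof eventually_elim
      case (elim T)
      have "\<bar>ip (Z i T) (w j T) - ip (Z i T) (ainv N * Z j T)\<bar> \<le> nrm (Z i T) * nrm (w j T - ainv N * Z j T)"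
        unfolding ip_diff_right[symmetric] by (rule ip_le)
      also have "\<dots> \<le> 1 * dl N" by (intro mult_mono Z_nrm elim) auto
      finally show ?case by simp
    qed
  qed
  with A(2) show thesis using that by blast
qed

lemma noise_limit:
  assumes "even_l1 \<gamma>"
  obtains B where "(\<lambda>T. ip (w i T) (trunc \<gamma> T * w j T)) \<longlonglongrightarrow> B"
    "has_RS_integral (\<lambda>v. symb \<gamma> v / (symb \<eta> v)\<^sup>2) (F i j) (- pi) pi (of_real B)"
proof -
  interpret \<gamma>: even_l1 \<gamma> by fact
  define q where "q N = ainv N * trunc \<gamma> N * ainv N" for N
  have aq: "adj (q N) = q N" for N by (simp add: q_def adj_mult adj_ainv \<gamma>.adj_trunc)
  have "\<exists>S. (\<lambda>T. ip (Z i T) (q N * Z j T)) \<longlonglongrightarrow> S \<and> has_RS_integral (ft (q N)) (F i j) (- pi) pi (of_real S)" for N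
    using quadratic_form_limit[OF aq] by metis
  then obtain S where S: "\<And>N. (\<lambda>T. ip (Z i T) (q N * Z j T)) \<longlonglongrightarrow> S N"
    "\<And>N. has_RS_integral (ft (q N)) (F i j) (- pi) pi (of_real (S N))" by metis
  have bi: "bounded ((\<lambda>v. 1 / symb \<eta> v) ` {-pi..pi})"
  proof (rule boundedI)
    fix x assume "x \<in> (\<lambda>v. 1 / symb \<eta> v) ` {-pi..pi}"
    then obtain v where v: "v \<in> {-pi..pi}" "x = 1 / symb \<eta> v" by blast
    then show "norm x \<le> 1 / (2 * m)"
      using cmod_symb_ge[OF v(1)] m_pos by (auto simp: norm_divide intro!: divide_left_mono mult_pos_pos)
  qed
  have bg: "bounded (symb \<gamma> ` {-pi..pi})"
    using \<gamma>.cmod_symb_le by (auto intro!: boundedI)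
  have bp: "bounded ((\<lambda>v. 1 / symb \<eta> v * symb \<gamma> v) ` {-pi..pi})"
  proof (rule boundedI)
    fix x assume "x \<in> (\<lambda>v. 1 / symb \<eta> v * symb \<gamma> v) ` {-pi..pi}"
    then obtain v where v: "v \<in> {-pi..pi}" "x = 1 / symb \<eta> v * symb \<gamma> v" by blast
    have "norm (1 / symb \<eta> v) \<le> 1 / (2 * m)"
      using cmod_symb_ge[OF v(1)] m_pos by (auto simp: norm_divide intro!: divide_left_mono mult_pos_pos)
    then show "norm x \<le> 1 / (2 * m) * l1norm \<gamma>"
      unfolding v norm_mult using m_pos by (intro mult_mono \<gamma>.cmod_symb_le) auto
  qed
  have "uniform_limit {-pi..pi} (\<lambda>N v. ft (ainv N) v * ft (trunc \<gamma> N) v * ft (ainv N) v)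
      (\<lambda>v. 1 / symb \<eta> v * symb \<gamma> v * (1 / symb \<eta> v)) sequentially"
    by (intro uniform_lim_mult uniform_limit_ainv \<gamma>.uniform_limit_trunc bi bg bp)
  then have ul: "uniform_limit {-pi..pi} (\<lambda>N. ft (q N)) (\<lambda>v. symb \<gamma> v / (symb \<eta> v)\<^sup>2) sequentially"
    by (simp add: q_def ft_mult[abs_def] power2_eq_square)
  obtain B where B: "S \<longlonglongrightarrow> B" "has_RS_integral (\<lambda>v. symb \<gamma> v / (symb \<eta> v)\<^sup>2) (F i j) (- pi) pi (of_real B)"
    using real_RS_limit[OF S(2) ul] by blast
  \<comment> \<open>Three exchanges: the left \<open>w\<close>, the right \<open>w\<close>, and the
    noise symbol truncated at \<open>T\<close> for the one truncated at \<open>N\<close>.\<close>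
  let ?e = "\<lambda>N. l1norm \<gamma> * dl N * (1 / m + dl N) + l1norm \<gamma> * dl N * (1 / m) + 2 * l1tail \<gamma> N * (1 / m) * (1 / m)"
  have "(\<lambda>T. ip (w i T) (trunc \<gamma> T * w j T)) \<longlonglongrightarrow> B"
  proof (rule tendsto_double_limit[OF _ _ S(1) B(1)])
    have "?e \<longlonglongrightarrow> l1norm \<gamma> * 0 * (1 / m + 0) + l1norm \<gamma> * 0 * (1 / m) + 2 * 0 * (1 / m) * (1 / m)"
      by (intro tendsto_intros dl_tendsto \<gamma>.l1tail_tendsto)
    then show "?e \<longlonglongrightarrow> 0" by simp
    fix N
    show "\<forall>\<^sub>F T in sequentially. \<bar>ip (w i T) (trunc \<gamma> T * w j T) - ip (Z i T) (q N * Z j T)\<bar> \<le> ?e N"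
      using w_close[of i N] w_close[of j N] eventually_ge_at_top[of N]
    proof eventually_elim
      case (elim T)
      let ?u = "\<lambda>i. ainv N * Z i T" and ?G = "trunc \<gamma> T" and ?w = "\<lambda>i. w i T"
      have m0: "0 \<le> 1 / m" using m_pos by simp
      have qq: "ip (Z i T) (q N * Z j T) = ip (?u i) (trunc \<gamma> N * ?u j)"
        by (simp add: ip_mult_left adj_ainv q_def mult_ac)
      have "ip (?w i) (?G * ?w j) - ip (?u i) (trunc \<gamma> N * ?u j) =
        ip (?w i - ?u i) (?G * ?w j) + ip (?u i) (?G * (?w j - ?u j)) + ip (?u i) ((?G - trunc \<gamma> N) * ?u j)"
        by (simp add: ip_diff_left ip_diff_right right_diff_distrib left_diff_distrib)
      moreover have "\<bar>ip (?w i - ?u i) (?G * ?w j)\<bar> \<le> dl N * (l1norm \<gamma> * (1 / m + dl N))"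
        using dl_pos[of N] \<gamma>.l1norm_nonneg
        by (intro order_trans[OF ip_le] mult_mono elim order_trans[OF \<gamma>.nrm_trunc_mult_le] mult_left_mono
            nrm_w_le) auto
      moreover have "\<bar>ip (?u i) (?G * (?w j - ?u j))\<bar> \<le> (1 / m) * (l1norm \<gamma> * dl N)"
        using dl_pos[of N] \<gamma>.l1norm_nonneg m0
        by (intro order_trans[OF ip_le] mult_mono elim order_trans[OF \<gamma>.nrm_trunc_mult_le] mult_left_mono
            nrm_ainv_Z_le) auto
      moreover have "\<bar>ip (?u i) ((?G - trunc \<gamma> N) * ?u j)\<bar> \<le> (1 / m) * (2 * l1tail \<gamma> N * (1 / m))"
        using elim(3) \<gamma>.l1tail_nonneg m0
        by (intro order_trans[OF ip_le] mult_mono order_trans[OF \<gamma>.nrm_trunc_diff_mult_le] mult_left_mono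
            nrm_ainv_Z_le) auto
      moreover have "dl N * (l1norm \<gamma> * (1 / m + dl N)) + (1 / m) * (l1norm \<gamma> * dl N) + (1 / m) * (2 * l1tail \<gamma> N * (1 / m)) = ?e N"
        by (simp add: algebra_simps)
      ultimately show ?case unfolding qq by linarith
    qed
  qed
  with B(2) show thesis using that by blast
qed

lemma solution_ip:
  assumes "\<forall>t\<in>{1..int T}. coef (trunc \<eta> T * b) t = coef z t" "supp a \<subseteq> {1..int T}"
  shows "ip a (trunc \<eta> T * b) = ip a z"
  unfolding ip_eq_sum[OF finite_atLeastAtMost_int disjI1[OF assms(2)]]
  using assms(1) by (intro sum.cong) auto

text \<open>Both sides equal the symmetric Toeplitz form evaluated at the two solutions.\<close>

lemma design_sym: "\<forall>\<^sub>F T in sequentially. ip (Z i T) (w j T) = ip (Z j T) (w i T)"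
  using w_eq[of i] w_eq[of j]
proof eventually_elim
  case (elim T)
  have "ip (Z i T) (w j T) = ip (w j T) (trunc \<eta> T * w i T)"
    using solution_ip[OF elim(1) w_supp] by (simp add: ip_commute)
  also have "\<dots> = ip (w i T) (trunc \<eta> T * w j T)"
    by (simp add: ip_commute[of "w j T"] ip_mult_left adj_trunc)
  also have "\<dots> = ip (Z j T) (w i T)"
    using solution_ip[OF elim(2) w_supp] by (simp add: ip_commute)
  finally show ?case .
qed

text \<open>With \<open>u\<close> the solution for \<open>z\<close>, coercivity bounds
  \<open>ip z u\<close> below by \<open>m\<close> times the squared norm of \<open>u\<close>, while
  boundedness of the operator gives \<open>nrm z \<le> l1norm \<eta> * nrm u\<close>. Hence the
  constant \<open>m / (l1norm \<eta>)\<^sup>2\<close>, the same for all large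
  \<open>T\<close>.\<close>

lemma design_lower:
  "\<forall>\<^sub>F T in sequentially. m / (l1norm \<eta>)\<^sup>2 * (\<Sum>i\<in>UNIV. \<Sum>j\<in>UNIV. v i * ip (Z i T) (Z j T) * v j)
     \<le> (\<Sum>i\<in>UNIV. \<Sum>j\<in>UNIV. v i * ip (Z i T) (w j T) * v j)"
proof -
  have "\<forall>\<^sub>F T in sequentially. l1tail \<eta> T < m"
    using order_tendstoD(2)[OF l1tail_tendsto m_pos] .
  moreover have "\<forall>\<^sub>F T in sequentially. \<forall>i. \<forall>t\<in>{1..int T}. coef (trunc \<eta> T * w i T) t = coef (Z i T) t"
    using w_eq by (intro eventually_all_finite) 
  ultimately show ?thesis
  proof eventually_elim
    case (elim T)
    define z where "z = (\<Sum>i\<in>UNIV. scal (v i) (Z i T))"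
    define u where "u = (\<Sum>i\<in>UNIV. scal (v i) (w i T))"
    have eq: "\<forall>t\<in>{1..int T}. coef (trunc \<eta> T * u) t = coef z t"
    proof
      fix t assume t: "t \<in> {1..int T}"
      have "trunc \<eta> T * u = (\<Sum>i\<in>UNIV. scal (v i) (trunc \<eta> T * w i T))"
        by (simp add: u_def sum_distrib_left mult_ac)
      then show "coef (trunc \<eta> T * u) t = coef z t"
        using elim(2) t by (simp add: z_def lookup_sum coef_scal)
    qed
    have su: "supp u \<subseteq> {1..int T}" 
    proof
      fix t assume "t \<in> supp u"
      then have "(\<Sum>i\<in>UNIV. v i * coef (w i T) t) \<noteq> 0" by (simp add: in_keys_iff u_def lookup_sum coef_scal)
      then obtain i where "coef (w i T) t \<noteq> 0" by (auto elim!: sum.not_neutral_contains_not_neutral)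
      then show "t \<in> {1..int T}" using w_supp[of i T] by (auto simp: in_keys_iff)
    qed
    have sz: "supp z \<subseteq> {1..int T}" 
    proof
      fix t assume "t \<in> supp z"
      then have "(\<Sum>i\<in>UNIV. v i * coef (Z i T) t) \<noteq> 0" by (simp add: in_keys_iff z_def lookup_sum coef_scal)
      then obtain i where "coef (Z i T) t \<noteq> 0" by (auto elim!: sum.not_neutral_contains_not_neutral)
      then show "t \<in> {1..int T}" using Z_supp[of i T] by (auto simp: in_keys_iff)
    qed
    have "m * (nrm u)\<^sup>2 \<le> ip u (trunc \<eta> T * u)"
      using elim(1) by (intro ip_mult_self_ge Re_ft_trunc_ge) auto
    also have "\<dots> = ip z u" using solution_ip[OF eq su] by (simp add: ip_commute)
    finally have 1: "m * (nrm u)\<^sup>2 \<le> ip z u" .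
    have "(nrm z)\<^sup>2 = ip z (trunc \<eta> T * u)" unfolding nrm_sq using solution_ip[OF eq sz] by simp
    also have "\<dots> \<le> nrm z * (l1norm \<eta> * nrm u)"
      using ip_le[of z "trunc \<eta> T * u"] nrm_trunc_mult_le[of T u]
      by (meson abs_le_D1 mult_left_mono nrm_nonneg order_trans)
    finally have zz: "(nrm z)\<^sup>2 \<le> nrm z * (l1norm \<eta> * nrm u)" .
    have "nrm z \<le> l1norm \<eta> * nrm u"
    proof (cases "nrm z = 0")
      case True
      then show ?thesis using l1norm_nonneg by simp
    next
      case False
      then have "nrm z > 0" using nrm_nonneg[of z] by linarith
      with zz show ?thesis
        by (simp only: power2_eq_square mult_le_cancel_left_pos)
    qed
    then have "(nrm z)\<^sup>2 \<le> (l1norm \<eta>)\<^sup>2 * (nrm u)\<^sup>2"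
      using power_mono[of "nrm z" "l1norm \<eta> * nrm u" 2] by (simp add: power_mult_distrib)
    then have "m / (l1norm \<eta>)\<^sup>2 * (nrm z)\<^sup>2 \<le> m / (l1norm \<eta>)\<^sup>2 * ((l1norm \<eta>)\<^sup>2 * (nrm u)\<^sup>2)"
      using m_pos by (intro mult_left_mono) auto
    also have "\<dots> = m * (nrm u)\<^sup>2" using l1norm_pos by simp
    finally have "m / (l1norm \<eta>)\<^sup>2 * ip z z \<le> ip z u" using 1 by (simp add: nrm_sq)
    then show ?case unfolding z_def u_def ip_lin_comb .
  qed
qed

lemma design_limit_lower:
  assumes "\<And>i j. (\<lambda>T. ip (Z i T) (w j T)) \<longlonglongrightarrow> A i j"
  shows "m / (l1norm \<eta>)\<^sup>2 * (\<Sum>i\<in>UNIV. \<Sum>j\<in>UNIV. v i * R 0 i j * v j) \<le> (\<Sum>i\<in>UNIV. \<Sum>j\<in>UNIV. v i * A i j * v j)"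
proof (rule tendsto_le[OF _ _ _ design_lower[of v]])
  have "(\<lambda>T. ip (Z i T) (Z j T)) \<longlonglongrightarrow> R 0 i j" for i j
    using Z_lim[of i 0 j] by simp
  then show "(\<lambda>T. m / (l1norm \<eta>)\<^sup>2 * (\<Sum>i\<in>UNIV. \<Sum>j\<in>UNIV. v i * ip (Z i T) (Z j T) * v j))
     \<longlonglongrightarrow> m / (l1norm \<eta>)\<^sup>2 * (\<Sum>i\<in>UNIV. \<Sum>j\<in>UNIV. v i * R 0 i j * v j)"
    by (intro tendsto_intros)
  show "(\<lambda>T. \<Sum>i\<in>UNIV. \<Sum>j\<in>UNIV. v i * ip (Z i T) (w j T) * v j) \<longlonglongrightarrow> (\<Sum>i\<in>UNIV. \<Sum>j\<in>UNIV. v i * A i j * v j)"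
    by (intro tendsto_intros assms)
qed simp

lemma gram_limit_psd: "0 \<le> (\<Sum>i\<in>UNIV. \<Sum>j\<in>UNIV. v i * R 0 i j * v j)"
proof (rule LIMSEQ_le_const)
  have "(\<lambda>T. ip (Z i T) (Z j T)) \<longlonglongrightarrow> R 0 i j" for i j
    using Z_lim[of i 0 j] by simp
  then show "(\<lambda>T. \<Sum>i\<in>UNIV. \<Sum>j\<in>UNIV. v i * ip (Z i T) (Z j T) * v j)
     \<longlonglongrightarrow> (\<Sum>i\<in>UNIV. \<Sum>j\<in>UNIV. v i * R 0 i j * v j)"
    by (intro tendsto_intros)
  show "\<exists>N. \<forall>T\<ge>N. 0 \<le> (\<Sum>i\<in>UNIV. \<Sum>j\<in>UNIV. v i * ip (Z i T) (Z j T) * v j)"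
    unfolding ip_lin_comb[symmetric] by simp
qed

lemma gram_limit_sym: "R 0 i j = R 0 j i"
  using Z_lim[of i 0 j] Z_lim[of j 0 i] by (simp add: ip_commute LIMSEQ_unique)

end

section \<open>Inverses of positive definite matrices\<close>

text \<open>Gaussian elimination by induction on the index set. Positive definiteness passes to the
  smaller system and makes the pivot \<open>a\<close>, a Schur complement, positive.\<close>

lemma pd_solvable:
  fixes A :: "'i \<Rightarrow> 'i \<Rightarrow> real"
  assumes "finite S"
    and "\<And>v. \<exists>s\<in>S. v s \<noteq> 0 \<Longrightarrow> 0 < (\<Sum>s\<in>S. v s * (\<Sum>t\<in>S. A s t * v t))"
  shows "\<exists>v. \<forall>s\<in>S. (\<Sum>t\<in>S. A s t * v t) = b s"
  using assms
proof (induction S arbitrary: b)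
  case empty
  then show ?case by simp
next
  case (insert x S)
  have IH: "\<exists>v. \<forall>s\<in>S. (\<Sum>t\<in>S. A s t * v t) = b s" for b
  proof (rule insert.IH)
    fix v :: "'i \<Rightarrow> real" assume "\<exists>s\<in>S. v s \<noteq> 0"
    then have "\<exists>s\<in>insert x S. (v(x := 0)) s \<noteq> 0" using insert.hyps by auto
    from insert.prems[OF this]
    have "0 < (\<Sum>s\<in>S. (v(x := 0)) s * (\<Sum>t\<in>S. A s t * (v(x := 0)) t))"
      using insert.hyps by simp
    also have "\<dots> = (\<Sum>s\<in>S. v s * (\<Sum>t\<in>S. A s t * v t))"
      using insert.hyps by (intro sum.cong arg_cong2[where f = "(*)"]) auto
    finally show "0 < (\<Sum>s\<in>S. v s * (\<Sum>t\<in>S. A s t * v t))" .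
  qed
  obtain u where u: "\<forall>s\<in>S. (\<Sum>t\<in>S. A s t * u t) = A s x" using IH[of "\<lambda>s. A s x"] by blast
  define a where "a = A x x - (\<Sum>t\<in>S. A x t * u t)"
  have "a > 0"
  proof -
    \<comment> \<open>The form evaluated at this vector is the pivot, because \<open>u\<close>
      annihilates all rows other than \<open>x\<close>.\<close>
    let ?v = "\<lambda>t. if t = x then 1 else - u t"
    have inner: "(\<Sum>t\<in>insert x S. A s t * ?v t) = A s x - (\<Sum>t\<in>S. A s t * u t)" for s
    proof -
      have "(\<Sum>t\<in>S. A s t * ?v t) = (\<Sum>t\<in>S. - (A s t * u t))"
        using insert.hyps by (intro sum.cong) auto
      then show ?thesis using insert.hyps by (simp add: sum_negf)
    qed
    have "0 < (\<Sum>s\<in>insert x S. ?v s * (\<Sum>t\<in>insert x S. A s t * ?v t))"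
      by (rule insert.prems) auto
    also have "\<dots> = a"
      unfolding inner using insert.hyps u by (simp add: a_def)
    finally show ?thesis .
  qed
  obtain y where y: "\<forall>s\<in>S. (\<Sum>t\<in>S. A s t * y t) = b s" using IH by blast
  define c where "c = (b x - (\<Sum>t\<in>S. A x t * y t)) / a"
  let ?v = "\<lambda>t. if t = x then c else y t - c * u t"
  have eq: "(\<Sum>t\<in>insert x S. A s t * ?v t) = A s x * c + (\<Sum>t\<in>S. A s t * y t) - c * (\<Sum>t\<in>S. A s t * u t)" for s
  proof -
    have "(\<Sum>t\<in>S. A s t * ?v t) = (\<Sum>t\<in>S. A s t * y t - c * (A s t * u t))"
      using insert.hyps by (intro sum.cong) (auto simp: algebra_simps)
    then show ?thesis using insert.hyps by (simp add: sum_subtractf sum_distrib_left)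
  qed
  have "(\<Sum>t\<in>insert x S. A s t * ?v t) = b s" if s: "s \<in> insert x S" for s
  proof (cases "s = x")
    case True
    have "c * a = b x - (\<Sum>t\<in>S. A x t * y t)" using \<open>a > 0\<close> by (simp add: c_def)
    then show ?thesis unfolding eq True by (simp add: a_def algebra_simps)
  next
    case False
    with s u y show ?thesis unfolding eq by (simp add: mult.commute)
  qed
  then show ?case by (intro exI[of _ ?v] ballI)
qed

lemma left_right_inverse_eq:
  fixes A L R :: "nat \<Rightarrow> nat \<Rightarrow> real"
  assumes L: "\<And>j. j \<in> {1..n} \<Longrightarrow> (\<Sum>k=1..n. L s k * A k j) = (if s = j then 1 else 0)"
    and R: "\<And>k. k \<in> {1..n} \<Longrightarrow> (\<Sum>j=1..n. A k j * R j t) = (if k = t then 1 else 0)"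
    and st: "s \<in> {1..n}" "t \<in> {1..n}"
  shows "L s t = R s t"
proof -
  have "L s t = (\<Sum>k=1..n. L s k * (if k = t then 1 else 0))"
    using st by (simp add: if_distrib[of "\<lambda>x. _ * x"] cong: if_cong)
  also have "\<dots> = (\<Sum>k=1..n. \<Sum>j=1..n. L s k * A k j * R j t)"
    using R by (intro sum.cong refl) (simp add: mult.assoc flip: sum_distrib_left)
  also have "\<dots> = (\<Sum>j=1..n. (if s = j then 1 else 0) * R j t)"
    using L by (subst sum.swap, intro sum.cong refl) (simp flip: sum_distrib_right)
  also have "\<dots> = R s t"
    using st by (simp add: if_distrib[of "\<lambda>x. x * _"] cong: if_cong)
  finally show ?thesis .
qed

text \<open>Columns obtained by solving the system form a right inverse; symmetry of
  \<open>A\<close> makes their transpose a left inverse. Hence the inverse is symmetric and unique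
  on the index range, and the choice in \<open>sq_inv\<close> must agree with it there.\<close>

lemma sq_inv_pd:
  fixes A :: "nat \<Rightarrow> nat \<Rightarrow> real"
  assumes sym: "\<And>s t. A s t = A t s"
    and pd: "\<And>v. \<exists>s\<in>{1..n}. v s \<noteq> 0 \<Longrightarrow> 0 < (\<Sum>s=1..n. v s * (\<Sum>t=1..n. A s t * v t))"
    and st: "s \<in> {1..n}" "t \<in> {1..n}"
  shows "(\<Sum>k=1..n. A s k * sq_inv n A k t) = (if s = t then 1 else 0)"
    and "sq_inv n A s t = sq_inv n A t s"
proof -
  have "\<forall>t. \<exists>v. \<forall>s\<in>{1..n}. (\<Sum>k=1..n. A s k * v k) = (if s = t then 1 else 0)"
    by (intro allI pd_solvable pd) auto
  then obtain C where C: "\<And>t s. s \<in> {1..n} \<Longrightarrow> (\<Sum>k=1..n. A s k * C t k) = (if s = t then 1 else 0)"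
    by metis
  have C': "(\<Sum>k=1..n. C s k * A k j) = (if s = j then 1 else 0)" if "j \<in> {1..n}" for s j
  proof -
    have "(\<Sum>k=1..n. C s k * A k j) = (\<Sum>k=1..n. A j k * C s k)"
      by (intro sum.cong refl) (metis sym mult.commute)
    then show ?thesis using C[OF that, of s] by auto
  qed
  have Csym: "C s t = C t s" if "s \<in> {1..n}" "t \<in> {1..n}" for s t
    by (rule left_right_inverse_eq[where L = C and A = A and R = "\<lambda>j t. C t j", OF C' C that])
  define B where "B = sq_inv n A"
  have "\<exists>B. \<forall>s\<in>{1..n}. \<forall>t\<in>{1..n}. (\<Sum>k=1..n. A s k * B k t) = (if s = t then 1 else 0) \<and>
     (\<Sum>k=1..n. B s k * A k t) = (if s = t then 1 else 0)"
  proof (intro exI[of _ C] ballI conjI)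
    fix s t assume st: "s \<in> {1..n}" "t \<in> {1..n}"
    have "(\<Sum>k=1..n. A s k * C k t) = (\<Sum>k=1..n. A s k * C t k)"
      using Csym st by (intro sum.cong) auto
    then show "(\<Sum>k=1..n. A s k * C k t) = (if s = t then 1 else 0)" using C st by simp
  qed (rule C')
  from someI_ex[OF this, folded sq_inv_def, folded B_def]
  have B: "\<And>s t. s \<in> {1..n} \<Longrightarrow> t \<in> {1..n} \<Longrightarrow> (\<Sum>k=1..n. A s k * B k t) = (if s = t then 1 else 0)"
    by blast
  have BC: "B s t = C s t" if "s \<in> {1..n}" "t \<in> {1..n}" for s t
    by (rule left_right_inverse_eq[where L = C and A = A and R = B, OF C' B[OF _ that(2)] that, symmetric])
  show "(\<Sum>k=1..n. A s k * sq_inv n A k t) = (if s = t then 1 else 0)"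
    using B[OF st] by (simp only: B_def)
  show "sq_inv n A s t = sq_inv n A t s"
    using BC[OF st] BC[OF st(2,1)] Csym[OF st] by (simp add: B_def)
qed

lemma matrix_inv_both:
  fixes A :: "'a::semiring_1^'d^'d"
  assumes "invertible A"
  shows "A ** matrix_inv A = mat 1" "matrix_inv A ** A = mat 1"
  using someI_ex[OF assms[unfolded invertible_def]] by (auto simp: matrix_inv_def)

text \<open>By Cramer's rule the entries of the inverse are quotients of determinants, which are
  continuous in the entries. Invertibility for large \<open>n\<close> is part of the
  conclusion.\<close>

lemma matrix_inv_tendsto:
  fixes A :: "nat \<Rightarrow> real^'d^'d"
  assumes "A \<longlonglongrightarrow> B" "invertible B"
  shows "(\<lambda>n. matrix_inv (A n)) \<longlonglongrightarrow> matrix_inv B" "\<forall>\<^sub>F n in sequentially. invertible (A n)"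
proof -
  have det: "(\<lambda>n. det (C n)) \<longlonglongrightarrow> det D" if "\<And>i j. (\<lambda>n. C n $ i $ j) \<longlonglongrightarrow> D $ i $ j"
    for C :: "nat \<Rightarrow> real^'d^'d" and D
    unfolding det_def by (intro tendsto_intros that)
  have e: "(\<lambda>n. A n $ i $ j) \<longlonglongrightarrow> B $ i $ j" for i j
    using assms(1) by (intro tendsto_vec_nth)
  have dB: "det B \<noteq> 0" using assms(2) by (simp add: invertible_det_nz)
  have "\<forall>\<^sub>F n in sequentially. det (A n) \<noteq> 0"
    using tendsto_imp_eventually_ne[OF det[OF e] dB] .
  then show inv: "\<forall>\<^sub>F n in sequentially. invertible (A n)"
    by (simp add: invertible_det_nz)
  have cr: "matrix_inv C $ k $ l = det (\<chi> i j. if j = k then axis l 1 $ i else C $ i $ j) / det C" if "invertible C"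
    for C :: "real^'d^'d" and k l
  proof -
    have "C ** matrix_inv C = mat 1" by (rule matrix_inv_both(1)[OF that])
    then have "C *v (matrix_inv C *v axis l 1) = axis l 1"
      by (simp add: matrix_vector_mul_assoc)
    then have "matrix_inv C *v axis l 1 = (\<chi> k. det (\<chi> i j. if j = k then axis l 1 $ i else C $ i $ j) / det C)"
      using cramer[of C] that by (simp add: invertible_det_nz)
    moreover have "(matrix_inv C *v axis l 1) $ k = matrix_inv C $ k $ l"
      by (simp add: matrix_vector_mul_component inner_axis)
    ultimately show ?thesis by simp
  qed
  show "(\<lambda>n. matrix_inv (A n)) \<longlonglongrightarrow> matrix_inv B"
  proof (intro vec_tendstoI)
    fix k l
    have "(\<lambda>n. det (\<chi> i j. if j = k then axis l 1 $ i else A n $ i $ j) / det (A n))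
       \<longlonglongrightarrow> det (\<chi> i j. if j = k then axis l 1 $ i else B $ i $ j) / det B"
      by (intro tendsto_divide det e dB) (auto intro: e)
    then show "(\<lambda>n. matrix_inv (A n) $ k $ l) \<longlonglongrightarrow> matrix_inv B $ k $ l"
      unfolding cr[OF assms(2)]
      by (rule Lim_transform_eventually) (use inv in \<open>eventually_elim, simp add: cr\<close>)
  qed
qed

lemma matrix_inv_eqI:
  fixes A B :: "'a::field^'d^'d"
  assumes "A ** B = mat 1" shows "matrix_inv A = B"
proof -
  have "invertible A" using assms by (metis invertible_def matrix_left_right_inverse)
  then have "matrix_inv A ** A = mat 1" using matrix_inv_both(2) by blast
  then have "matrix_inv A ** (A ** B) = B" by (simp add: matrix_mul_assoc)
  with assms show ?thesis by simp
qed

section \<open>The limit law of the generalised least squares estimator\<close>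

lemma tendsto_matrix_mult:
  fixes A B :: "nat \<Rightarrow> real^'d^'d"
  assumes "A \<longlonglongrightarrow> a" "B \<longlonglongrightarrow> b"
  shows "(\<lambda>n. A n ** B n) \<longlonglongrightarrow> a ** b"
  unfolding matrix_matrix_mult_def
  by (intro vec_tendstoI) (simp, intro tendsto_intros tendsto_vec_nth assms)

lemma transpose_eqI: "(\<And>i j. A $ i $ j = A $ j $ i) \<Longrightarrow> transpose A = A"
  by (simp add: transpose_def vec_eq_iff)

lemma quad_form_matrix:
  fixes A :: "real^'d^'d"
  shows "v \<bullet> (A *v u) = (\<Sum>i\<in>UNIV. \<Sum>j\<in>UNIV. v $ i * A $ i $ j * u $ j)"
  by (simp add: inner_vec_def matrix_vector_mult_def sum_distrib_left mult.assoc)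

lemma (in noise) even_l1_\<gamma>: "even_l1 \<gamma>"
  by unfold_locales (auto simp: \<gamma>_even \<gamma>_summable)

lemma (in noise) W_lin_comb:
  assumes "\<And>j. supp (w j) \<subseteq> {1..int T}"
  shows "W (\<Sum>j\<in>J. scal (l j) (w j)) \<omega> = (\<Sum>j\<in>J. l j * W (w j) \<omega>)"
proof -
  have "supp (\<Sum>j\<in>J. scal (l j) (w j)) \<subseteq> {1..int T}"
  proof
    fix t assume "t \<in> supp (\<Sum>j\<in>J. scal (l j) (w j))"
    then have "(\<Sum>j\<in>J. l j * coef (w j) t) \<noteq> 0" by (simp add: in_keys_iff lookup_sum coef_scal)
    then obtain j where "coef (w j) t \<noteq> 0" by (auto elim!: sum.not_neutral_contains_not_neutral)
    then show "t \<in> {1..int T}" using assms[of j] by (auto simp: in_keys_iff)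
  qed
  then have "W (\<Sum>j\<in>J. scal (l j) (w j)) \<omega> = (\<Sum>t\<in>{1..int T}. \<Sum>j\<in>J. l j * (coef (w j) t * U t \<omega>))"
    by (subst W_superset) (auto simp: lookup_sum coef_scal sum_distrib_right mult.assoc)
  also have "\<dots> = (\<Sum>j\<in>J. l j * (\<Sum>t\<in>{1..int T}. coef (w j) t * U t \<omega>))"
    by (subst sum.swap) (simp add: sum_distrib_left)
  also have "\<dots> = (\<Sum>j\<in>J. l j * W (w j) \<omega>)"
    using assms by (simp add: W_superset[of "{1..int T}"])
  finally show ?thesis .
qed

lemma (in noise) W_sq_ip:
  assumes "supp v \<subseteq> {1..int T}"
  shows "expectation (\<lambda>\<omega>. (W v \<omega>)\<^sup>2) = ip v (trunc \<gamma> T * v)"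
proof -
  interpret \<gamma>: even_l1 \<gamma> by (rule even_l1_\<gamma>)
  have "\<gamma> (t - s) = \<gamma> (s - t)" for s t using \<gamma>_even[of "s - t"] by simp
  then show ?thesis
    unfolding \<gamma>.ip_trunc_mult[OF assms assms] by (subst W_sq[OF _ assms]) auto
qed

locale gls_clt = noise M E \<theta> \<sigma> + grenander \<eta> m Z w R F K \<mu>
  for M :: "'a measure" and E \<theta> \<sigma> \<eta> m and Z w :: "'d::finite \<Rightarrow> nat \<Rightarrow> laurent" and R F K \<mu> +
  assumes R_inv: "invertible (\<chi> i j. R 0 i j)"
begin

sublocale \<gamma>: even_l1 \<gamma> by (rule even_l1_\<gamma>)

definition At :: "nat \<Rightarrow> real^'d^'d" where "At T = (\<chi> i j. ip (Z i T) (w j T))"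
definition Bt :: "nat \<Rightarrow> real^'d^'d" where "Bt T = (\<chi> i j. ip (w i T) (trunc \<gamma> T * w j T))"
definition Al :: "real^'d^'d" where "Al = lim At"
definition Bl :: "real^'d^'d" where "Bl = lim Bt"
definition Cl :: "real^'d^'d" where "Cl = matrix_inv Al ** Bl ** matrix_inv Al"

text \<open>Gathers limits obtained entry by entry into one matrix, keeping for each entry the
  property \<open>P\<close>, later the integral representation.\<close>

lemma entrywise_limit:
  fixes a :: "'d \<Rightarrow> 'd \<Rightarrow> nat \<Rightarrow> real"
  assumes "\<And>i j. \<exists>l. a i j \<longlonglongrightarrow> l \<and> P i j l"
  defines "L \<equiv> lim (\<lambda>T. \<chi> i j. a i j T) :: real^'d^'d"
  shows "a i j \<longlonglongrightarrow> L $ i $ j" "P i j (L $ i $ j)" "(\<lambda>T. \<chi> i j. a i j T) \<longlonglongrightarrow> L"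
proof -
  have "\<forall>i j. \<exists>l. a i j \<longlonglongrightarrow> l \<and> P i j l" using assms(1) by blast
  then obtain l where "\<forall>i j. a i j \<longlonglongrightarrow> l i j \<and> P i j (l i j)"
    unfolding choice_iff by (elim exE)
  then have l: "a i j \<longlonglongrightarrow> l i j" "P i j (l i j)" for i j by blast+
  have lim: "(\<lambda>T. \<chi> i j. a i j T) \<longlonglongrightarrow> (\<chi> i j. l i j)"
    by (intro vec_tendstoI) (simp add: l)
  then have "L = (\<chi> i j. l i j)" unfolding L_def by (rule limI)
  then show "a i j \<longlonglongrightarrow> L $ i $ j" "P i j (L $ i $ j)" "(\<lambda>T. \<chi> i j. a i j T) \<longlonglongrightarrow> L"
    using l lim by simp_all
qed

lemma
  shows At_entry: "(\<lambda>T. ip (Z i T) (w j T)) \<longlonglongrightarrow> Al $ i $ j"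
    and Al_RS: "has_RS_integral (\<lambda>v. 1 / symb \<eta> v) (F i j) (- pi) pi (of_real (Al $ i $ j))"
    and At_lim: "At \<longlonglongrightarrow> Al"
proof -
  have ex: "\<exists>l. (\<lambda>T. ip (Z i T) (w j T)) \<longlonglongrightarrow> l \<and>
      has_RS_integral (\<lambda>v. 1 / symb \<eta> v) (F i j) (- pi) pi (of_real l)" for i j
    by (rule design_limit) blast
  note lims = entrywise_limit[where a = "\<lambda>i j T. ip (Z i T) (w j T)"
      and P = "\<lambda>i j l. has_RS_integral (\<lambda>v. 1 / symb \<eta> v) (F i j) (- pi) pi (of_real l)", OF ex,
      folded At_def, folded Al_def]
  show "(\<lambda>T. ip (Z i T) (w j T)) \<longlonglongrightarrow> Al $ i $ j" by (rule lims(1))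
  show "has_RS_integral (\<lambda>v. 1 / symb \<eta> v) (F i j) (- pi) pi (of_real (Al $ i $ j))" by (rule lims(2))
  show "At \<longlonglongrightarrow> Al" by (rule lims(3))
qed

lemma
  shows Bt_entry: "(\<lambda>T. ip (w i T) (trunc \<gamma> T * w j T)) \<longlonglongrightarrow> Bl $ i $ j"
    and Bl_RS: "has_RS_integral (\<lambda>v. symb \<gamma> v / (symb \<eta> v)\<^sup>2) (F i j) (- pi) pi (of_real (Bl $ i $ j))"
    and Bt_lim: "Bt \<longlonglongrightarrow> Bl"
proof -
  have ex: "\<exists>l. (\<lambda>T. ip (w i T) (trunc \<gamma> T * w j T)) \<longlonglongrightarrow> l \<and>
      has_RS_integral (\<lambda>v. symb \<gamma> v / (symb \<eta> v)\<^sup>2) (F i j) (- pi) pi (of_real l)" for i j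
    by (rule noise_limit[OF even_l1_\<gamma>]) blast
  note lims = entrywise_limit[where a = "\<lambda>i j T. ip (w i T) (trunc \<gamma> T * w j T)"
      and P = "\<lambda>i j l. has_RS_integral (\<lambda>v. symb \<gamma> v / (symb \<eta> v)\<^sup>2) (F i j) (- pi) pi (of_real l)", OF ex,
      folded Bt_def, folded Bl_def]
  show "(\<lambda>T. ip (w i T) (trunc \<gamma> T * w j T)) \<longlonglongrightarrow> Bl $ i $ j" by (rule lims(1))
  show "has_RS_integral (\<lambda>v. symb \<gamma> v / (symb \<eta> v)\<^sup>2) (F i j) (- pi) pi (of_real (Bl $ i $ j))" by (rule lims(2))
  show "Bt \<longlonglongrightarrow> Bl" by (rule lims(3))
qed

lemma Al_sym: "Al $ i $ j = Al $ j $ i"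
  by (rule LIMSEQ_unique[OF At_entry Lim_transform_eventually[OF At_entry]]) (rule design_sym)

lemma Bl_sym: "Bl $ i $ j = Bl $ j $ i"
proof (rule LIMSEQ_unique[OF Bt_entry])
  have "ip (w i T) (trunc \<gamma> T * w j T) = ip (w j T) (trunc \<gamma> T * w i T)" for T
    by (simp add: ip_commute[of "w i T"] ip_mult_left \<gamma>.adj_trunc)
  then show "(\<lambda>T. ip (w i T) (trunc \<gamma> T * w j T)) \<longlonglongrightarrow> Bl $ j $ i"
    using Bt_entry[of j i] by simp
qed

text \<open>A kernel vector of \<open>Al\<close> annihilates the quadratic form of
  \<open>R(0)\<close> by \<open>design_limit_lower\<close>. Through a square root of
  \<open>R(0)\<close> it then lies in the kernel of \<open>R(0)\<close>, which is trivial.\<close>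

lemma Al_invertible: "invertible Al"
proof -
  let ?R = "\<chi> i j. R 0 i j"
  have R_form: "v \<bullet> (?R *v v) = (\<Sum>i\<in>UNIV. \<Sum>j\<in>UNIV. v $ i * R 0 i j * v $ j)" for v
    by (simp add: quad_form_matrix)
  obtain L :: "real^'d^'d" where L: "L ** transpose L = ?R"
  proof (rule psd_matrix_sqrt)
    show "?R $ i $ j = ?R $ j $ i" for i j using gram_limit_sym[of i j] by simp
    show "0 \<le> v \<bullet> (?R *v v)" for v unfolding R_form by (rule gram_limit_psd)
  qed
  have "v = 0" if v: "Al *v v = 0" for v
  proof -
    have "m / (l1norm \<eta>)\<^sup>2 * (v \<bullet> (?R *v v)) \<le> v \<bullet> (Al *v v)"
      unfolding R_form quad_form_matrix[of v Al] by (rule design_limit_lower[OF At_entry])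
    then have "m / (l1norm \<eta>)\<^sup>2 * (v \<bullet> (?R *v v)) \<le> 0" using v by simp
    moreover have "m / (l1norm \<eta>)\<^sup>2 > 0" using m_pos l1norm_pos by simp
    ultimately have "v \<bullet> (?R *v v) \<le> 0" by (simp only: mult_le_0_iff) linarith
    moreover have "v \<bullet> (?R *v v) = (transpose L *v v) \<bullet> (transpose L *v v)"
      unfolding L[symmetric] by (simp add: dot_lmul_matrix matrix_vector_mul_assoc[symmetric])
    ultimately have "(transpose L *v v) \<bullet> (transpose L *v v) \<le> 0" by linarith
    then have "transpose L *v v = 0" by (metis inner_eq_zero_iff inner_ge_zero order_antisym)
    then have "?R *v v = 0" unfolding L[symmetric] matrix_vector_mul_assoc[symmetric] by simp
    then show "v = 0" using R_inv by (metis inj_matrix_vector_mult inj_eq matrix_vector_mult_0_right)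
  qed
  then show ?thesis
    by (metis invertible_left_inverse matrix_left_invertible_ker)
qed

lemmas At_inv_lim = matrix_inv_tendsto(1)[OF At_lim Al_invertible]
  and At_invertible = matrix_inv_tendsto(2)[OF At_lim Al_invertible]

lemma Al_inv_sym: "transpose (matrix_inv Al) = matrix_inv Al"
proof -
  have "transpose (matrix_inv Al ** Al) = transpose (mat 1)"
    by (simp add: matrix_inv_both(2)[OF Al_invertible])
  then have "Al ** transpose (matrix_inv Al) = mat 1"
    by (simp add: matrix_transpose_mul transpose_eqI[OF Al_sym])
  then show ?thesis by (metis matrix_inv_eqI)
qed

lemma sandwich_lim: "(\<lambda>T. matrix_inv (At T) ** Bt T ** matrix_inv (At T)) \<longlonglongrightarrow> Cl"
  unfolding Cl_def by (intro tendsto_matrix_mult At_inv_lim Bt_lim)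

definition lam :: "real^'d \<Rightarrow> nat \<Rightarrow> real^'d" where
  "lam \<xi> T = transpose (matrix_inv (At T)) *v \<xi>"

text \<open>The weights with which the noise enters the linear combination \<open>\<xi>\<close> of
  the normalised error (\<open>XX_inner\<close>), which turns the multivariate statement into a
  scalar one.\<close>

definition vv :: "real^'d \<Rightarrow> nat \<Rightarrow> laurent" where
  "vv \<xi> T = (\<Sum>j\<in>UNIV. scal (lam \<xi> T $ j) (w j T))"

definition XX :: "nat \<Rightarrow> 'a \<Rightarrow> real^'d" where
  "XX T \<omega> = matrix_inv (At T) *v (\<chi> j. W (w j T) \<omega>)"

lemma supp_vv: "supp (vv \<xi> T) \<subseteq> {1..int T}"
proof
  fix t assume "t \<in> supp (vv \<xi> T)"
  then have "(\<Sum>j\<in>UNIV. lam \<xi> T $ j * coef (w j T) t) \<noteq> 0" by (simp add: in_keys_iff vv_def lookup_sum coef_scal)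
  then obtain j where "coef (w j T) t \<noteq> 0" by (auto elim!: sum.not_neutral_contains_not_neutral)
  then show "t \<in> {1..int T}" using w_supp[of j T] by (auto simp: in_keys_iff)
qed

lemma XX_inner: "\<xi> \<bullet> XX T \<omega> = W (vv \<xi> T) \<omega>"
proof -
  have "\<xi> \<bullet> XX T \<omega> = lam \<xi> T \<bullet> (\<chi> j. W (w j T) \<omega>)"
    unfolding XX_def lam_def by (simp add: dot_lmul_matrix[symmetric])
  then show ?thesis
    unfolding vv_def by (simp add: W_lin_comb[OF w_supp] inner_vec_def)
qed

lemma XX_measurable [measurable]: "XX T \<in> borel_measurable M"
proof -
  have "(\<lambda>\<omega>. XX T \<omega> \<bullet> b) \<in> borel_measurable M" for b
    by (simp add: inner_commute[of _ b] XX_inner)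
  then show ?thesis by (subst borel_measurable_euclidean_space) auto
qed

lemma lam_lim: "(\<lambda>T. lam \<xi> T $ j) \<longlonglongrightarrow> (matrix_inv Al *v \<xi>) $ j"
proof -
  have "(\<lambda>T. lam \<xi> T $ j) \<longlonglongrightarrow> (\<Sum>i\<in>UNIV. matrix_inv Al $ i $ j * \<xi> $ i)"
    unfolding lam_def matrix_vector_mult_def transpose_def
    by (simp, intro tendsto_intros tendsto_vec_nth At_inv_lim)
  moreover have "matrix_inv Al $ i $ j = matrix_inv Al $ j $ i" for i
    using arg_cong[OF Al_inv_sym, of "\<lambda>A. A $ j $ i"] by (simp add: transpose_def)
  ultimately show ?thesis by (simp add: matrix_vector_mult_def)
qed

lemma W_vv_sq_lim: "(\<lambda>T. expectation (\<lambda>\<omega>. (W (vv \<xi> T) \<omega>)\<^sup>2)) \<longlonglongrightarrow> \<xi> \<bullet> (Cl *v \<xi>)"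
proof -
  have "expectation (\<lambda>\<omega>. (W (vv \<xi> T) \<omega>)\<^sup>2) =
    (\<Sum>i\<in>UNIV. \<Sum>j\<in>UNIV. lam \<xi> T $ i * ip (w i T) (trunc \<gamma> T * w j T) * lam \<xi> T $ j)" for T
  proof -
    have "trunc \<gamma> T * vv \<xi> T = (\<Sum>j\<in>UNIV. scal (lam \<xi> T $ j) (trunc \<gamma> T * w j T))"
      by (simp add: vv_def sum_distrib_left mult_ac)
    then show ?thesis
      unfolding W_sq_ip[OF supp_vv] by (simp only: vv_def[of \<xi> T] ip_lin_comb)
  qed
  moreover have "(\<lambda>T. \<Sum>i\<in>UNIV. \<Sum>j\<in>UNIV. lam \<xi> T $ i * ip (w i T) (trunc \<gamma> T * w j T) * lam \<xi> T $ j)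
    \<longlonglongrightarrow> (\<Sum>i\<in>UNIV. \<Sum>j\<in>UNIV. (matrix_inv Al *v \<xi>) $ i * Bl $ i $ j * (matrix_inv Al *v \<xi>) $ j)"
    by (intro tendsto_intros lam_lim Bt_entry)
  moreover have "(\<Sum>i\<in>UNIV. \<Sum>j\<in>UNIV. (matrix_inv Al *v \<xi>) $ i * Bl $ i $ j * (matrix_inv Al *v \<xi>) $ j) = \<xi> \<bullet> (Cl *v \<xi>)"
  proof -
    have "\<xi> \<bullet> (Cl *v \<xi>) = \<xi> \<bullet> (matrix_inv Al *v (Bl *v (matrix_inv Al *v \<xi>)))"
      by (simp add: Cl_def matrix_vector_mul_assoc matrix_mul_assoc)
    also have "\<dots> = (transpose (matrix_inv Al) *v \<xi>) \<bullet> (Bl *v (matrix_inv Al *v \<xi>))"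
      by (simp add: dot_lmul_matrix[symmetric])
    finally show ?thesis by (simp add: Al_inv_sym quad_form_matrix)
  qed
  ultimately show ?thesis by simp
qed

lemma Cl_psd: "0 \<le> \<xi> \<bullet> (Cl *v \<xi>)"
  by (rule LIMSEQ_le_const[OF W_vv_sq_lim]) (auto intro: integral_nonneg_AE)

lemma Cl_sym: "Cl $ i $ j = Cl $ j $ i"
proof -
  have "transpose Cl = Cl"
    unfolding Cl_def by (simp add: matrix_transpose_mul Al_inv_sym transpose_eqI[OF Bl_sym] matrix_mul_assoc)
  from arg_cong[OF this, of "\<lambda>A. A $ j $ i"] show ?thesis by (simp add: transpose_def)
qed

text \<open>The coefficients \<open>lam\<close> converge, so the weights inherit bounded norm and
  vanishing largest entry from the solutions \<open>w\<close>, as \<open>linear_process_clt\<close>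
  demands.\<close>

lemma XX_char: "(\<lambda>T. CLINT \<omega>|M. iexp (\<xi> \<bullet> XX T \<omega>)) \<longlonglongrightarrow> (CLINT z|mvn Cl. iexp (\<xi> \<bullet> z))"
  unfolding XX_inner char_mvn[OF Cl_sym Cl_psd]
proof (rule linear_process_clt[OF _ _ _ W_vv_sq_lim])
  let ?l = "\<lambda>j. \<bar>(matrix_inv Al *v \<xi>) $ j\<bar>"
  have "\<forall>\<^sub>F T in sequentially. \<forall>j. \<bar>lam \<xi> T $ j\<bar> < ?l j + 1"
    by (intro eventually_all_finite order_tendstoD(2)[OF tendsto_rabs[OF lam_lim]]) auto
  moreover have "\<forall>\<^sub>F T in sequentially. \<forall>j. nrm (w j T) \<le> 1 / m + dl 0"
    by (intro eventually_all_finite w_bounded)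
  ultimately show "\<forall>\<^sub>F T in sequentially. nrm (vv \<xi> T) \<le> (\<Sum>j\<in>UNIV. (?l j + 1) * (1 / m + dl 0))"
  proof eventually_elim
    case (elim T)
    have sc: "nrm (scal c a) \<le> \<bar>c\<bar> * nrm a" for c a
      by (rule nrm_mult_le) (simp add: ft_mono1)
    have "nrm (vv \<xi> T) \<le> (\<Sum>j\<in>UNIV. nrm (scal (lam \<xi> T $ j) (w j T)))"
      unfolding vv_def by (rule nrm_sum_le)
    also have "\<dots> \<le> (\<Sum>j\<in>UNIV. (?l j + 1) * (1 / m + dl 0))"
    proof (rule sum_mono)
      fix j
      have "nrm (scal (lam \<xi> T $ j) (w j T)) \<le> \<bar>lam \<xi> T $ j\<bar> * nrm (w j T)" by (rule sc)
      also have "\<dots> \<le> (?l j + 1) * (1 / m + dl 0)"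
        using elim(1)[rule_format, of j] elim(2) by (intro mult_mono) auto
      finally show "nrm (scal (lam \<xi> T $ j) (w j T)) \<le> (?l j + 1) * (1 / m + dl 0)" .
    qed
    finally show ?case .
  qed
  let ?m = "\<lambda>T. \<Sum>j\<in>UNIV. \<bar>lam \<xi> T $ j\<bar> * mxc (w j T)"
  have "?m \<longlonglongrightarrow> (\<Sum>j\<in>UNIV. ?l j * 0)"
    by (intro tendsto_intros lam_lim mxc_w_tendsto)
  then show "?m \<longlonglongrightarrow> 0" by simp
  have "\<bar>coef (vv \<xi> T) s\<bar> \<le> ?m T" for T s
    unfolding vv_def lookup_sum coef_scal
    by (rule order_trans[OF sum_abs]) (auto simp: abs_mult intro!: sum_mono mult_left_mono mxc_ge)
  then show "\<forall>\<^sub>F T in sequentially. \<forall>s. \<bar>coef (vv \<xi> T) s\<bar> \<le> ?m T" by simp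
qed

text \<open>Markov's inequality: the second moment of the norm is the sum of the variances along the
  axes, which converges. The level \<open>k\<close> turns the bound \<open>?D\<close> into
  \<open>e\<close>.\<close>

lemma XX_tight:
  assumes "e > 0"
  shows "\<exists>k. \<forall>\<^sub>F T in sequentially. measure M {\<omega> \<in> space M. k < norm (XX T \<omega>)} \<le> e"
proof -
  let ?c = "\<lambda>T. \<Sum>i\<in>UNIV. expectation (\<lambda>\<omega>. (W (vv (axis i 1) T) \<omega>)\<^sup>2)"
  let ?D = "(\<Sum>i\<in>UNIV. axis i 1 \<bullet> (Cl *v axis i 1)) + 1"
  have nn: "norm (XX T \<omega>) ^ 2 = (\<Sum>i\<in>UNIV. (W (vv (axis i 1) T) \<omega>)\<^sup>2)" for T \<omega>
  proof -
    have "norm (XX T \<omega>) ^ 2 = (\<Sum>i\<in>UNIV. (XX T \<omega> $ i)\<^sup>2)"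
      unfolding power2_norm_eq_inner inner_vec_def by (simp add: power2_eq_square)
    then show ?thesis by (simp add: inner_axis' flip: XX_inner)
  qed
  have int: "integrable M (\<lambda>\<omega>. norm (XX T \<omega>) ^ 2)" for T
    unfolding nn by (intro Bochner_Integration.integrable_sum W_sq_integrable)
  have ex: "expectation (\<lambda>\<omega>. norm (XX T \<omega>) ^ 2) = ?c T" for T
    unfolding nn by (intro Bochner_Integration.integral_sum W_sq_integrable)
  have "?c \<longlonglongrightarrow> (\<Sum>i\<in>UNIV. axis i 1 \<bullet> (Cl *v axis i 1))"
    by (intro tendsto_sum W_vv_sq_lim)
  then have ev: "\<forall>\<^sub>F T in sequentially. ?c T < ?D" by (rule order_tendstoD(2)) simp
  have D: "?D > 0" by (intro add_nonneg_pos sum_nonneg Cl_psd) simp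
  define k where "k = sqrt (?D / e)"
  have k: "k > 0" "k\<^sup>2 = ?D / e" using D assms by (auto simp: k_def intro!: divide_nonneg_pos less_imp_le)
  show ?thesis
  proof (intro exI[of _ k])
    show "\<forall>\<^sub>F T in sequentially. measure M {\<omega> \<in> space M. k < norm (XX T \<omega>)} \<le> e"
      using ev
    proof eventually_elim
      case (elim T)
      have "measure M {\<omega> \<in> space M. k < norm (XX T \<omega>)} \<le> measure M {\<omega> \<in> space M. k\<^sup>2 \<le> norm (XX T \<omega>) ^ 2}"
        using k(1) by (intro finite_measure_mono) (auto intro: power_mono)
      also have "\<dots> \<le> expectation (\<lambda>\<omega>. norm (XX T \<omega>) ^ 2) / k\<^sup>2"
        using k(1) by (intro integral_Markov_inequality_measure[OF int, where A = "{}"]) auto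
      also have "\<dots> \<le> ?D / k\<^sup>2" unfolding ex using elim by (intro divide_right_mono) auto
      also have "\<dots> = e" unfolding k(2) using D by simp
      finally show ?case .
    qed
  qed
qed

lemma XX_conv: "conv_in_law M XX (mvn Cl)"
  by (rule conv_in_lawI[OF prob_space_axioms XX_measurable prob_space_mvn sets_mvn XX_char XX_tight])

end

section \<open>From the estimator to Laurent polynomials\<close>

lemma sum_int_shift: "(\<Sum>k\<in>{1..int T}. f k) = (\<Sum>t=1..T. f (int t))"
  using sum.atLeast_int_atMost_int_shift[of f 1 T] by (simp add: o_def)

context pos_symbol
begin

lemma \<eta>_abs: "\<eta> \<bar>i\<bar> = \<eta> i"
  using even_c[of i] by (simp add: abs_if)

text \<open>A vector indexed by \<open>{1..T}\<close> becomes a polynomial, and coercivity applies.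
  The size condition holds for all large \<open>T\<close>, so the inverse is controlled only
  eventually.\<close>

lemma toeplitz_pd:
  assumes "l1tail \<eta> T \<le> m" "\<exists>s\<in>{1..T}. v s \<noteq> 0"
  shows "0 < (\<Sum>s=1..T. v s * (\<Sum>t=1..T. \<eta> \<bar>int s - int t\<bar> * v t))"
proof -
  define a where "a = restr {1..int T} (\<lambda>k. v (nat k))"
  have c: "coef a (int t) = v t" if "t \<in> {1..T}" for t
    using that by (simp add: a_def coef_restr)
  have s: "supp a \<subseteq> {1..int T}" by (simp add: a_def supp_restr)
  obtain t where t: "t \<in> {1..T}" "v t \<noteq> 0" using assms(2) by blast
  then have "a \<noteq> 0" using c[OF t(1)] by auto
  then have "nrm a \<noteq> 0" using nrm_eq_0D by blast
  then have "0 < m * (nrm a)\<^sup>2" using m_pos by simp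
  also have "\<dots> \<le> ip a (trunc \<eta> T * a)"
    by (intro ip_mult_self_ge Re_ft_trunc_ge assms)
  also have "\<dots> = (\<Sum>s=1..T. \<Sum>t=1..T. coef a (int s) * \<eta> (int s - int t) * coef a (int t))"
    unfolding ip_trunc_mult[OF s s] sum_int_shift ..
  also have "\<dots> = (\<Sum>s=1..T. v s * (\<Sum>t=1..T. \<eta> \<bar>int s - int t\<bar> * v t))"
    unfolding sum_distrib_left by (intro sum.cong refl) (simp add: c \<eta>_abs)
  finally show ?thesis .
qed

lemma toeplitz_sym: "\<eta> \<bar>int s - int t\<bar> = \<eta> \<bar>int t - int s\<bar>"
  by (simp add: abs_minus_commute)

lemma toep_inv_right:
  assumes "l1tail \<eta> T \<le> m" "s \<in> {1..T}" "t \<in> {1..T}"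
  shows "(\<Sum>k=1..T. \<eta> (int s - int k) * toep_inv \<eta> T k t) = (if s = t then 1 else 0)"
  using sq_inv_pd(1)[of "\<lambda>p q. \<eta> \<bar>int p - int q\<bar>" T s t, OF toeplitz_sym toeplitz_pd[OF assms(1)] assms(2,3)]
  unfolding toep_inv_def \<eta>_abs .

lemma toep_inv_sym:
  assumes "l1tail \<eta> T \<le> m" "s \<in> {1..T}" "t \<in> {1..T}"
  shows "toep_inv \<eta> T s t = toep_inv \<eta> T t s"
  using sq_inv_pd(2)[of "\<lambda>p q. \<eta> \<bar>int p - int q\<bar>" T s t, OF toeplitz_sym toeplitz_pd[OF assms(1)] assms(2,3)]
  unfolding toep_inv_def .

end

definition zreg :: "(nat \<Rightarrow> real^'d) \<Rightarrow> 'd \<Rightarrow> nat \<Rightarrow> laurent" where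
  "zreg x i T = restr {1..int T} (\<lambda>t. x (nat t) $ i / s_norm x T i)"

text \<open>The columns of the inverse Toeplitz matrix applied to the normalised design, as
  polynomials; \<open>wreg_eq\<close> states the equation they solve.\<close>

definition wreg :: "(nat \<Rightarrow> real^'d) \<Rightarrow> (int \<Rightarrow> real) \<Rightarrow> 'd \<Rightarrow> nat \<Rightarrow> laurent" where
  "wreg x \<eta> i T = restr {1..int T} (\<lambda>t. \<Sum>q=1..T. toep_inv \<eta> T (nat t) q * (x q $ i / s_norm x T i))"

lemma supp_zreg: "supp (zreg x i T) \<subseteq> {1..int T}" and supp_wreg: "supp (wreg x \<eta> i T) \<subseteq> {1..int T}"
  by (simp_all add: zreg_def wreg_def supp_restr)

lemma coef_zreg: "t \<in> {1..T} \<Longrightarrow> coef (zreg x i T) (int t) = x t $ i / s_norm x T i"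
  by (simp add: zreg_def coef_restr)

lemma coef_wreg:
  "t \<in> {1..T} \<Longrightarrow> coef (wreg x \<eta> i T) (int t) = (\<Sum>q=1..T. toep_inv \<eta> T t q * (x q $ i / s_norm x T i))"
  by (simp add: wreg_def coef_restr)

lemma s_norm_sq: "(s_norm x T i)\<^sup>2 = (\<Sum>t=1..T. (x t $ i)\<^sup>2)"
  by (simp add: s_norm_def sum_nonneg)

lemma s_norm_nonneg: "0 \<le> s_norm x T i"
  by (simp add: s_norm_def sum_nonneg)

text \<open>The norm is 1 unless the regressor vanishes up to time \<open>T\<close>; then division
  by zero yields the zero polynomial.\<close>

lemma nrm_zreg: "nrm (zreg x i T) \<le> 1"
proof -
  have "(nrm (zreg x i T))\<^sup>2 = (\<Sum>t=1..T. coef (zreg x i T) (int t) * coef (zreg x i T) (int t))"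
    unfolding nrm_sq ip_eq_sum[OF finite_atLeastAtMost_int disjI1[OF supp_zreg]] sum_int_shift ..
  also have "\<dots> = (\<Sum>t=1..T. (x t $ i)\<^sup>2 / (s_norm x T i)\<^sup>2)"
    by (intro sum.cong refl) (simp add: coef_zreg power2_eq_square)
  also have "\<dots> = (s_norm x T i)\<^sup>2 / (s_norm x T i)\<^sup>2"
    by (simp only: sum_divide_distrib[symmetric] s_norm_sq)
  also have "\<dots> \<le> 1\<^sup>2" by simp
  finally show ?thesis by (rule power2_le_imp_le) simp
qed

text \<open>The second Grenander condition speaks of the last entry only. Monotonicity of
  \<open>s_norm\<close> in \<open>T\<close> extends it to all late entries, and the first condition
  makes the finitely many early ones negligible.\<close>

lemma mxc_zreg_tendsto:
  assumes G1: "filterlim (\<lambda>T. (s_norm x T i)\<^sup>2) at_top sequentially"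
    and G2: "(\<lambda>T. (x T $ i)\<^sup>2 / (s_norm x T i)\<^sup>2) \<longlonglongrightarrow> 0"
  shows "(\<lambda>T. mxc (zreg x i T)) \<longlonglongrightarrow> 0"
proof (rule tendstoI)
  fix e :: real assume e: "e > 0"
  define r where "r = e / 2"
  have r: "r > 0" using e by (simp add: r_def)
  have "\<forall>\<^sub>F T in sequentially. (x T $ i)\<^sup>2 / (s_norm x T i)\<^sup>2 < r\<^sup>2"
    using r by (intro order_tendstoD(2)[OF G2]) simp
  moreover have "\<forall>\<^sub>F T in sequentially. (s_norm x T i)\<^sup>2 > 0"
    using G1 by (simp only: filterlim_at_top_dense)
  ultimately have "\<forall>\<^sub>F T in sequentially. (x T $ i)\<^sup>2 / (s_norm x T i)\<^sup>2 < r\<^sup>2 \<and> (s_norm x T i)\<^sup>2 > 0"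
    by (rule eventually_conj)
  then obtain N where N: "\<And>t. t \<ge> N \<Longrightarrow> (x t $ i)\<^sup>2 / (s_norm x t i)\<^sup>2 < r\<^sup>2 \<and> (s_norm x t i)\<^sup>2 > 0"
    by (auto simp: eventually_sequentially)
  \<comment> \<open>Bounds the squares of all entries before \<open>N\<close> at once.\<close>
  define C where "C = (\<Sum>t<N. (x t $ i)\<^sup>2)"
  have "\<forall>\<^sub>F T in sequentially. (s_norm x T i)\<^sup>2 > C / r\<^sup>2"
    using G1 by (simp only: filterlim_at_top_dense)
  moreover have "\<forall>\<^sub>F T in sequentially. (s_norm x T i)\<^sup>2 > 0"
    using G1 by (simp only: filterlim_at_top_dense)
  ultimately show "\<forall>\<^sub>F T in sequentially. dist (mxc (zreg x i T)) 0 < e"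
  proof eventually_elim
    case (elim T)
    have sq: "(x t $ i)\<^sup>2 \<le> r\<^sup>2 * (s_norm x T i)\<^sup>2" if t: "t \<in> {1..T}" for t
    proof (cases "t \<ge> N")
      case True
      then have "(x t $ i)\<^sup>2 \<le> r\<^sup>2 * (s_norm x t i)\<^sup>2"
        using N[OF True] less_imp_le pos_divide_less_eq by blast
      also have "\<dots> \<le> r\<^sup>2 * (s_norm x T i)\<^sup>2"
        unfolding s_norm_sq using t by (intro mult_left_mono sum_mono2) auto
      finally show ?thesis .
    next
      case False
      then have "(x t $ i)\<^sup>2 \<le> C" unfolding C_def by (intro member_le_sum) auto
      also have "\<dots> \<le> r\<^sup>2 * (s_norm x T i)\<^sup>2"
        using elim(1) r by (simp add: pos_divide_less_eq mult.commute)
      finally show ?thesis .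
    qed
    have "\<bar>coef (zreg x i T) k\<bar> \<le> r" for k
    proof (cases "k \<in> {1..int T}")
      case True
      then obtain t where t: "k = int t" "t \<in> {1..T}"
        by (metis atLeastAtMost_iff int_one_le_iff_zero_less nat_0_le of_nat_1 of_nat_le_iff order_trans zero_le_one)
      have "\<bar>x t $ i\<bar> \<le> r * s_norm x T i"
        by (rule power2_le_imp_le) (use sq[OF t(2)] r s_norm_nonneg[of x T i] in \<open>auto simp: power_mult_distrib\<close>)
      moreover have "s_norm x T i > 0" using elim(2) s_norm_nonneg[of x T i] by (simp add: less_le)
      ultimately show ?thesis using t by (simp add: coef_zreg abs_divide pos_divide_le_eq)
    next
      case False
      then show ?thesis using r by (auto simp: zreg_def coef_restr)
    qed
    then have "mxc (zreg x i T) \<le> r" by (rule mxc_le)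
    then show ?case using mxc_nonneg[of "zreg x i T"] e by (simp add: r_def)
  qed
qed

lemma ip_zreg_shift: "ip (zreg x i T) (mono1 (- int n) 1 * zreg x j T) = rho_pos x i j n T"
proof -
  have "ip (zreg x i T) (mono1 (- int n) 1 * zreg x j T) =
    (\<Sum>t=1..T. coef (zreg x i T) (int t) * coef (zreg x j T) (int (t + n)))"
    unfolding ip_eq_sum[OF finite_atLeastAtMost_int disjI1[OF supp_zreg]] sum_int_shift coef_mono1_mult
    by simp
  also have "\<dots> = (\<Sum>t=1..T - n. coef (zreg x i T) (int t) * coef (zreg x j T) (int (t + n)))"
    by (intro sum.mono_neutral_right) (auto simp: zreg_def coef_restr)
  also have "\<dots> = (\<Sum>t=1..T - n. x t $ i * x (t + n) $ j / (s_norm x T i * s_norm x T j))"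
    by (intro sum.cong refl) (auto simp: coef_zreg simp del: of_nat_add)
  finally show ?thesis by (simp add: rho_pos_def sum_divide_distrib)
qed

lemma ip_zreg_tendsto:
  assumes "\<And>i j k. convergent (rho_pos x i j k)"
  shows "(\<lambda>T. ip (zreg x i T) (mono1 (- k) 1 * zreg x j T)) \<longlonglongrightarrow> R_mat x k $ i $ j"
proof -
  have lim: "rho_pos x i j n \<longlonglongrightarrow> lim (rho_pos x i j n)" for i j n
    using assms by (simp add: convergent_LIMSEQ_iff)
  show ?thesis
  proof (cases "k \<ge> 0")
    case True
    then have "ip (zreg x i T) (mono1 (- k) 1 * zreg x j T) = rho_pos x i j (nat k) T" for T
      using ip_zreg_shift[of x i T "nat k" j] by simp
    with True lim show ?thesis by (simp add: R_mat_def grenander_rho_def)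
  next
    case False
    have "ip (zreg x i T) (mono1 (- k) 1 * zreg x j T) = rho_pos x j i (nat (- k)) T" for T
    proof -
      have "ip (zreg x i T) (mono1 (- k) 1 * zreg x j T) = ip (zreg x j T) (mono1 k 1 * zreg x i T)"
        by (simp add: ip_commute[of "zreg x i T"] ip_mult_left adj_mono1)
      then show ?thesis using ip_zreg_shift[of x j T "nat (- k)" i] False by simp
    qed
    with False lim show ?thesis by (simp add: R_mat_def grenander_rho_def)
  qed
qed

lemma (in pos_symbol) wreg_eq:
  assumes T: "l1tail \<eta> T \<le> m" and t: "t \<in> {1..int T}"
  shows "coef (trunc \<eta> T * wreg x \<eta> i T) t = coef (zreg x i T) t"
proof -
  define p where "p = nat t"
  have p: "t = int p" "p \<in> {1..T}" using t by (auto simp: p_def)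
  let ?z = "\<lambda>r. x r $ i / s_norm x T i"
  have "coef (trunc \<eta> T * wreg x \<eta> i T) t = (\<Sum>q=1..T. \<eta> (int p - int q) * coef (wreg x \<eta> i T) (int q))"
    by (simp only: coef_trunc_mult[OF supp_wreg t] sum_int_shift p(1)[symmetric])
  also have "\<dots> = (\<Sum>q=1..T. \<Sum>r=1..T. \<eta> (int p - int q) * toep_inv \<eta> T q r * ?z r)"
    by (intro sum.cong refl) (simp add: coef_wreg sum_distrib_left mult.assoc)
  also have "\<dots> = (\<Sum>r=1..T. (\<Sum>q=1..T. \<eta> (int p - int q) * toep_inv \<eta> T q r) * ?z r)"
    by (subst sum.swap) (simp only: sum_distrib_right)
  also have "\<dots> = (\<Sum>r=1..T. (if p = r then 1 else 0) * ?z r)"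
    using p(2) by (intro sum.cong refl) (simp only: toep_inv_right[OF T])
  also have "\<dots> = (\<Sum>r=1..T. if p = r then ?z r else 0)" by (intro sum.cong refl) simp
  also have "\<dots> = ?z p" by (subst sum.delta') (use p(2) in auto)
  finally show ?thesis using p by (simp add: coef_zreg)
qed

lemma design_entry:
  "(\<Sum>p=1..T. \<Sum>q=1..T. z_row x T p $ i * toep_inv \<eta> T p q * z_row x T q $ j) = ip (zreg x i T) (wreg x \<eta> j T)"
proof -
  have "ip (zreg x i T) (wreg x \<eta> j T) = (\<Sum>p=1..T. coef (zreg x i T) (int p) * coef (wreg x \<eta> j T) (int p))"
    unfolding ip_eq_sum[OF finite_atLeastAtMost_int disjI1[OF supp_zreg]] sum_int_shift ..
  also have "\<dots> = (\<Sum>p=1..T. \<Sum>q=1..T. z_row x T p $ i * toep_inv \<eta> T p q * z_row x T q $ j)"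
    by (intro sum.cong refl) (simp add: coef_zreg coef_wreg z_row_def sum_distrib_left mult.assoc)
  finally show ?thesis ..
qed

lemma noise_entry:
  assumes "even_l1 c" and sym: "\<And>p q. p \<in> {1..T} \<Longrightarrow> q \<in> {1..T} \<Longrightarrow> toep_inv \<eta> T p q = toep_inv \<eta> T q p"
  shows "(\<Sum>p=1..T. \<Sum>q=1..T. \<Sum>r=1..T. \<Sum>w=1..T.
      z_row x T p $ i * toep_inv \<eta> T p q * c (int r - int q) * toep_inv \<eta> T r w * z_row x T w $ j)
    = ip (wreg x \<eta> i T) (trunc c T * wreg x \<eta> j T)"
proof -
  interpret even_l1 c by fact
  have c: "c (int q - int r) = c (int r - int q)" for q r using even_c[of "int q - int r"] by simp
  have wi: "coef (wreg x \<eta> i T) (int q) = (\<Sum>p=1..T. z_row x T p $ i * toep_inv \<eta> T p q)" if "q \<in> {1..T}" for q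
    unfolding coef_wreg[OF that] using sym[OF _ that] by (intro sum.cong refl) (simp add: z_row_def)
  have wj: "coef (wreg x \<eta> j T) (int r) = (\<Sum>w=1..T. toep_inv \<eta> T r w * z_row x T w $ j)" if "r \<in> {1..T}" for r
    unfolding coef_wreg[OF that] by (simp add: z_row_def)
  have "ip (wreg x \<eta> i T) (trunc c T * wreg x \<eta> j T) =
    (\<Sum>q=1..T. \<Sum>r=1..T. coef (wreg x \<eta> i T) (int q) * c (int q - int r) * coef (wreg x \<eta> j T) (int r))"
    unfolding ip_trunc_mult[OF supp_wreg supp_wreg] sum_int_shift ..
  also have "\<dots> = (\<Sum>q=1..T. \<Sum>p=1..T. z_row x T p $ i * toep_inv \<eta> T p q *
      (\<Sum>r=1..T. c (int r - int q) * (\<Sum>w=1..T. toep_inv \<eta> T r w * z_row x T w $ j)))"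
  proof (rule sum.cong[OF refl])
    fix q assume q: "q \<in> {1..T}"
    have "(\<Sum>r=1..T. coef (wreg x \<eta> i T) (int q) * c (int q - int r) * coef (wreg x \<eta> j T) (int r)) =
      coef (wreg x \<eta> i T) (int q) * (\<Sum>r=1..T. c (int r - int q) * (\<Sum>w=1..T. toep_inv \<eta> T r w * z_row x T w $ j))"
      unfolding sum_distrib_left[of "coef (wreg x \<eta> i T) (int q)"]
      by (intro sum.cong refl) (simp only: wj c mult.assoc)
    then show "(\<Sum>r=1..T. coef (wreg x \<eta> i T) (int q) * c (int q - int r) * coef (wreg x \<eta> j T) (int r)) =
      (\<Sum>p=1..T. z_row x T p $ i * toep_inv \<eta> T p q *
      (\<Sum>r=1..T. c (int r - int q) * (\<Sum>w=1..T. toep_inv \<eta> T r w * z_row x T w $ j)))"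
      by (simp only: wi[OF q] sum_distrib_right)
  qed
  also have "\<dots> = (\<Sum>p=1..T. \<Sum>q=1..T. \<Sum>r=1..T. \<Sum>w=1..T.
      z_row x T p $ i * toep_inv \<eta> T p q * c (int r - int q) * toep_inv \<eta> T r w * z_row x T w $ j)"
    by (subst sum.swap) (simp only: sum_distrib_left mult.assoc)
  finally show ?thesis ..
qed

text \<open>The signal part of the observations is reproduced exactly. What remains is the inverse
  of the unnormalised design form, \<open>Q = S A S\<close>, applied to the noise; the outer scaling
  by \<open>s_norm\<close> leaves only the inverse of \<open>A\<close>.\<close>

lemma gls_error_eq:
  fixes x :: "nat \<Rightarrow> real^'d" and \<eta> :: "int \<Rightarrow> real" and T :: nat
  defines "A \<equiv> \<chi> i j. ip (zreg x i T) (wreg x \<eta> j T)"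
  assumes s: "\<And>i. s_norm x T i \<noteq> 0" and inv: "invertible A"
    and sym: "\<And>p q. p \<in> {1..T} \<Longrightarrow> q \<in> {1..T} \<Longrightarrow> toep_inv \<eta> T p q = toep_inv \<eta> T q p"
  shows "(\<chi> i. s_norm x T i * (gls_est x \<eta> (\<lambda>t. x t \<bullet> b + u t) T $ i - b $ i)) =
    matrix_inv A *v (\<chi> j. \<Sum>q=1..T. coef (wreg x \<eta> j T) (int q) * u q)"
proof -
  define V where "V = matrix_inv A"
  have AV: "A ** V = mat 1" unfolding V_def by (rule matrix_inv_both(1)[OF inv])
  let ?s = "s_norm x T" and ?L = "toep_inv \<eta> T"
  define Q where "Q = (\<chi> i j. \<Sum>p=1..T. \<Sum>q=1..T. x p $ i * ?L p q * x q $ j)"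
  define c where "c i = (\<Sum>q=1..T. coef (wreg x \<eta> i T) (int q) * u q)" for i
  have Qe: "Q $ i $ j = ?s i * A $ i $ j * ?s j" for i j
  proof -
    have "?s i * A $ i $ j * ?s j = (\<Sum>p=1..T. \<Sum>q=1..T. ?s i * (z_row x T p $ i * ?L p q * z_row x T q $ j) * ?s j)"
      unfolding A_def design_entry[symmetric] by (simp only: vec_lambda_beta sum_distrib_left sum_distrib_right)
    also have "\<dots> = Q $ i $ j"
      unfolding Q_def using s by (auto simp: z_row_def intro!: sum.cong)
    finally show ?thesis ..
  qed
  have xs: "(\<Sum>p=1..T. x p $ i * ?L p q) = ?s i * coef (wreg x \<eta> i T) (int q)" if q: "q \<in> {1..T}" for i q
    unfolding coef_wreg[OF q] sum_distrib_left using s sym[OF _ q] by (intro sum.cong refl) simp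
  \<comment> \<open>The candidate inverse of \<open>S A S\<close>, namely the inverse of
    \<open>A\<close> with the scaling undone on both sides.\<close>
  define Qi where "Qi = (\<chi> i j. V $ i $ j / (?s i * ?s j))"
  have "Q ** Qi = mat 1"
  proof -
    have "(\<Sum>k\<in>UNIV. Q $ i $ k * Qi $ k $ j) = (if i = j then 1 else 0)" for i j
    proof -
      have "(\<Sum>k\<in>UNIV. Q $ i $ k * Qi $ k $ j) = (\<Sum>k\<in>UNIV. (?s i / ?s j) * (A $ i $ k * V $ k $ j))"
        using s by (intro sum.cong refl) (simp add: Qe Qi_def)
      also have "\<dots> = (?s i / ?s j) * (A ** V) $ i $ j"
        by (simp add: matrix_matrix_mult_def sum_distrib_left)
      finally show ?thesis using s by (simp add: AV mat_def)
    qed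
    then show ?thesis by (simp add: vec_eq_iff matrix_matrix_mult_def mat_def)
  qed
  then have mQ: "matrix_inv Q = Qi" and QiQ: "Qi ** Q = mat 1"
    by (auto simp: matrix_inv_eqI matrix_left_right_inverse)
  have rhs: "(\<chi> i. \<Sum>p=1..T. \<Sum>q=1..T. x p $ i * ?L p q * (x q \<bullet> b + u q)) = Q *v b + (\<chi> i. ?s i * c i)"
  proof -
    have "(\<Sum>p=1..T. \<Sum>q=1..T. x p $ i * ?L p q * (x q \<bullet> b + u q)) = (Q *v b) $ i + ?s i * c i" for i
    proof -
      have "(\<Sum>p=1..T. \<Sum>q=1..T. x p $ i * ?L p q * (x q \<bullet> b)) = (\<Sum>p=1..T. \<Sum>j\<in>UNIV. \<Sum>q=1..T. x p $ i * ?L p q * x q $ j * b $ j)"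
        by (simp add: inner_vec_def sum_distrib_left mult.assoc sum.swap[of _ UNIV])
      also have "\<dots> = (\<Sum>j\<in>UNIV. \<Sum>p=1..T. \<Sum>q=1..T. x p $ i * ?L p q * x q $ j * b $ j)"
        by (rule sum.swap)
      also have "\<dots> = (Q *v b) $ i"
        by (simp add: Q_def matrix_vector_mult_def sum_distrib_right)
      finally have 1: "(\<Sum>p=1..T. \<Sum>q=1..T. x p $ i * ?L p q * (x q \<bullet> b)) = (Q *v b) $ i" .
      have "(\<Sum>p=1..T. \<Sum>q=1..T. x p $ i * ?L p q * u q) = (\<Sum>q=1..T. (\<Sum>p=1..T. x p $ i * ?L p q) * u q)"
        by (subst sum.swap) (simp add: sum_distrib_right)
      also have "\<dots> = (\<Sum>q=1..T. ?s i * coef (wreg x \<eta> i T) (int q) * u q)"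
        by (intro sum.cong refl) (simp only: xs)
      also have "\<dots> = ?s i * c i" by (simp add: c_def sum_distrib_left mult.assoc)
      finally show ?thesis using 1 by (simp add: distrib_left sum.distrib)
    qed
    then show ?thesis by (simp add: vec_eq_iff)
  qed
  have "gls_est x \<eta> (\<lambda>t. x t \<bullet> b + u t) T = Qi *v (Q *v b + (\<chi> i. ?s i * c i))"
    unfolding gls_est_def rhs Q_def[symmetric] mQ ..
  also have "\<dots> = b + Qi *v (\<chi> i. ?s i * c i)"
    by (simp add: matrix_vector_right_distrib matrix_vector_mul_assoc QiQ)
  finally have g: "gls_est x \<eta> (\<lambda>t. x t \<bullet> b + u t) T = b + Qi *v (\<chi> i. ?s i * c i)" .
  have "?s i * (Qi *v (\<chi> i. ?s i * c i)) $ i = (V *v (\<chi> j. c j)) $ i" for i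
  proof -
    have "?s i * (Qi *v (\<chi> i. ?s i * c i)) $ i = (\<Sum>j\<in>UNIV. ?s i * (Qi $ i $ j * (?s j * c j)))"
      by (simp add: matrix_vector_mult_def sum_distrib_left)
    also have "\<dots> = (\<Sum>j\<in>UNIV. V $ i $ j * c j)"
      using s by (intro sum.cong refl) (simp add: Qi_def)
    finally show ?thesis by (simp add: matrix_vector_mult_def)
  qed
  then show ?thesis unfolding g by (simp add: vec_eq_iff V_def[symmetric] c_def)
qed

section \<open>The spectral form of the covariance\<close>

text \<open>As \<open>spec_dens\<close> is \<open>symb\<close> divided by \<open>2 * pi\<close>,
  both integrals carry one factor \<open>2 * pi\<close>. The two inverses contribute its inverse
  twice, and the prefactor in \<open>spectral_cov\<close> restores the balance.\<close>

lemma spectral_cov_eqI: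
  fixes A B :: "real^'d^'d"
  assumes A: "\<And>i j. has_RS_integral (\<lambda>w. 1 / symb \<eta> w) (\<lambda>w. H w $ i $ j) (- pi) pi (of_real (A $ i $ j))"
    and B: "\<And>i j. has_RS_integral (\<lambda>w. symb c w / (symb \<eta> w)\<^sup>2) (\<lambda>w. H w $ i $ j) (- pi) pi (of_real (B $ i $ j))"
    and inv: "invertible A"
  shows "spectral_cov H (spec_dens \<eta>) (spec_dens c) =
    (\<chi> i j. complex_of_real ((matrix_inv A ** B ** matrix_inv A) $ i $ j))"
proof -
  define V where "V = matrix_inv A"
  let ?p = "2 * pi"
  have mat: "RS_integral_mat g H (- pi) pi = (\<chi> i j. complex_of_real (?p * X $ i $ j))"
    if "\<And>i j. has_RS_integral f (\<lambda>w. H w $ i $ j) (- pi) pi (of_real (X $ i $ j))" "g = (\<lambda>w. of_real ?p * f w)"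
    for f g and X :: "real^'d^'d"
    using RS_integral_eq[OF _ has_RS_integral_cmult[OF that(1), of "of_real ?p"]]
    by (simp add: RS_integral_mat_def that(2))
  have Hv: "RS_integral_mat (\<lambda>w. 1 / spec_dens \<eta> w) H (- pi) pi = (\<chi> i j. complex_of_real (?p * A $ i $ j))"
    by (rule mat[OF A]) (simp add: spec_dens_symb)
  have Hu: "RS_integral_mat (\<lambda>w. spec_dens c w / (spec_dens \<eta> w)\<^sup>2) H (- pi) pi = (\<chi> i j. complex_of_real (?p * B $ i $ j))"
    by (rule mat[OF B]) (simp add: spec_dens_symb power2_eq_square mult.assoc)
  have Vinv: "matrix_inv (\<chi> i j. complex_of_real (?p * A $ i $ j)) = (\<chi> i j. complex_of_real (V $ i $ j / ?p))"
  proof (rule matrix_inv_eqI)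
    have "(\<Sum>k\<in>UNIV. complex_of_real (?p * A $ i $ k) * complex_of_real (V $ k $ j / ?p)) = (if i = j then 1 else 0)" for i j
    proof -
      have "(\<Sum>k\<in>UNIV. complex_of_real (?p * A $ i $ k) * complex_of_real (V $ k $ j / ?p)) =
        complex_of_real (\<Sum>k\<in>UNIV. A $ i $ k * V $ k $ j)"
        by simp
      also have "(\<Sum>k\<in>UNIV. A $ i $ k * V $ k $ j) = (A ** V) $ i $ j"
        by (simp add: matrix_matrix_mult_def)
      finally show ?thesis unfolding V_def matrix_inv_both(1)[OF inv] by (simp add: mat_def)
    qed
    then show "(\<chi> i j. complex_of_real (?p * A $ i $ j)) ** (\<chi> i j. complex_of_real (V $ i $ j / ?p)) = mat 1"
      by (simp add: vec_eq_iff matrix_matrix_mult_def mat_def)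
  qed
  have "spectral_cov H (spec_dens \<eta>) (spec_dens c) $ i $ j = complex_of_real ((V ** B ** V) $ i $ j)" for i j
  proof -
    have "spectral_cov H (spec_dens \<eta>) (spec_dens c) $ i $ j = of_real ?p *
      (\<Sum>k\<in>UNIV. (\<Sum>l\<in>UNIV. complex_of_real (V $ i $ l / ?p) * complex_of_real (?p * B $ l $ k)) * complex_of_real (V $ k $ j / ?p))"
      unfolding spectral_cov_def Let_def Hv Hu Vinv by (simp add: matrix_matrix_mult_def)
    also have "\<dots> = complex_of_real (\<Sum>k\<in>UNIV. ?p * ((\<Sum>l\<in>UNIV. (V $ i $ l / ?p) * (?p * B $ l $ k)) * (V $ k $ j / ?p)))"
      by (simp only: of_real_mult of_real_sum sum_distrib_left)
    also have "(\<Sum>k\<in>UNIV. ?p * ((\<Sum>l\<in>UNIV. (V $ i $ l / ?p) * (?p * B $ l $ k)) * (V $ k $ j / ?p))) = (V ** B ** V) $ i $ j"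
      by (simp add: matrix_matrix_mult_def)
    finally show ?thesis .
  qed
  then show ?thesis by (simp add: vec_eq_iff V_def)
qed

text \<open>The weight \<open>n\<close> is at least 1 from the second term on, and evenness carries
  summability over to negative indices.\<close>

lemma summable_on_int_even:
  fixes c :: "int \<Rightarrow> real"
  assumes even: "\<And>i. c (- i) = c i" and s: "summable (\<lambda>n::nat. real n * \<bar>c (int n)\<bar>)"
  shows "(\<lambda>i. \<bar>c i\<bar>) summable_on UNIV"
proof -
  have "summable (\<lambda>n. \<bar>c (int n)\<bar>)"
    by (rule summable_comparison_test'[OF s, of 1]) (auto simp: mult_le_cancel_right1)
  then have 1: "(\<lambda>n. \<bar>c (int n)\<bar>) summable_on UNIV"
    by (subst summable_on_UNIV_nonneg_real_iff) auto
  have "(\<lambda>i. \<bar>c i\<bar>) summable_on range int"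
    using 1 by (subst summable_on_reindex) (auto simp: o_def)
  moreover have "(\<lambda>i. \<bar>c i\<bar>) summable_on range (\<lambda>n. - int n)"
    using 1 by (subst summable_on_reindex) (auto simp: o_def even inj_on_def)
  ultimately have "(\<lambda>i. \<bar>c i\<bar>) summable_on (range int \<union> range (\<lambda>n. - int n))"
    by (rule summable_on_union)
  moreover have "range int \<union> range (\<lambda>n. - int n) = UNIV"
  proof -
    have "i \<in> range int \<union> range (\<lambda>n. - int n)" for i
      by (cases i rule: int_cases2) auto
    then show ?thesis by blast
  qed
  ultimately show ?thesis by simp
qed

theorem theorem1:
  fixes x :: "nat \<Rightarrow> real^'d" and beta :: "real^'d"
    and H :: "real \<Rightarrow> complex^'d^'d"
    and M :: "'a measure" and E :: "int \<Rightarrow> 'a \<Rightarrow> real" and \<theta> :: "int \<Rightarrow> real" and \<sigma> :: real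
    and N :: "'b measure" and V :: "int \<Rightarrow> 'b \<Rightarrow> real" and \<eta> :: "int \<Rightarrow> real"
  assumes G1: "\<forall>i. filterlim (\<lambda>T. (s_norm x T i)^2) at_top sequentially"
    and G2: "\<forall>i. (\<lambda>T. (x T $ i)^2 / (s_norm x T i)^2) \<longlonglongrightarrow> 0"
    and G3: "\<forall>i j k. convergent (rho_pos x i j k)"
    and G4: "invertible (R_mat x 0)"
    and H_herm: "\<forall>w\<in>{-pi..pi}. \<forall>i j. H w $ i $ j = cnj (H w $ j $ i)"
    and H_psd: "\<forall>a b. - pi \<le> a \<and> a \<le> b \<and> b \<le> pi \<longrightarrow> (\<forall>v::complex^'d.
                  Im (\<Sum>i\<in>UNIV. \<Sum>j\<in>UNIV. cnj (v $ i) * (H b $ i $ j - H a $ i $ j) * v $ j) = 0 \<and>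
                  Re (\<Sum>i\<in>UNIV. \<Sum>j\<in>UNIV. cnj (v $ i) * (H b $ i $ j - H a $ i $ j) * v $ j) \<ge> 0)"
    and H_rep: "\<forall>k::int. \<forall>i j. has_RS_integral (\<lambda>w. exp (\<i> * of_int k * of_real w))
                  (\<lambda>w. H w $ i $ j) (- pi) pi (complex_of_real (R_mat x k $ i $ j))"
    and M_prob: "prob_space M"
    and E_meas: "\<forall>t. E t \<in> borel_measurable M"
    and E_sq: "\<forall>t. integrable M (\<lambda>\<omega>. (E t \<omega>)^2)"
    and E_indep: "prob_space.indep_vars M (\<lambda>_. borel) E UNIV"
    and E_mean: "\<forall>t. (\<integral>\<omega>. E t \<omega> \<partial>M) = 0"
    and E_var: "\<forall>t. (\<integral>\<omega>. (E t \<omega> - (\<integral>\<omega>'. E t \<omega>' \<partial>M))^2 \<partial>M) = \<sigma>^2"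
    and \<theta>_abs: "(\<lambda>i. \<bar>\<theta> i\<bar>) summable_on (UNIV :: int set)"
    and \<theta>_nz: "\<forall>w\<in>{-pi..pi}.
                 (\<Sum>\<^sub>\<infinity> i \<in> (UNIV :: int set). complex_of_real (\<theta> i) * exp (- \<i> * of_int i * of_real w)) \<noteq> 0"
    and M2: "((\<lambda>\<delta>::real. SUP t. \<integral>e. e^2 * indicator {e. \<bar>e\<bar> > \<delta>} e \<partial>(distr M borel (E t)))
               \<longlongrightarrow> 0) at_top"
    and N_prob: "prob_space N"
    and V_meas: "\<forall>t. V t \<in> borel_measurable N"
    and V_sq: "\<forall>t. integrable N (\<lambda>\<omega>. (V t \<omega>)^2)"
    and V_mean: "\<forall>t. (\<integral>\<omega>. V t \<omega> \<partial>N) = (\<integral>\<omega>. V 0 \<omega> \<partial>N)"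
    and V_cov: "\<forall>t i. cov N (V t) (V (t + i)) = \<eta> i"
    and M3: "\<forall>w\<in>{-pi..pi}. Im (spec_dens \<eta> w) = 0 \<and> Re (spec_dens \<eta> w) > 0"
    and M3_cont: "continuous_on {-pi..pi} (spec_dens \<eta>)"
    and M3_even: "\<forall>w\<in>{-pi..pi}. spec_dens \<eta> (- w) = spec_dens \<eta> w"
    and M4: "summable (\<lambda>i::nat. real i * \<bar>\<eta> (int i)\<bar>)"
  shows "\<exists>C :: real^'d^'d.
           (\<lambda>T. sandwich_cov x \<eta>
                  (\<lambda>p q. \<integral>\<omega>. lin_proc \<theta> E (int p) \<omega> * lin_proc \<theta> E (int q) \<omega> \<partial>M) T)
             \<longlonglongrightarrow> C \<and>
           (\<chi> i j. complex_of_real (C $ i $ j)) =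
             spectral_cov H (spec_dens \<eta>)
               (spec_dens (\<lambda>i. cov M (lin_proc \<theta> E 0) (lin_proc \<theta> E i))) \<and>
           conv_in_law M
             (\<lambda>T \<omega>. \<chi> i. s_norm x T i *
                (gls_est x \<eta> (\<lambda>t. x t \<bullet> beta + lin_proc \<theta> E (int t) \<omega>) T $ i - beta $ i))
             (mvn C)"
proof -
  \<comment> \<open>Stationarity moves the pair to the origin, and covariance is symmetric.\<close>
  have \<eta>_even: "\<eta> (- i) = \<eta> i" for i
  proof -
    have "\<eta> (- i) = cov N (V i) (V (i + - i))" by (rule V_cov[rule_format, symmetric])
    also have "\<dots> = cov N (V 0) (V (0 + i))" by (simp add: cov_def mult.commute)
    also have "\<dots> = \<eta> i" by (rule V_cov[rule_format])
    finally show ?thesis .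
  qed
  have \<eta>_sum: "(\<lambda>i. \<bar>\<eta> i\<bar>) summable_on UNIV"
    using \<eta>_even M4 by (rule summable_on_int_even)
  obtain w0 where w0: "w0 \<in> {-pi..pi}" "\<And>w. w \<in> {-pi..pi} \<Longrightarrow> Re (spec_dens \<eta> w0) \<le> Re (spec_dens \<eta> w)"
    using continuous_attains_inf[OF compact_Icc _ continuous_on_Re[OF M3_cont]] by auto
  \<comment> \<open>With \<open>symb = 2 * pi * spec_dens\<close>, twice this number is the minimum
    of the symbol, attained by continuity on the compact interval and positive there.\<close>
  define m where "m = pi * Re (spec_dens \<eta> w0)"
  have symb: "symb \<eta> w = of_real (2 * pi) * spec_dens \<eta> w" for w
    by (simp add: spec_dens_symb)
  interpret P: pos_symbol \<eta> m
  proof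
    show "m > 0" using M3 w0(1) by (simp add: m_def)
    show "2 * m \<le> Re (symb \<eta> w)" if "w \<in> {-pi..pi}" for w
      using w0(2)[OF that] by (simp add: symb m_def)
  qed (use \<eta>_even \<eta>_sum in auto)
  define F where "F i j w = H w $ i $ j" for i j w
  define K where "K i j = (Re (H pi $ i $ i - H (- pi) $ i $ i) + Re (H pi $ j $ j - H (- pi) $ j $ j)) / 2" for i j
  have ev_m: "\<forall>\<^sub>F T in sequentially. l1tail \<eta> T < m"
    using order_tendstoD(2)[OF P.l1tail_tendsto P.m_pos] .
  interpret G: gls_clt M E \<theta> \<sigma> \<eta> m "zreg x" "wreg x \<eta>" "\<lambda>k i j. R_mat x k $ i $ j" F K "\<lambda>i T. mxc (zreg x i T)"
  proof (intro gls_clt.intro noise.intro grenander.intro noise_axioms.intro grenander_axioms.intro gls_clt_axioms.intro)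
    show "prob_space M" by fact
    show "pos_symbol \<eta> m" ..
    show "(\<lambda>i. \<bar>\<theta> i\<bar>) summable_on UNIV" by fact
    show "((\<lambda>\<delta>::real. SUP t. \<integral>e. e\<^sup>2 * indicator {e. \<bar>e\<bar> > \<delta>} e \<partial>(distr M borel (E t))) \<longlongrightarrow> 0) at_top" by fact
    show "prob_space.indep_vars M (\<lambda>_. borel) E UNIV" by fact
    show "(\<integral>\<omega>. (E t \<omega>)\<^sup>2 \<partial>M) = \<sigma>\<^sup>2" for t using E_var E_mean by simp
    show "supp (zreg x i T) \<subseteq> {1..int T}" for i T by (rule supp_zreg)
    show "nrm (zreg x i T) \<le> 1" for i T by (rule nrm_zreg)
    show "\<bar>coef (zreg x i T) t\<bar> \<le> mxc (zreg x i T)" for i T t by (rule mxc_ge)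
    show "(\<lambda>T. mxc (zreg x i T)) \<longlonglongrightarrow> 0" for i using G1 G2 by (intro mxc_zreg_tendsto) auto
    show "(\<lambda>T. ip (zreg x i T) (mono1 (- k) 1 * zreg x j T)) \<longlonglongrightarrow> R_mat x k $ i $ j" for i j k
      using G3 by (intro ip_zreg_tendsto) auto
    show "has_RS_integral (\<lambda>w. exp (\<i> * of_int k * of_real w)) (F i j) (- pi) pi (of_real (R_mat x k $ i $ j))" for i j k
      unfolding F_def using H_rep by blast
    show "RS_var_le (F i j) (- pi) pi (K i j)" for i j
      unfolding F_def K_def
    proof (rule RS_var_le_psd_increments)
      show "H w $ i $ j = cnj (H w $ j $ i)" if "w \<in> {- pi..pi}" for w i j
        using H_herm that by blast
      show "0 \<le> Re (\<Sum>i\<in>UNIV. \<Sum>j\<in>UNIV. cnj (v $ i) * (H w $ i $ j - H u $ i $ j) * v $ j)"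
        if "- pi \<le> u" "u \<le> w" "w \<le> pi" for u w v
        using H_psd that by blast
    qed
    show "supp (wreg x \<eta> i T) \<subseteq> {1..int T}" for i T by (rule supp_wreg)
    show "\<forall>\<^sub>F T in sequentially. \<forall>t\<in>{1..int T}. coef (trunc \<eta> T * wreg x \<eta> i T) t = coef (zreg x i T) t" for i
      using ev_m by eventually_elim (auto intro: P.wreg_eq)
    show "invertible (\<chi> i j. R_mat x 0 $ i $ j)" using G4 by (simp add: vec_lambda_eta)
  qed (use E_meas E_sq E_mean in auto)
  have Fs: "F i j = (\<lambda>w. H w $ i $ j)" for i j by (simp add: F_def fun_eq_iff)
  let ?U = "lin_proc \<theta> E"
  have cov: "(\<lambda>i. cov M (?U 0) (?U i)) = G.\<gamma>" by (simp add: G.cov_U fun_eq_iff)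
  have "(\<lambda>T. sandwich_cov x \<eta> (\<lambda>p q. \<integral>\<omega>. ?U (int p) \<omega> * ?U (int q) \<omega> \<partial>M) T) \<longlonglongrightarrow> G.Cl"
  proof (rule Lim_transform_eventually[OF G.sandwich_lim])
    show "\<forall>\<^sub>F T in sequentially. matrix_inv (G.At T) ** G.Bt T ** matrix_inv (G.At T) =
       sandwich_cov x \<eta> (\<lambda>p q. \<integral>\<omega>. ?U (int p) \<omega> * ?U (int q) \<omega> \<partial>M) T"
      using ev_m
    proof eventually_elim
      case (elim T)
      show ?case
        unfolding sandwich_cov_def Let_def G.U_mult_expectation design_entry G.At_def[symmetric]
        by (subst noise_entry[OF G.even_l1_\<gamma>]) (use elim in \<open>auto simp: G.Bt_def intro: P.toep_inv_sym\<close>)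
    qed
  qed
  moreover have "(\<chi> i j. complex_of_real (G.Cl $ i $ j)) =
      spectral_cov H (spec_dens \<eta>) (spec_dens (\<lambda>i. cov M (?U 0) (?U i)))"
    unfolding cov G.Cl_def
    by (rule spectral_cov_eqI[symmetric, OF G.Al_RS[unfolded Fs] G.Bl_RS[unfolded Fs] G.Al_invertible])
  moreover have "conv_in_law M
      (\<lambda>T \<omega>. \<chi> i. s_norm x T i * (gls_est x \<eta> (\<lambda>t. x t \<bullet> beta + ?U (int t) \<omega>) T $ i - beta $ i)) (mvn G.Cl)"
  proof -
    have s_ev: "\<forall>\<^sub>F T in sequentially. \<forall>i. (s_norm x T i)\<^sup>2 > 0"
      using G1 by (intro eventually_all_finite) (simp only: filterlim_at_top_dense)
    \<comment> \<open>The closed form of the error needs the Toeplitz inverse, nonzero norms and an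
      invertible design form, all available for large \<open>T\<close> only; convergence in law
      depends on no initial segment.\<close>
    have eq: "\<forall>\<^sub>F T in sequentially. G.XX T =
       (\<lambda>\<omega>. \<chi> i. s_norm x T i * (gls_est x \<eta> (\<lambda>t. x t \<bullet> beta + ?U (int t) \<omega>) T $ i - beta $ i))"
      using ev_m s_ev G.At_invertible
    proof eventually_elim
      case (elim T)
      show ?case
      proof
        fix \<omega>
        have W: "G.W (wreg x \<eta> j T) \<omega> = (\<Sum>q=1..T. coef (wreg x \<eta> j T) (int q) * ?U (int q) \<omega>)" for j
          unfolding G.W_superset[OF finite_atLeastAtMost_int supp_wreg] sum_int_shift ..
        have "(\<chi> i. s_norm x T i * (gls_est x \<eta> (\<lambda>t. x t \<bullet> beta + ?U (int t) \<omega>) T $ i - beta $ i)) =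
          matrix_inv (G.At T) *v (\<chi> j. \<Sum>q=1..T. coef (wreg x \<eta> j T) (int q) * ?U (int q) \<omega>)"
          unfolding G.At_def
          by (rule gls_error_eq) (use elim in \<open>auto simp: G.At_def intro: P.toep_inv_sym\<close>)
        then show "G.XX T \<omega> = (\<chi> i. s_norm x T i * (gls_est x \<eta> (\<lambda>t. x t \<bullet> beta + ?U (int t) \<omega>) T $ i - beta $ i))"
          by (simp add: G.XX_def W)
      qed
    qed
    show ?thesis
      unfolding conv_in_law_def
    proof (intro allI impI)
      fix g :: "real^'d \<Rightarrow> real" assume "continuous_on UNIV g \<and> bounded (range g)"
      then have "(\<lambda>T. \<integral>\<omega>. g (G.XX T \<omega>) \<partial>M) \<longlonglongrightarrow> (\<integral>z. g z \<partial>mvn G.Cl)"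
        using G.XX_conv unfolding conv_in_law_def by blast
      then show "(\<lambda>T. \<integral>\<omega>. g (\<chi> i. s_norm x T i * (gls_est x \<eta> (\<lambda>t. x t \<bullet> beta + ?U (int t) \<omega>) T $ i - beta $ i)) \<partial>M)
        \<longlonglongrightarrow> (\<integral>z. g z \<partial>mvn G.Cl)"
        by (rule Lim_transform_eventually) (use eq in \<open>eventually_elim, simp\<close>)
    qed
  qed
  ultimately show ?thesis by blast
qed

end
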